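(* Let $\mathbb{K}$ be an algebraically closed field of characteristic $p>0$. Let $\Gamma=\langle\gamma_1,\ldots,\gamma_n\rangle_{\mathbb{N}}\subseteq\mathbb{Z}^d$ be a semigroup such that $\langle\gamma_1,\ldots,\gamma_n\rangle_{\mathbb{Z}}=\mathbb{Z}^d$, and let $X_\Gamma\subseteq\mathbb{K}^n$ be the (not necessarily normal) toric variety defined by $\Gamma$. Then the Nash blowup $X_\Gamma^*$ of $X_\Gamma$ is isomorphic to the blowup $\mathrm{Bl}_{\mathcal{J}_p}X_\Gamma$ of $X_\Gamma$ along its logarithmic Jacobian ideal modulo $p$, $\mathcal{J}_p$.
   Context: Notation: $\langle\gamma_1,\ldots,\gamma_n\rangle_{\mathbb{N}}$ is the set of all $\mathbb{N}$-linear combinations (with $0\in\mathbb{N}$) of $\gamma_1,\ldots,\gamma_n$, and $\langle\gamma_1,\ldots,\gamma_n\rangle_{\mathbb{Z}}$ is the subgroup they generate. Toric variety: given $\Gamma\subseteq\mathbb{Z}^d$ a semigroup generated by $\{\gamma_1,\ldots,\gamma_n\}$, consider the $\mathbb{K}$-algebra homomorphism $\pi_\Gamma:\mathbb{K}[x_1,\ldots,x_n]\to\mathbb{K}[t_1^{\pm},\ldots,t_d^{\pm}]$, $x_i\mapsto t^{\gamma_i}$, and let $I_\Gamma=\ker\pi_\Gamma$. The toric variety defined by $\Gamma$ is $X_\Gamma=\mathbf{V}(I_\Gamma)\subseteq\mathbb{K}^n$ (normality is not assumed). Its coordinate ring is denoted $\mathbb{K}[t^\Gamma]$, identified with the image of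 $\pi_\Gamma$, i.e. the subalgebra of $\mathbb{K}[t_1^{\pm},\ldots,t_d^{\pm}]$ spanned by the monomials $t^\gamma$, $\gamma\in\Gamma$. Logarithmic Jacobian ideal modulo $p$: $$\mathcal{J}_p=\langle t^{\gamma_{i_1}+\cdots+\gamma_{i_d}}\mid \det(\gamma_{i_1}\cdots\gamma_{i_d})\neq 0 \bmod p,\ 1\le i_1<\cdots<i_d\le n\rangle\subseteq\mathbb{K}[t^\Gamma],$$ where $(\gamma_{i_1}\cdots\gamma_{i_d})$ is the $d\times d$ integer matrix with the given columns. Nash blowup: for an equidimensional algebraic variety $X\subseteq\mathbb{K}^n$ of dimension $d$, consider the Gauss map $G:X\setminus\mathrm{Sing}(X)\to\mathrm{Gr}(d,n)$, $x\mapsto T_xX$, where $\mathrm{Gr}(d,n)$ is the Grassmannian of $d$-dimensional vector subspaces of $\mathbb{K}^n$ and $T_xX$ is the tangent space to $X$ at $x$. Let $X^*$ be the Zariski closure of the graph of $G$ in $X\times\mathrm{Gr}(d,n)$, and let $\nu:X^*\to X$ be the restriction of the projection $X\times \mathrm{Gr}(d,n)\to X$. The pair $(X^*,\nu)$ is the Nash blowup of $X$. *)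

theory Defs
  imports
    "HOL-Analysis.Analysis"
    "HOL-Library.Poly_Mapping"
    "HOL-Computational_Algebra.Computational_Algebra"
begin

section \<open>Polynomials and affine algebraic sets\<close>

text \<open>
  The polynomial ring over \<open>'k\<close> in finitely many variables indexed by \<open>'v\<close>, and the Laurent
  polynomial ring \<open>K[t\<^sub>1\<^sup>\<plusminus>, \<dots>, t\<^sub>d\<^sup>\<plusminus>]\<close>, as the group algebra of the exponent lattice
  \<open>int ^ 'd\<close>. Both carry the convolution product of finitely supported functions.
\<close>

type_synonym ('v, 'k) mpoly = "('v \<Rightarrow>\<^sub>0 nat) \<Rightarrow>\<^sub>0 'k"
type_synonym ('d, 'k) laurent = "(int ^ 'd) \<Rightarrow>\<^sub>0 'k"

text \<open>The algebra homomorphism that maps scalars by \<open>c\<close> and the variable \<open>v\<close> to \<open>g v\<close>.\<close>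

definition poly_subst ::
    "('k::zero \<Rightarrow> 'a::comm_semiring_1) \<Rightarrow> ('v::finite \<Rightarrow> 'a) \<Rightarrow> ('v, 'k) mpoly \<Rightarrow> 'a" where
  "poly_subst c g f =
     (\<Sum>m\<in>Poly_Mapping.keys f.
        c (Poly_Mapping.lookup f m) * (\<Prod>v\<in>UNIV. g v ^ Poly_Mapping.lookup m v))"

definition eval_poly :: "('v::finite \<Rightarrow> 'k::comm_semiring_1) \<Rightarrow> ('v, 'k) mpoly \<Rightarrow> 'k" where
  "eval_poly x f = poly_subst (\<lambda>a. a) x f"

definition partial_deriv :: "'v \<Rightarrow> ('v, 'k::comm_semiring_1) mpoly \<Rightarrow> ('v, 'k) mpoly" where
  "partial_deriv v f =
     (\<Sum>m\<in>Poly_Mapping.keys f.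
        Poly_Mapping.single (m - Poly_Mapping.single v 1)
          (of_nat (Poly_Mapping.lookup m v) * Poly_Mapping.lookup f m))"

definition zero_set :: "('n::finite, 'k::comm_semiring_1) mpoly set \<Rightarrow> ('k ^ 'n) set" where
  "zero_set I = {x. \<forall>f\<in>I. eval_poly (($) x) f = 0}"

definition vanishing_ideal :: "('k::comm_semiring_1 ^ 'n::finite) set \<Rightarrow> ('n, 'k) mpoly set" where
  "vanishing_ideal X = {f. \<forall>x\<in>X. eval_poly (($) x) f = 0}"

definition irreducible_algebraic_set :: "('k::comm_semiring_1 ^ 'n::finite) set \<Rightarrow> bool" where
  "irreducible_algebraic_set Z \<longleftrightarrow>
     Z \<in> range zero_set \<and> Z \<noteq> {} \<and>
     (\<forall>A\<in>range zero_set. \<forall>B\<in>range zero_set. Z \<subseteq> A \<union> B \<longrightarrow> Z \<subseteq> A \<or> Z \<subseteq> B)"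

text \<open>Krull dimension of an algebraic set in the Zariski topology.\<close>

definition alg_dim :: "('k::comm_semiring_1 ^ 'n::finite) set \<Rightarrow> enat" where
  "alg_dim X = Sup {enat m | m. \<exists>Z :: nat \<Rightarrow> ('k ^ 'n) set.
     (\<forall>i\<le>m. irreducible_algebraic_set (Z i) \<and> Z i \<subseteq> X) \<and> (\<forall>i<m. Z i \<subset> Z (Suc i))}"

definition tangent_space :: "('k::field ^ 'n::finite) set \<Rightarrow> 'k ^ 'n \<Rightarrow> ('k ^ 'n) set" where
  "tangent_space X x =
     {v. \<forall>f\<in>vanishing_ideal X. (\<Sum>i\<in>UNIV. eval_poly (($) x) (partial_deriv i f) * v $ i) = 0}"

text \<open>For equidimensional \<open>X\<close> only: the dimension of \<open>X\<close> is used in place of that at \<open>x\<close>.\<close>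

definition singular_locus :: "('k::field ^ 'n::finite) set \<Rightarrow> ('k ^ 'n) set" where
  "singular_locus X = {x\<in>X. enat (vec.dim (tangent_space X x)) \<noteq> alg_dim X}"


section \<open>Subvarieties of products of an affine space with a projective space or a Grassmannian\<close>

text \<open>
  A variety is a set \<open>Z\<close> of points together with \<open>co\<close>, which assigns to every point the set of
  its coordinate tuples \<open>(x, y)\<close>: affine coordinates \<open>x\<close>, and homogeneous coordinates \<open>y\<close> in all
  their possible scalings. Polynomials in \<open>(x, y)\<close> have the variables \<open>Inl i\<close> for \<open>x\<close> and
  \<open>Inr j\<close> for \<open>y\<close>.
\<close>

type_synonym ('a, 'k, 'n, 'i) coords = "'a \<Rightarrow> (('k ^ 'n) \<times> ('k ^ 'i)) set"

definition eval_at ::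
    "('k::comm_semiring_1 ^ 'n::finite) \<times> ('k ^ 'i::finite) \<Rightarrow> ('n + 'i, 'k) mpoly \<Rightarrow> 'k" where
  "eval_at z f = eval_poly (case_sum (($) (fst z)) (($) (snd z))) f"

definition homogeneous_snd :: "nat \<Rightarrow> ('n + 'i::finite, 'k::zero) mpoly \<Rightarrow> bool" where
  "homogeneous_snd e f \<longleftrightarrow>
     (\<forall>m\<in>Poly_Mapping.keys f. (\<Sum>j\<in>UNIV. Poly_Mapping.lookup m (Inr j)) = e)"

definition zariski ::
    "('a, 'k::comm_semiring_1, 'n::finite, 'i::finite) coords \<Rightarrow> 'a set \<Rightarrow> 'a topology" where
  "zariski co Z = topology_generated_by
     {{P\<in>Z. \<exists>z\<in>co P. eval_at z f \<noteq> 0} | f. \<exists>e. homogeneous_snd e f}"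

text \<open>Regular functions on the open subset \<open>U\<close> of \<open>Z\<close>; values outside \<open>U\<close> are irrelevant.\<close>

definition regular_on ::
    "('a, 'k::field, 'n::finite, 'i::finite) coords \<Rightarrow> 'a set \<Rightarrow> 'a set \<Rightarrow> ('a \<Rightarrow> 'k) \<Rightarrow> bool" where
  "regular_on co Z U h \<longleftrightarrow>
     (\<forall>P\<in>U. \<exists>V f g e. openin (zariski co Z) V \<and> P \<in> V \<and> V \<subseteq> U \<and>
        homogeneous_snd e f \<and> homogeneous_snd e g \<and>
        (\<forall>Q\<in>V. \<forall>z\<in>co Q. eval_at z g \<noteq> 0 \<and> h Q = eval_at z f / eval_at z g))"

definition morphism ::
    "('a, 'k::field, 'n::finite, 'i::finite) coords \<Rightarrow> 'a set \<Rightarrow>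
     ('b, 'k, 'm::finite, 'j::finite) coords \<Rightarrow> 'b set \<Rightarrow> ('a \<Rightarrow> 'b) \<Rightarrow> bool" where
  "morphism co Z co' Z' \<phi> \<longleftrightarrow>
     continuous_map (zariski co Z) (zariski co' Z') \<phi> \<and>
     (\<forall>V h. openin (zariski co' Z') V \<and> regular_on co' Z' V h \<longrightarrow>
        regular_on co Z {P\<in>Z. \<phi> P \<in> V} (h \<circ> \<phi>))"

text \<open>
  Isomorphism over a base \<open>X\<close>, for varieties in products \<open>X \<times> _\<close> whose structure map to \<open>X\<close> is the
  first projection.
\<close>

definition isomorphic_over_base ::
    "('x \<times> 'a, 'k::field, 'n::finite, 'i::finite) coords \<Rightarrow> ('x \<times> 'a) set \<Rightarrow>
     ('x \<times> 'b, 'k, 'm::finite, 'j::finite) coords \<Rightarrow> ('x \<times> 'b) set \<Rightarrow> bool" where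
  "isomorphic_over_base co Z co' Z' \<longleftrightarrow>
     (\<exists>\<phi> \<psi>. morphism co Z co' Z' \<phi> \<and> morphism co' Z' co Z \<psi> \<and>
        (\<forall>P\<in>Z. \<psi> (\<phi> P) = P \<and> fst (\<phi> P) = fst P) \<and>
        (\<forall>Q\<in>Z'. \<phi> (\<psi> Q) = Q \<and> fst (\<psi> Q) = fst Q))"

definition Gr :: "nat \<Rightarrow> ('k::field ^ 'n::finite) set set" where
  "Gr d = {W. vec.subspace W \<and> vec.dim W = d}"

text \<open>
  The projective space of lines in \<open>'k ^ 'r\<close> is \<open>Gr 1\<close>; homogeneous coordinates of a line are its
  nonzero vectors.
\<close>

definition proj_coords :: "(('k ^ 'n) \<times> ('k ^ 'r) set, 'k::field, 'n::finite, 'r::finite) coords" where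
  "proj_coords P = {(fst P, y) | y. y \<in> snd P \<and> y \<noteq> 0}"

text \<open>
  Pluecker coordinates of a \<open>d\<close>-dimensional subspace \<open>W\<close>, where \<open>d = CARD('d)\<close>: the maximal minors
  of a basis of \<open>W\<close>. The minors are indexed by all maps \<open>'d \<Rightarrow> 'n\<close>, not only the increasing ones;
  the additional coordinates are zero or, up to sign, repeat the others. Passing to another basis
  multiplies all minors by the same arbitrary nonzero scalar.
\<close>

definition plucker_coords ::
    "(('k ^ 'n) \<times> ('k ^ 'n) set, 'k::field, 'n::finite, 'd::finite \<Rightarrow> 'n) coords" where
  "plucker_coords P =
     {(fst P, \<chi> i. det (\<chi> a b. B a $ i b)) | B :: 'd \<Rightarrow> 'k ^ 'n.
        inj B \<and> vec.independent (range B) \<and> vec.span (range B) = snd P}"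


section \<open>Nash blowup and blowup along an ideal\<close>

text \<open>The Nash blowup of an equidimensional algebraic set \<open>X\<close> of dimension \<open>CARD('d)\<close>.\<close>

definition nash_blowup ::
    "'d::finite itself \<Rightarrow> ('k::field ^ 'n::finite) set \<Rightarrow> (('k ^ 'n) \<times> ('k ^ 'n) set) set" where
  "nash_blowup d X =
     zariski (plucker_coords :: (_, _, _, 'd \<Rightarrow> 'n) coords) (X \<times> Gr CARD('d)) closure_of
       {(x, tangent_space X x) | x. x \<in> X - singular_locus X}"

text \<open>
  The blowup of \<open>X\<close> along the ideal of its coordinate ring generated by the restrictions of the
  polynomials \<open>F j\<close>: the closure of the graph of the map to projective space that they define away
  from their common zeros. Up to isomorphism over \<open>X\<close> it depends on the ideal only.
\<close>

definition blowup ::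
    "('k::field ^ 'n::finite) set \<Rightarrow> ('r::finite \<Rightarrow> ('n, 'k) mpoly) \<Rightarrow>
     (('k ^ 'n) \<times> ('k ^ 'r) set) set" where
  "blowup X F =
     zariski proj_coords (X \<times> Gr 1) closure_of
       {(x, vec.span {\<chi> j. eval_poly (($) x) (F j)}) | x.
          x \<in> X \<and> (\<exists>j. eval_poly (($) x) (F j) \<noteq> 0)}"


section \<open>Toric varieties\<close>

definition int_span :: "('n::finite \<Rightarrow> int ^ 'd::finite) \<Rightarrow> (int ^ 'd) set" where
  "int_span \<gamma> = {\<Sum>j\<in>UNIV. c j *s \<gamma> j | c. True}"

definition toric_hom ::
    "('n::finite \<Rightarrow> int ^ 'd::finite) \<Rightarrow> ('n, 'k::comm_ring_1) mpoly \<Rightarrow> ('d, 'k) laurent" where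
  "toric_hom \<gamma> = poly_subst (Poly_Mapping.single 0) (\<lambda>j. Poly_Mapping.single (\<gamma> j) 1)"

definition toric_variety ::
    "('n::finite \<Rightarrow> int ^ 'd::finite) \<Rightarrow> ('k::comm_ring_1 ^ 'n) set" where
  "toric_variety \<gamma> = zero_set {f. toric_hom \<gamma> f = 0}"

text \<open>The coordinate ring \<open>K[t\<^sup>\<Gamma>]\<close>, as a subring of the Laurent polynomials.\<close>

definition toric_ring :: "('n::finite \<Rightarrow> int ^ 'd::finite) \<Rightarrow> ('d, 'k::comm_ring_1) laurent set" where
  "toric_ring \<gamma> = range (toric_hom \<gamma>)"

text \<open>The ideal generated by \<open>S\<close> in a subring \<open>R\<close> of the ambient ring.\<close>

definition ideal_in :: "'a::comm_ring_1 set \<Rightarrow> 'a set \<Rightarrow> 'a set" where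
  "ideal_in R S = {\<Sum>s\<in>T. c s * s | T c. finite T \<and> T \<subseteq> S \<and> c ` T \<subseteq> R}"

definition log_jacobian_ideal ::
    "nat \<Rightarrow> ('n::{finite,linorder} \<Rightarrow> int ^ 'd::{finite,linorder}) \<Rightarrow>
     ('d, 'k::comm_ring_1) laurent set" where
  "log_jacobian_ideal p \<gamma> = ideal_in (toric_ring \<gamma>)
     {Poly_Mapping.single (\<Sum>b\<in>UNIV. \<gamma> (i b)) 1 | i :: 'd \<Rightarrow> 'n.
        strict_mono i \<and> det (\<chi> a b. \<gamma> (i b) $ a) mod int p \<noteq> 0}"

end

theory Submission
  imports Defs
begin

text \<open>
  Let \<open>G\<close> be the family of the products of \<open>d\<close> coordinates \<open>x $ i b\<close>, each multiplied with the image
  in the field of the determinant of the exponent vectors \<open>\<gamma> (i b)\<close>. At a point \<open>x\<close> of the torus, the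
  tangent space of \<open>X\<close> is spanned by the logarithmic vector fields, so that \<open>G x\<close> is its tuple of
  Pluecker coordinates. On \<open>X\<close>, both \<open>F\<close> and \<open>G\<close> generate the logarithmic Jacobian ideal, hence
  \<open>G = a F\<close> and \<open>F = b G\<close> with matrices \<open>a\<close>, \<open>b\<close> of polynomials. Both blowups are the closures of
  their parts over the torus, and \<open>y \<mapsto> b y\<close>, \<open>z \<mapsto> a z\<close> are mutually inverse there, which is a
  condition that is polynomial in \<open>x\<close> and linear in the homogeneous coordinates. So these maps are
  mutually inverse on the closures too; the Pluecker relations ensure that \<open>a z\<close> comes from a subspace.

  That the closure of the graph of the Gauss map is determined over the torus requires that torus
  points are smooth, i.e. that the Krull dimension of \<open>X\<close> is \<open>d\<close>, and that near an arbitrary smooth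
  point the Pluecker coordinates of the tangent space are given by polynomials.
\<close>

text \<open>The characteristic enters twice. The exponent vectors must keep rank
  \<open>CARD('d)\<close> after reduction to the field; this holds because they generate the lattice
  over the integers, so that the integer relations producing the unit vectors survive reduction mod
  \<open>p\<close> (full rational rank would not do). And the determinant in front of a monomial is
  a unit or zero in the field according to its residue mod \<open>p\<close>, which is why the ideal
  modulo \<open>p\<close> appears. Points of a closure are recognised by functions that are
  homogeneous in the second block of variables, so everything is an identity that spreads from the
  torus. No charts are needed: each map is given by one matrix everywhere, and an image tuple cannot
  vanish, since the other matrix carries it back to a nonzero tuple. As smoothness compares the
  tangent space with the Krull dimension, the latter has to be computed. A flag of subtori bounds it
  from below; from above it is bounded by counting monomials in \<open>k\<close> functions against
  lattice points in a box.\<close>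

no_notation fps_nth (infixl "$" 75)


subsection \<open>Polynomial functions\<close>

lemma poly_mapping_eq_sum_single:
  "f = (\<Sum>m\<in>Poly_Mapping.keys f. Poly_Mapping.single m (Poly_Mapping.lookup f m))"
proof (rule poly_mapping_eqI)
  fix k
  have "Poly_Mapping.lookup (\<Sum>m\<in>Poly_Mapping.keys f. Poly_Mapping.single m (Poly_Mapping.lookup f m)) k
      = (\<Sum>m\<in>Poly_Mapping.keys f. if m = k then Poly_Mapping.lookup f k else 0)"
    unfolding lookup_sum by (intro sum.cong) (auto simp: lookup_single when_def)
  also have "\<dots> = Poly_Mapping.lookup f k"
    by (simp add: in_keys_iff)
  finally show "Poly_Mapping.lookup f k =
    Poly_Mapping.lookup (\<Sum>m\<in>Poly_Mapping.keys f. Poly_Mapping.single m (Poly_Mapping.lookup f m)) k"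
    by simp
qed

lemma poly_mapping_add_induct [case_names single add]:
  fixes f :: "'m \<Rightarrow>\<^sub>0 'k::comm_monoid_add"
  assumes single: "\<And>m a. P (Poly_Mapping.single m a)"
    and add: "\<And>f g. P f \<Longrightarrow> P g \<Longrightarrow> P (f + g)"
  shows "P f"
proof -
  have "finite S \<Longrightarrow> P (\<Sum>m\<in>S. Poly_Mapping.single m (Poly_Mapping.lookup f m))" for S
  proof (induction S rule: finite_induct)
    case empty
    show ?case using single[of undefined 0] by simp
  next
    case (insert x S)
    then show ?case using single add by simp
  qed
  then show ?thesis
    by (metis finite_keys poly_mapping_eq_sum_single)
qed

text \<open>Two coefficient maps are in use: evaluation at a point keeps the coefficients,
  \<open>toric_hom\<close> embeds them as constant Laurent polynomials.\<close>

locale semiring_hom =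
  fixes c :: "'k::comm_semiring_1 \<Rightarrow> 'a::comm_semiring_1"
  assumes zero: "c 0 = 0" and one: "c 1 = 1"
    and add: "c (a + b) = c a + c b" and mult: "c (a * b) = c a * c b"
begin

lemma poly_subst_superset:
  assumes "finite S" "Poly_Mapping.keys f \<subseteq> S"
  shows "poly_subst c g f =
    (\<Sum>m\<in>S. c (Poly_Mapping.lookup f m) * (\<Prod>v\<in>UNIV. g v ^ Poly_Mapping.lookup m v))"
  unfolding poly_subst_def using assms
  by (intro sum.mono_neutral_left) (auto simp: in_keys_iff zero)

lemma poly_subst_add: "poly_subst c g (f + h) = poly_subst c g f + poly_subst c g h"
proof -
  let ?S = "Poly_Mapping.keys f \<union> Poly_Mapping.keys h"
  have "Poly_Mapping.keys (f + h) \<subseteq> ?S" by (rule keys_add)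
  then show ?thesis
    by (subst (1 2 3) poly_subst_superset[of ?S])
       (auto simp: lookup_add add distrib_right sum.distrib)
qed

lemma poly_subst_single:
  "poly_subst c g (Poly_Mapping.single m a) = c a * (\<Prod>v\<in>UNIV. g v ^ Poly_Mapping.lookup m v)"
  by (subst poly_subst_superset[of "{m}"]) auto

lemma poly_subst_zero [simp]: "poly_subst c g 0 = 0"
  by (simp add: poly_subst_def)

lemma poly_subst_sum: "poly_subst c g (sum f S) = (\<Sum>s\<in>S. poly_subst c g (f s))"
  by (induction S rule: infinite_finite_induct) (auto simp: poly_subst_add)

lemma poly_subst_mult: "poly_subst c g (f * h) = poly_subst c g f * poly_subst c g h"
proof (induction f rule: poly_mapping_add_induct)
  case (single m a)
  show ?case
  proof (induction h rule: poly_mapping_add_induct)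
    case (single m' a')
    then show ?case
      by (simp add: mult_single poly_subst_single mult lookup_add power_add prod.distrib ac_simps)
  next
    case (add f g)
    then show ?case by (simp add: distrib_left poly_subst_add)
  qed
next
  case (add f1 f2)
  then show ?case by (simp add: distrib_right poly_subst_add)
qed

lemma poly_subst_const: "poly_subst c g (Poly_Mapping.single 0 a) = c a"
  by (simp add: poly_subst_single)

lemma poly_subst_var: "poly_subst c g (Poly_Mapping.single (Poly_Mapping.single v 1) 1) = g v"
proof -
  have "(\<Prod>w\<in>UNIV. g w ^ Poly_Mapping.lookup (Poly_Mapping.single v (1::nat)) w)
      = (\<Prod>w\<in>UNIV. if w = v then g v else 1)"
    by (intro prod.cong) (auto simp: lookup_single when_def)
  then show ?thesis by (simp add: poly_subst_single one)
qed

end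

interpretation coeff_id: semiring_hom "\<lambda>a :: 'k::comm_semiring_1. a"
  by unfold_locales auto

interpretation coeff_single:
  semiring_hom "Poly_Mapping.single 0 :: 'k::comm_ring_1 \<Rightarrow> ('d::finite, 'k) laurent"
  by unfold_locales (auto simp: single_add mult_single)

lemmas eval_poly_simps =
  coeff_id.poly_subst_add[folded eval_poly_def] coeff_id.poly_subst_mult[folded eval_poly_def]
  coeff_id.poly_subst_zero[folded eval_poly_def] coeff_id.poly_subst_sum[folded eval_poly_def]
  coeff_id.poly_subst_const[folded eval_poly_def] coeff_id.poly_subst_var[folded eval_poly_def]
  coeff_id.poly_subst_single[folded eval_poly_def]

lemma eval_poly_diff:
  fixes f :: "('v::finite, 'k::comm_ring_1) mpoly"
  shows "eval_poly x (f - g) = eval_poly x f - eval_poly x g"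
  by (metis add_diff_cancel_right' diff_add_cancel eval_poly_simps(1))

text \<open>Closures depend on values only, and with functions instead of polynomials, determinants
  and substitutions are recognised as polynomial by closure rules.\<close>

definition pfun :: "(('k::comm_semiring_1 ^ 'n::finite) \<Rightarrow> 'k) \<Rightarrow> bool" where
  "pfun h \<longleftrightarrow> (\<exists>f. \<forall>x. eval_poly (($) x) f = h x)"

lemma pfun_eval [intro]: "pfun (\<lambda>x. eval_poly (($) x) f)"
  by (auto simp: pfun_def)

lemma pfun_const [intro]: "pfun (\<lambda>_. a)"
  unfolding pfun_def by (metis eval_poly_simps(5))

lemma pfun_var [intro]: "pfun (\<lambda>x. x $ i)"
  unfolding pfun_def by (metis eval_poly_simps(6))

lemma pfun_add [intro]: "pfun f \<Longrightarrow> pfun g \<Longrightarrow> pfun (\<lambda>x. f x + g x)"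
  unfolding pfun_def by (metis eval_poly_simps(1))

lemma pfun_mult [intro]: "pfun f \<Longrightarrow> pfun g \<Longrightarrow> pfun (\<lambda>x. f x * g x)"
  unfolding pfun_def by (metis eval_poly_simps(2))

lemma pfun_sum: "(\<And>i. i \<in> S \<Longrightarrow> pfun (f i)) \<Longrightarrow> pfun (\<lambda>x. \<Sum>i\<in>S. f i x)"
  by (induction S rule: infinite_finite_induct) auto

lemma pfun_prod: "(\<And>i. i \<in> S \<Longrightarrow> pfun (f i)) \<Longrightarrow> pfun (\<lambda>x. \<Prod>i\<in>S. f i x)"
  by (induction S rule: infinite_finite_induct) auto

lemma pfun_power: "pfun f \<Longrightarrow> pfun (\<lambda>x. f x ^ m)"
  by (induction m) auto

lemma pfun_diff:
  fixes f :: "('k::comm_ring_1 ^ 'n::finite) \<Rightarrow> 'k"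
  shows "pfun f \<Longrightarrow> pfun g \<Longrightarrow> pfun (\<lambda>x. f x - g x)"
  using pfun_add[of f "\<lambda>x. -1 * g x"] pfun_mult[OF pfun_const, of g "-1"] by simp

lemma pfun_det:
  fixes A :: "('k::comm_ring_1 ^ 'n::finite) \<Rightarrow> 'k ^ 'm ^ 'm"
  assumes "\<And>i j. pfun (\<lambda>x. A x $ i $ j)"
  shows "pfun (\<lambda>x. det (A x))"
  unfolding det_def by (intro pfun_sum pfun_mult pfun_const pfun_prod assms)

lemma pfun_subst:
  assumes "\<And>v. pfun (g v)"
  shows "pfun (\<lambda>x. eval_poly (\<lambda>v. g v x) f)"
  unfolding eval_poly_def poly_subst_def
  by (intro pfun_sum pfun_mult pfun_const pfun_prod pfun_power assms)

text \<open>The degree counts the second block of variables only. With a fixed degree, vanishing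
  does not depend on the scaling of the homogeneous coordinates.\<close>

definition hfun :: "nat \<Rightarrow> (('k::comm_semiring_1 ^ 'n::finite) \<times> ('k ^ 'i::finite) \<Rightarrow> 'k) \<Rightarrow> bool" where
  "hfun e h \<longleftrightarrow> (\<exists>f. homogeneous_snd e f \<and> (\<forall>z. eval_at z f = h z))"

lemma hfun_eval [intro]: "homogeneous_snd e f \<Longrightarrow> hfun e (\<lambda>z. eval_at z f)"
  by (auto simp: hfun_def)

lemma hfun_const [intro]: "hfun 0 (\<lambda>_. a)"
  unfolding hfun_def
proof (intro exI conjI allI)
  show "homogeneous_snd 0 (Poly_Mapping.single 0 a)"
    by (auto simp: homogeneous_snd_def)
qed (simp add: eval_at_def eval_poly_simps)

lemma hfun_fst [intro]: "hfun 0 (\<lambda>z. fst z $ i)"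
  unfolding hfun_def
proof (intro exI conjI allI)
  show "homogeneous_snd 0 (Poly_Mapping.single (Poly_Mapping.single (Inl i) 1) 1)"
    by (auto simp: homogeneous_snd_def lookup_single)
qed (unfold eval_at_def eval_poly_simps(6), simp)

lemma hfun_snd [intro]: "hfun 1 (\<lambda>z. snd z $ i)"
  unfolding hfun_def
proof (intro exI conjI allI)
  show "homogeneous_snd 1 (Poly_Mapping.single (Poly_Mapping.single (Inr i) 1) 1)"
    by (auto simp: homogeneous_snd_def lookup_single when_def)
qed (unfold eval_at_def eval_poly_simps(6), simp)

lemma hfun_add [intro]: "hfun e f \<Longrightarrow> hfun e g \<Longrightarrow> hfun e (\<lambda>x. f x + g x)"
  unfolding hfun_def
proof (elim exE conjE)
  fix f' g' assume *: "homogeneous_snd e f'" "homogeneous_snd e g'"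
    "\<forall>z. eval_at z f' = f z" "\<forall>z. eval_at z g' = g z"
  show "\<exists>f'. homogeneous_snd e f' \<and> (\<forall>z. eval_at z f' = f z + g z)"
    using * keys_add[of f' g']
    by (intro exI[of _ "f' + g'"]) (auto simp: homogeneous_snd_def eval_at_def eval_poly_simps)
qed

lemma hfun_mult [intro]: "hfun d f \<Longrightarrow> hfun e g \<Longrightarrow> hfun (d + e) (\<lambda>x. f x * g x)"
  unfolding hfun_def
proof (elim exE conjE)
  fix f' g' assume *: "homogeneous_snd d f'" "homogeneous_snd e g'"
    "\<forall>z. eval_at z f' = f z" "\<forall>z. eval_at z g' = g z"
  show "\<exists>f'. homogeneous_snd (d + e) f' \<and> (\<forall>z. eval_at z f' = f z * g z)"
  proof (intro exI conjI)
    show "homogeneous_snd (d + e) (f' * g')"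
      unfolding homogeneous_snd_def
    proof
      fix m assume "m \<in> Poly_Mapping.keys (f' * g')"
      then obtain a b where "m = a + b" "a \<in> Poly_Mapping.keys f'" "b \<in> Poly_Mapping.keys g'"
        using keys_mult[of f' g'] by blast
      then show "(\<Sum>j\<in>UNIV. Poly_Mapping.lookup m (Inr j)) = d + e"
        using * by (simp add: homogeneous_snd_def lookup_add sum.distrib)
    qed
  qed (use * in \<open>simp add: eval_at_def eval_poly_simps\<close>)
qed

lemma hfun_sum: "(\<And>i. i \<in> S \<Longrightarrow> hfun e (f i)) \<Longrightarrow> hfun e (\<lambda>x. \<Sum>i\<in>S. f i x)"
proof (induction S rule: infinite_finite_induct)
  case (insert x F)
  then show ?case by auto
\<comment> \<open>An empty sum is given by the zero polynomial, which has no keys and so is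
  homogeneous of every degree.\<close>
qed (auto simp: hfun_def homogeneous_snd_def eval_at_def eval_poly_simps intro!: exI[of _ 0])

lemma hfun_prod:
  "(\<And>i. i \<in> S \<Longrightarrow> hfun (e i) (f i)) \<Longrightarrow> hfun (\<Sum>i\<in>S. e i) (\<lambda>x. \<Prod>i\<in>S. f i x)"
  by (induction S rule: infinite_finite_induct) auto

lemma hfun_power: "hfun e f \<Longrightarrow> hfun (m * e) (\<lambda>x. f x ^ m)"
  by (induction m) auto

lemma hfun_diff:
  fixes f :: "('k::comm_ring_1 ^ 'n::finite) \<times> ('k ^ 'i::finite) \<Rightarrow> 'k"
  assumes "hfun e f" "hfun e g"
  shows "hfun e (\<lambda>x. f x - g x)"
  using hfun_add[of e f "\<lambda>x. -1 * g x"] hfun_mult[OF hfun_const, of e g "-1"] assms by simp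

lemma hfun_det:
  fixes A :: "('k::comm_ring_1 ^ 'n::finite) \<times> ('k ^ 'i::finite) \<Rightarrow> 'k ^ 'm ^ 'm"
  assumes "\<And>i j. hfun 1 (\<lambda>x. A x $ i $ j)"
  shows "hfun CARD('m) (\<lambda>x. det (A x))"
proof -
  \<comment> \<open>The degree is written in the shape in which \<open>hfun_mult\<close> and
    \<open>hfun_prod\<close> produce it.\<close>
  have "hfun (0 + (\<Sum>i\<in>(UNIV :: 'm set). 1)) (\<lambda>x. of_int (sign p) * (\<Prod>i\<in>UNIV. A x $ i $ p i))" for p
    by (intro hfun_mult hfun_const hfun_prod assms)
  then show ?thesis
    unfolding det_def by (intro hfun_sum) simp_all
qed

lemma hfun_pfun:
  assumes "pfun h"
  shows "hfun 0 (\<lambda>z. h (fst z))"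
proof -
  obtain f where f: "\<And>x. h x = eval_poly (($) x) f"
    using assms by (metis pfun_def)
  have "hfun (0 + (\<Sum>v\<in>UNIV. Poly_Mapping.lookup m v * 0))
      (\<lambda>z. Poly_Mapping.lookup f m * (\<Prod>v\<in>UNIV. fst z $ v ^ Poly_Mapping.lookup m v))" for m
    by (intro hfun_mult hfun_const hfun_prod hfun_power hfun_fst)
  then show ?thesis
    unfolding f eval_poly_def poly_subst_def by (intro hfun_sum) simp_all
qed

lemma sum_UNIV_Plus:
  "(\<Sum>v\<in>(UNIV :: ('a::finite + 'b::finite) set). f v) = (\<Sum>i\<in>UNIV. f (Inl i)) + (\<Sum>j\<in>UNIV. f (Inr j))"
  by (subst UNIV_Plus_UNIV[symmetric], subst sum.Plus) (auto simp: o_def)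

text \<open>Affine variables count 0 and each homogeneous variable is replaced by something of
  degree 1, so the degree is preserved. This pulls equations and fractions back along maps that are
  linear in the homogeneous coordinates.\<close>

lemma hfun_subst:
  assumes "hfun e h" "\<And>j. hfun 1 (\<lambda>z. L z $ j)"
  shows "hfun e (\<lambda>z. h (fst z, L z))"
proof -
  obtain f where f: "homogeneous_snd e f" "\<And>z. h z = eval_at z f"
    using assms(1) by (metis hfun_def)
  have "hfun e (\<lambda>z. Poly_Mapping.lookup f m *
      (\<Prod>v\<in>UNIV. case_sum (($) (fst z)) (($) (L z)) v ^ Poly_Mapping.lookup m v))"
    if "m \<in> Poly_Mapping.keys f" for m
  proof -
    have "hfun (case_sum (\<lambda>_. 0) (\<lambda>_. 1) v) (\<lambda>z. case_sum (($) (fst z)) (($) (L z)) v)" for v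
      using assms(2) by (cases v) auto
    then have "hfun (0 + (\<Sum>v\<in>UNIV. Poly_Mapping.lookup m v * case_sum (\<lambda>_. 0) (\<lambda>_. 1) v))
       (\<lambda>z. Poly_Mapping.lookup f m *
      (\<Prod>v\<in>UNIV. case_sum (($) (fst z)) (($) (L z)) v ^ Poly_Mapping.lookup m v))"
      by (intro hfun_mult hfun_const hfun_prod hfun_power)
    also have "0 + (\<Sum>v\<in>UNIV. Poly_Mapping.lookup m v * case_sum (\<lambda>_. 0) (\<lambda>_. 1) v) = e"
      using f(1) that by (simp add: sum_UNIV_Plus homogeneous_snd_def)
    finally show ?thesis .
  qed
  then show ?thesis
    unfolding f(2) eval_at_def eval_poly_def poly_subst_def fst_conv snd_conv by (intro hfun_sum) auto
qed

lemma hfun_scale: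
  assumes "hfun e h"
  shows "h (x, a *s y) = a ^ e * h (x, y)"
proof -
  obtain f where f: "homogeneous_snd e f" "\<And>z. h z = eval_at z f"
    using assms by (metis hfun_def)
  have "(\<Prod>v\<in>UNIV. case_sum (($) x) (($) (a *s y)) v ^ Poly_Mapping.lookup m v)
      = a ^ e * (\<Prod>v\<in>UNIV. case_sum (($) x) (($) y) v ^ Poly_Mapping.lookup m v)"
    if "m \<in> Poly_Mapping.keys f" for m
  proof -
    have "(\<Prod>v\<in>UNIV. case_sum (($) x) (($) (a *s y)) v ^ Poly_Mapping.lookup m v)
      = (\<Prod>v\<in>UNIV. a ^ (Poly_Mapping.lookup m v * case_sum (\<lambda>_. 0) (\<lambda>_. 1) v) *
            case_sum (($) x) (($) y) v ^ Poly_Mapping.lookup m v)"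
      by (intro prod.cong) (auto simp: power_mult_distrib split: sum.splits)
    also have "\<dots> = a ^ (\<Sum>v\<in>UNIV. Poly_Mapping.lookup m v * case_sum (\<lambda>_. 0) (\<lambda>_. 1) v) *
        (\<Prod>v\<in>UNIV. case_sum (($) x) (($) y) v ^ Poly_Mapping.lookup m v)"
      by (simp add: prod.distrib power_sum)
    also have "(\<Sum>v\<in>UNIV. Poly_Mapping.lookup m v * case_sum (\<lambda>_. 0) (\<lambda>_. 1) v) = e"
      using f(1) that by (simp add: sum_UNIV_Plus homogeneous_snd_def)
    finally show ?thesis .
  qed
  then show ?thesis
    unfolding f(2) eval_at_def eval_poly_def poly_subst_def fst_conv snd_conv sum_distrib_left
    by (intro sum.cong) (simp_all add: mult.left_commute)
qed

text \<open>On the graph of a polynomial map \<open>H\<close>, a test function becomes a polynomial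
  function of \<open>x\<close> alone, to which density of the torus applies.\<close>

lemma pfun_hfun_subst:
  assumes "hfun e h" "\<And>j. pfun (\<lambda>x. H x $ j)"
  shows "pfun (\<lambda>x. h (x, H x))"
proof -
  obtain f where f: "\<And>z. h z = eval_at z f"
    using assms by (metis hfun_def)
  have "pfun (\<lambda>x. case_sum (($) x) (($) (H x)) v)" for v
    using assms(2) by (cases v) auto
  then show ?thesis
    unfolding f eval_at_def fst_conv snd_conv by (intro pfun_subst)
qed

subsection \<open>The Zariski topology\<close>

text \<open>What Pluecker and projective coordinates share: the tuples of a point form one orbit
  under nonzero scalars, and a tuple determines its point.\<close>

locale coordinates =
  fixes co :: "(('k ^ 'n) \<times> 'a, 'k::field, 'n::finite, 'i::finite) coords" and Z :: "(('k ^ 'n) \<times> 'a) set"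
  assumes nonempty: "P \<in> Z \<Longrightarrow> co P \<noteq> {}"
    and fst_co: "P \<in> Z \<Longrightarrow> z \<in> co P \<Longrightarrow> fst z = fst P"
    and nonzero: "P \<in> Z \<Longrightarrow> z \<in> co P \<Longrightarrow> snd z \<noteq> 0"
    and scale: "P \<in> Z \<Longrightarrow> z \<in> co P \<Longrightarrow> z' \<in> co P \<longleftrightarrow> (\<exists>c. c \<noteq> 0 \<and> z' = (fst z, c *s snd z))"
    and separate: "P \<in> Z \<Longrightarrow> Q \<in> Z \<Longrightarrow> z \<in> co P \<Longrightarrow> z \<in> co Q \<Longrightarrow> P = Q"
begin

lemma restrict: "Y \<subseteq> Z \<Longrightarrow> coordinates co Y"
proof unfold_locales
  assume Y: "Y \<subseteq> Z"
  fix P z z' Q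
  assume P: "P \<in> Y"
  then have PZ: "P \<in> Z" using Y by blast
  show "co P \<noteq> {}" by (rule nonempty[OF PZ])
  assume z: "z \<in> co P"
  show "fst z = fst P" by (rule fst_co[OF PZ z])
  show "snd z \<noteq> 0" by (rule nonzero[OF PZ z])
  show "z' \<in> co P \<longleftrightarrow> (\<exists>c. c \<noteq> 0 \<and> z' = (fst z, c *s snd z))" by (rule scale[OF PZ z])
  assume "Q \<in> Y" "z \<in> co Q"
  then show "P = Q" using separate[OF PZ _ z] Y by blast
qed

lemma vanish_cong:
  assumes "hfun e h" "P \<in> Z" "z \<in> co P" "z' \<in> co P"
  shows "h z' = 0 \<longleftrightarrow> h z = 0"
proof -
  obtain c where "c \<noteq> 0" "z' = (fst z, c *s snd z)"
    using scale assms by blast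
  then show ?thesis using hfun_scale[OF assms(1)] by simp
qed

lemma openin_nonvanishing:
  assumes "hfun e h"
  shows "openin (zariski co Z) {P\<in>Z. \<exists>z\<in>co P. h z \<noteq> 0}"
proof -
  obtain f where "homogeneous_snd e f" "\<And>z. eval_at z f = h z"
    using assms by (metis hfun_def)
  then show ?thesis
    unfolding zariski_def
    by (intro topology_generated_by_Basis CollectI exI[of _ f]) auto
qed

lemma topspace_zariski [simp]: "topspace (zariski co Z) = Z"
proof
  show "topspace (zariski co Z) \<subseteq> Z"
    unfolding zariski_def by auto
  \<comment> \<open>The constant 1 is homogeneous of degree 0, so \<open>Z\<close> itself is a basic
    open set.\<close>
  have "openin (zariski co Z) {P\<in>Z. \<exists>z\<in>co P. (1::'k) \<noteq> 0}"
    by (rule openin_nonvanishing[of 0]) auto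
  moreover have "\<exists>z\<in>co P. (1::'k) \<noteq> 0" if "P \<in> Z" for P
    using nonempty[OF that] unfolding ex_in_conv[symmetric] by (elim exE) (rule bexI, rule one_neq_zero)
  then have "{P\<in>Z. \<exists>z\<in>co P. (1::'k) \<noteq> 0} = Z" by blast
  ultimately show "Z \<subseteq> topspace (zariski co Z)"
    using openin_subset by fastforce
qed

text \<open>Products of homogeneous functions are homogeneous, so the generating nonvanishing sets
  are closed under intersection and form a basis.\<close>

lemma basic_nbhd:
  assumes "openin (zariski co Z) U" "P \<in> U"
  shows "\<exists>e h. hfun e h \<and> (\<forall>z\<in>co P. h z \<noteq> 0) \<and> {Q\<in>Z. \<exists>z\<in>co Q. h z \<noteq> 0} \<subseteq> U"
  using assms unfolding zariski_def openin_topology_generated_by_iff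
proof (induction U)
  case Empty
  then show ?case by simp
next
  case (Int A B)
  then have "P \<in> A" "P \<in> B" by auto
  obtain e h where *: "hfun e h" "\<forall>z\<in>co P. h z \<noteq> 0" "{Q\<in>Z. \<exists>z\<in>co Q. h z \<noteq> 0} \<subseteq> A"
    using Int.IH(1)[OF \<open>P \<in> A\<close>] by (elim exE conjE)
  obtain e' h' where **: "hfun e' h'" "\<forall>z\<in>co P. h' z \<noteq> 0" "{Q\<in>Z. \<exists>z\<in>co Q. h' z \<noteq> 0} \<subseteq> B"
    using Int.IH(2)[OF \<open>P \<in> B\<close>] by (elim exE conjE)
  show ?case
    by (intro exI[of _ "e + e'"] exI[of _ "\<lambda>z. h z * h' z"] conjI hfun_mult) (use * ** in auto)
next
  case (UN K)
  then obtain A where A: "A \<in> K" "P \<in> A" by blast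
  obtain e h where "hfun e h" "\<forall>z\<in>co P. h z \<noteq> 0" "{Q\<in>Z. \<exists>z\<in>co Q. h z \<noteq> 0} \<subseteq> A"
    using UN.IH[OF A] by (elim exE conjE)
  then show ?case using A(1) by (intro exI[of _ e] exI[of _ h]) blast
next
  case (Basis A)
  then obtain f e where f: "A = {P\<in>Z. \<exists>z\<in>co P. eval_at z f \<noteq> 0}" "homogeneous_snd e f" by blast
  have "\<forall>z\<in>co P. eval_at z f \<noteq> 0"
    using vanish_cong[OF hfun_eval[OF f(2)]] \<open>P \<in> A\<close> unfolding f(1) by blast
  then show ?case
    unfolding f(1) by (intro exI[of _ e] exI[of _ "\<lambda>z. eval_at z f"] conjI hfun_eval f(2)) auto
qed

text \<open>The closure is the common zero set of the homogeneous functions vanishing on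
  \<open>S\<close>. This replaces topology by the propagation of identities.\<close>

lemma in_closure_zariski_iff:
  assumes "S \<subseteq> Z"
  shows "P \<in> zariski co Z closure_of S \<longleftrightarrow> P \<in> Z \<and>
    (\<forall>e h. hfun e h \<longrightarrow> (\<forall>Q\<in>S. \<forall>z\<in>co Q. h z = 0) \<longrightarrow> (\<forall>z\<in>co P. h z = 0))"
    (is "?L \<longleftrightarrow> ?R")
proof
  assume L: ?L
  then have P: "P \<in> Z" by (simp add: in_closure_of)
  have "h z = 0" if h: "hfun e h" "\<forall>Q\<in>S. \<forall>z\<in>co Q. h z = 0" and z: "z \<in> co P" for e h z
  proof (rule ccontr)
    assume "h z \<noteq> 0"
    with z P have "P \<in> {P\<in>Z. \<exists>z\<in>co P. h z \<noteq> 0}" by auto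
    with L openin_nonvanishing[OF h(1)] have "\<exists>Q. Q \<in> S \<and> Q \<in> {P\<in>Z. \<exists>z\<in>co P. h z \<noteq> 0}"
      unfolding in_closure_of by (elim conjE allE[of _ "{P\<in>Z. \<exists>z\<in>co P. h z \<noteq> 0}"]) (rule mp, assumption, rule conjI)
    then obtain Q z' where "Q \<in> S" "z' \<in> co Q" "h z' \<noteq> 0" by blast
    then show False using h(2) by blast
  qed
  with P show ?R by blast
next
  assume R: ?R
  show ?L
    unfolding in_closure_of topspace_zariski
  proof (intro conjI allI impI)
    fix U assume "P \<in> U \<and> openin (zariski co Z) U"
    then obtain e h where h: "hfun e h" "\<forall>z\<in>co P. h z \<noteq> 0" "{Q\<in>Z. \<exists>z\<in>co Q. h z \<noteq> 0} \<subseteq> U"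
      using basic_nbhd[of U P] by (elim exE conjE) blast
    have "P \<in> Z" using R by (rule conjunct1)
    then obtain z where "z \<in> co P" using nonempty by blast
    have "\<not> (\<forall>Q\<in>S. \<forall>z\<in>co Q. h z = 0)"
      using R[THEN conjunct2, THEN spec, THEN spec, THEN mp, THEN mp, OF h(1)] h(2) \<open>z \<in> co P\<close> by blast
    then obtain Q z' where "Q \<in> S" "z' \<in> co Q" "h z' \<noteq> 0" by blast
    then show "\<exists>y. y \<in> S \<and> y \<in> U" using h(3) assms by blast
  qed (use R in blast)
qed

end

text \<open>Substituting \<open>L\<close> into a basic open condition or a fraction of equal degrees
  gives one of the same kind, so openness and regularity pull back.\<close>

lemma morphism_linear:
  fixes co :: "(('k ^ 'n) \<times> 'a, 'k::field, 'n::finite, 'i::finite) coords"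
    and co' :: "(('k ^ 'n) \<times> 'b, 'k, 'n, 'j::finite) coords"
  assumes c: "coordinates co Z" and c': "coordinates co' Z'"
    and L: "\<And>j. hfun 1 (\<lambda>z. L z $ j)"
    and \<phi>: "\<And>P. P \<in> Z \<Longrightarrow> \<phi> P \<in> Z'"
    and co: "\<And>P z. P \<in> Z \<Longrightarrow> z \<in> co P \<Longrightarrow> (fst z, L z) \<in> co' (\<phi> P)"
  shows "morphism co Z co' Z' \<phi>"
proof -
  interpret c: coordinates co Z by fact
  interpret c': coordinates co' Z' by fact
  have preimage: "openin (zariski co Z) {P\<in>Z. \<phi> P \<in> U}" if U: "openin (zariski co' Z') U" for U
  proof (subst openin_subopen, intro ballI)
    fix P assume P: "P \<in> {P\<in>Z. \<phi> P \<in> U}"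
    then have PZ: "P \<in> Z" and PU: "\<phi> P \<in> U" by simp_all
    obtain e h where h: "hfun e h" "\<forall>z\<in>co' (\<phi> P). h z \<noteq> 0" "{Q\<in>Z'. \<exists>z\<in>co' Q. h z \<noteq> 0} \<subseteq> U"
      using c'.basic_nbhd[OF U PU] by (elim exE conjE)
    let ?T = "{Q\<in>Z. \<exists>z\<in>co Q. h (fst z, L z) \<noteq> 0}"
    have "openin (zariski co Z) ?T"
      by (rule c.openin_nonvanishing[OF hfun_subst[OF h(1) L]])
    moreover have "P \<in> ?T"
    proof -
      obtain z where z: "z \<in> co P" using c.nonempty[OF PZ] by blast
      with h(2) co[OF PZ z] have "h (fst z, L z) \<noteq> 0" by blast
      with z PZ show ?thesis by blast
    qed
    moreover have "?T \<subseteq> {P\<in>Z. \<phi> P \<in> U}"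
    proof
      fix Q assume "Q \<in> ?T"
      then obtain z where z: "Q \<in> Z" "z \<in> co Q" "h (fst z, L z) \<noteq> 0" by blast
      then have "\<phi> Q \<in> {Q\<in>Z'. \<exists>z\<in>co' Q. h z \<noteq> 0}"
        using co[OF z(1,2)] \<phi>[OF z(1)] by blast
      then show "Q \<in> {P\<in>Z. \<phi> P \<in> U}" using h(3) z(1) by blast
    qed
    ultimately show "\<exists>T. openin (zariski co Z) T \<and> P \<in> T \<and> T \<subseteq> {P\<in>Z. \<phi> P \<in> U}" by blast
  qed
  show ?thesis
    unfolding morphism_def
  proof (intro conjI allI impI)
    show "continuous_map (zariski co Z) (zariski co' Z') \<phi>"
      unfolding continuous_map c.topspace_zariski c'.topspace_zariski using preimage \<phi> by blast
    fix V h assume "openin (zariski co' Z') V \<and> regular_on co' Z' V h"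
    then have V: "openin (zariski co' Z') V" "regular_on co' Z' V h" by auto
    show "regular_on co Z {P\<in>Z. \<phi> P \<in> V} (h \<circ> \<phi>)"
      unfolding regular_on_def
    proof
      fix P assume "P \<in> {P\<in>Z. \<phi> P \<in> V}"
      then have PZ: "P \<in> Z" and PV: "\<phi> P \<in> V" by simp_all
      obtain W f g e where W: "openin (zariski co' Z') W" "\<phi> P \<in> W" "W \<subseteq> V"
        "homogeneous_snd e f" "homogeneous_snd e g"
        "\<forall>Q\<in>W. \<forall>z\<in>co' Q. eval_at z g \<noteq> 0 \<and> h Q = eval_at z f / eval_at z g"
        using V(2)[unfolded regular_on_def, THEN bspec, OF PV] by (elim exE conjE)
      \<comment> \<open>Numerator and denominator are pulled back separately and keep their common
        degree \<open>e\<close>.\<close>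
      obtain f' where f': "homogeneous_snd e f'" "\<And>z. eval_at z f' = eval_at (fst z, L z) f"
        using hfun_subst[OF hfun_eval[OF W(4)] L] unfolding hfun_def by blast
      obtain g' where g': "homogeneous_snd e g'" "\<And>z. eval_at z g' = eval_at (fst z, L z) g"
        using hfun_subst[OF hfun_eval[OF W(5)] L] unfolding hfun_def by blast
      show "\<exists>V' f g e. openin (zariski co Z) V' \<and> P \<in> V' \<and> V' \<subseteq> {P\<in>Z. \<phi> P \<in> V} \<and>
        homogeneous_snd e f \<and> homogeneous_snd e g \<and>
        (\<forall>Q\<in>V'. \<forall>z\<in>co Q. eval_at z g \<noteq> 0 \<and> (h \<circ> \<phi>) Q = eval_at z f / eval_at z g)"
      proof (rule exI[of _ "{P\<in>Z. \<phi> P \<in> W}"], rule exI[of _ f'], rule exI[of _ g'], rule exI[of _ e],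
          intro conjI ballI)
        show "openin (zariski co Z) {P\<in>Z. \<phi> P \<in> W}" using preimage W(1) by blast
        show "P \<in> {P\<in>Z. \<phi> P \<in> W}" "{P\<in>Z. \<phi> P \<in> W} \<subseteq> {P\<in>Z. \<phi> P \<in> V}"
          using PZ W(2,3) by blast+
        fix Q z assume "Q \<in> {P\<in>Z. \<phi> P \<in> W}" "z \<in> co Q"
        then have "(fst z, L z) \<in> co' (\<phi> Q)" "\<phi> Q \<in> W" using co by simp_all
        from W(6)[THEN bspec, THEN bspec, OF this(2,1)]
        show "eval_at z g' \<noteq> 0" "(h \<circ> \<phi>) Q = eval_at z f' / eval_at z g'"
          by (auto simp: f' g')
      qed (rule f'(1), rule g'(1))
    qed
  qed
qed

text \<open>A target found for one tuple of \<open>P\<close> serves all: another tuple is a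
  multiple, \<open>L\<close> respects the scaling, and so do the coordinates of the target.\<close>

lemma linear_map_exists:
  fixes co :: "(('k ^ 'n) \<times> 'a, 'k::field, 'n::finite, 'i::finite) coords"
    and co' :: "(('k ^ 'n) \<times> 'b, 'k, 'n, 'j::finite) coords"
  assumes c: "coordinates co Z" and c': "coordinates co' Z'"
    and L: "\<And>j. hfun 1 (\<lambda>z. L z $ j)"
    and ex: "\<And>P z. P \<in> Z \<Longrightarrow> z \<in> co P \<Longrightarrow> \<exists>Q\<in>Z'. (fst z, L z) \<in> co' Q"
  shows "\<exists>\<phi>. \<forall>P\<in>Z. \<phi> P \<in> Z' \<and> (\<forall>z\<in>co P. (fst z, L z) \<in> co' (\<phi> P))"
proof -
  interpret c: coordinates co Z by fact
  interpret c': coordinates co' Z' by fact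
  have "\<exists>Q\<in>Z'. \<forall>z\<in>co P. (fst z, L z) \<in> co' Q" if P: "P \<in> Z" for P
  proof -
    obtain z where z: "z \<in> co P" using c.nonempty P by blast
    then obtain Q where Q: "Q \<in> Z'" "(fst z, L z) \<in> co' Q" using ex P by blast
    have "(fst z', L z') \<in> co' Q" if "z' \<in> co P" for z'
    proof -
      obtain a where a: "a \<noteq> 0" "z' = (fst z, a *s snd z)"
        using c.scale P z \<open>z' \<in> co P\<close> by blast
      have "L z' = a *s L z"
        using hfun_scale[OF L, of "fst z" a "snd z"] a by (simp add: vec_eq_iff)
      then show ?thesis
        using c'.scale[OF Q] a by auto
    qed
    then show ?thesis using Q(1) by blast
  qed
  then show ?thesis by metis
qed

text \<open>The inverse conditions are equalities of tuples. As a tuple determines its point, the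
  induced maps of points are mutually inverse.\<close>

lemma isomorphic_over_base_linear:
  fixes co :: "(('k ^ 'n) \<times> 'a, 'k::field, 'n::finite, 'i::finite) coords"
    and co' :: "(('k ^ 'n) \<times> 'b, 'k, 'n, 'j::finite) coords"
  assumes c: "coordinates co Z" and c': "coordinates co' Z'"
    and L: "\<And>j. hfun 1 (\<lambda>z. L z $ j)" and L': "\<And>j. hfun 1 (\<lambda>z. L' z $ j)"
    and ex: "\<And>P z. P \<in> Z \<Longrightarrow> z \<in> co P \<Longrightarrow> \<exists>Q\<in>Z'. (fst z, L z) \<in> co' Q"
    and ex': "\<And>P z. P \<in> Z' \<Longrightarrow> z \<in> co' P \<Longrightarrow> \<exists>Q\<in>Z. (fst z, L' z) \<in> co Q"
    and inv: "\<And>P z. P \<in> Z \<Longrightarrow> z \<in> co P \<Longrightarrow> L' (fst z, L z) = snd z"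
    and inv': "\<And>P z. P \<in> Z' \<Longrightarrow> z \<in> co' P \<Longrightarrow> L (fst z, L' z) = snd z"
  shows "isomorphic_over_base co Z co' Z'"
proof -
  interpret c: coordinates co Z by fact
  interpret c': coordinates co' Z' by fact
  have m: "\<exists>\<phi>. \<forall>P\<in>Z. \<phi> P \<in> Z' \<and> (\<forall>z\<in>co P. (fst z, L z) \<in> co' (\<phi> P))"
    by (rule linear_map_exists[OF c c' L]) (rule ex)
  have m': "\<exists>\<phi>. \<forall>P\<in>Z'. \<phi> P \<in> Z \<and> (\<forall>z\<in>co' P. (fst z, L' z) \<in> co (\<phi> P))"
    by (rule linear_map_exists[OF c' c L']) (rule ex')
  obtain \<phi> where \<phi>: "\<And>P. P \<in> Z \<Longrightarrow> \<phi> P \<in> Z'"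
    "\<And>P z. P \<in> Z \<Longrightarrow> z \<in> co P \<Longrightarrow> (fst z, L z) \<in> co' (\<phi> P)"
    using m by blast
  obtain \<psi> where \<psi>: "\<And>P. P \<in> Z' \<Longrightarrow> \<psi> P \<in> Z"
    "\<And>P z. P \<in> Z' \<Longrightarrow> z \<in> co' P \<Longrightarrow> (fst z, L' z) \<in> co (\<psi> P)"
    using m' by blast
  show ?thesis
    unfolding isomorphic_over_base_def
  proof (intro exI conjI ballI)
    show "morphism co Z co' Z' \<phi>" by (rule morphism_linear[OF c c' L]) (fact \<phi>)+
    show "morphism co' Z' co Z \<psi>" by (rule morphism_linear[OF c' c L']) (fact \<psi>)+
  next
    fix P assume P: "P \<in> Z"
    then obtain z where z: "z \<in> co P" using c.nonempty by blast
    have "(fst z, L z) \<in> co' (\<phi> P)" using \<phi> P z by blast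
    moreover from this have "(fst z, L' (fst z, L z)) \<in> co (\<psi> (\<phi> P))"
      using \<psi>(2)[of "\<phi> P" "(fst z, L z)"] \<phi> P by simp
    ultimately have *: "(fst z, L z) \<in> co' (\<phi> P)" "z \<in> co (\<psi> (\<phi> P))"
      using inv[OF P z] by simp_all
    show "\<psi> (\<phi> P) = P"
      by (rule c.separate[OF _ P *(2) z]) (use \<phi> \<psi> P in blast)
    show "fst (\<phi> P) = fst P"
      using c'.fst_co[OF _ *(1)] c.fst_co[OF P z] \<phi>(1)[OF P] by simp
  next
    fix P assume P: "P \<in> Z'"
    then obtain z where z: "z \<in> co' P" using c'.nonempty by blast
    have "(fst z, L' z) \<in> co (\<psi> P)" using \<psi> P z by blast
    moreover from this have "(fst z, L (fst z, L' z)) \<in> co' (\<phi> (\<psi> P))"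
      using \<phi>(2)[of "\<psi> P" "(fst z, L' z)"] \<psi> P by simp
    ultimately have *: "(fst z, L' z) \<in> co (\<psi> P)" "z \<in> co' (\<phi> (\<psi> P))"
      using inv'[OF P z] by simp_all
    show "\<phi> (\<psi> P) = P"
      by (rule c'.separate[OF _ P *(2) z]) (use \<phi> \<psi> P in blast)
    show "fst (\<psi> P) = fst P"
      using c.fst_co[OF _ *(1)] c'.fst_co[OF P z] \<psi>(1)[OF P] by simp
  qed
qed

subsection \<open>Pluecker coordinates\<close>

definition minors :: "('d::finite \<Rightarrow> 'k::field ^ 'n::finite) \<Rightarrow> 'k ^ ('d \<Rightarrow> 'n)" where
  "minors B = (\<chi> i. det (\<chi> a b. B a $ i b))"

text \<open>Independence of the family, not of its range: a repeated vector counts as a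
  dependence.\<close>

definition lin_indep :: "('d::finite \<Rightarrow> 'k::field ^ 'n::finite) \<Rightarrow> bool" where
  "lin_indep B \<longleftrightarrow> (\<forall>c. (\<Sum>a\<in>UNIV. c a *s B a) = 0 \<longrightarrow> (\<forall>a. c a = 0))"

lemma lin_indep_iff:
  fixes B :: "'d::finite \<Rightarrow> 'k::field ^ 'n::finite"
  shows "lin_indep B \<longleftrightarrow> inj B \<and> vec.independent (range B)"
proof
  assume L: "lin_indep B"
  have inj: "inj B"
  proof (rule injI, rule ccontr)
    fix a b assume ab: "B a = B b" "a \<noteq> b"
    let ?c = "\<lambda>i. if i = a then 1 :: 'k else if i = b then -1 else 0"
    have "(\<Sum>i\<in>UNIV. ?c i *s B i) = (\<Sum>i\<in>{a, b}. ?c i *s B i)"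
      by (rule sum.mono_neutral_right) auto
    also have "\<dots> = 0" using ab by simp
    finally have "(\<Sum>i\<in>UNIV. ?c i *s B i) = 0" .
    then have "\<forall>i. ?c i = 0"
      by (rule L[unfolded lin_indep_def, THEN spec[of _ ?c], THEN mp])
    then show False by (auto dest: spec[of _ a])
  qed
  have "vec.independent (range B)"
  proof (rule vec.independent_if_scalars_zero)
    fix f x assume f: "(\<Sum>x\<in>range B. f x *s x) = 0" and x: "x \<in> range B"
    have "(\<Sum>a\<in>UNIV. f (B a) *s B a) = 0"
      using f by (simp add: sum.reindex[OF inj])
    with L x show "f x = 0" unfolding lin_indep_def by (auto dest: spec[of _ "\<lambda>a. f (B a)"])
  qed simp
  with inj show "inj B \<and> vec.independent (range B)" by simp
next
  assume R: "inj B \<and> vec.independent (range B)"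
  show "lin_indep B"
    unfolding lin_indep_def
  proof (intro allI impI)
    fix c a assume "(\<Sum>a\<in>UNIV. c a *s B a) = 0"
    then have "(\<Sum>x\<in>range B. c (inv B x) *s x) = 0"
      using R by (simp add: sum.reindex)
    then have "c (inv B (B a)) = 0"
      using R by (intro vec.independentD[where t = "range B"]) auto
    then show "c a = 0" using R by simp
  qed
qed

lemma span_range_iff:
  fixes B :: "'d::finite \<Rightarrow> 'k::field ^ 'n::finite"
  shows "v \<in> vec.span (range B) \<longleftrightarrow> (\<exists>c. v = (\<Sum>a\<in>UNIV. c a *s B a))"
proof
  assume "v \<in> vec.span (range B)"
  then show "\<exists>c. v = (\<Sum>a\<in>UNIV. c a *s B a)"
  proof (induction rule: vec.span_induct_alt)
    case base
    show ?case by (rule exI[of _ "\<lambda>_. 0"]) simp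
  next
    case (step t x y)
    then obtain c b where c: "y = (\<Sum>a\<in>UNIV. c a *s B a)" "x = B b" by blast
    have "(\<Sum>a\<in>UNIV. (c a + (if a = b then t else 0)) *s B a)
        = (\<Sum>a\<in>UNIV. c a *s B a) + (\<Sum>a\<in>UNIV. if a = b then t *s B a else 0)"
      unfolding sum.distrib[symmetric] by (intro sum.cong) (auto simp: vector_sadd_rdistrib)
    then show ?case using c by (intro exI[of _ "\<lambda>a. c a + (if a = b then t else 0)"]) simp
  qed
next
  assume "\<exists>c. v = (\<Sum>a\<in>UNIV. c a *s B a)"
  then obtain c where "v = (\<Sum>a\<in>UNIV. c a *s B a)" by blast
  then show "v \<in> vec.span (range B)"
    by (simp only:) (intro vec.span_sum vec.span_scale vec.span_base rangeI)
qed

lemma dim_span_range: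
  fixes B :: "'d::finite \<Rightarrow> 'k::field ^ 'n::finite"
  assumes "lin_indep B"
  shows "vec.dim (vec.span (range B)) = CARD('d)"
  using assms by (simp add: lin_indep_iff vec.dim_eq_card_independent card_image)

text \<open>\<open>CARD('d)\<close> vectors span at most this dimension; containing a subspace that
  attains it leaves no slack, neither in the span nor for relations.\<close>

lemma dim_le_span_range:
  fixes B :: "'d::finite \<Rightarrow> 'k::field ^ 'n::finite"
  assumes "W \<subseteq> vec.span (range B)" "vec.subspace W" "vec.dim W = CARD('d)"
  shows "W = vec.span (range B)" "lin_indep B"
proof -
  have "vec.dim (range B) \<le> card (range B)"
    by (rule vec.dim_le_card) (auto intro: vec.span_superset[THEN subsetD])
  moreover have "card (range B) \<le> CARD('d)" by (rule card_image_le) simp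
  moreover have "vec.dim W \<le> vec.dim (range B)"
    using vec.dim_subset[OF assms(1)] by simp
  ultimately have *: "vec.dim (range B) = CARD('d)" "card (range B) = CARD('d)"
    using assms(3) by auto
  show "W = vec.span (range B)"
    using vec.subspace_dim_equal[OF assms(2) vec.subspace_span assms(1)] * assms(3) by simp
  have "vec.independent (range B)"
    by (rule vec.card_le_dim_spanning[of _ "vec.span (range B)"])
       (use * in \<open>auto intro: vec.span_superset[THEN subsetD]\<close>)
  moreover have "inj B" using *(2) by (simp add: eq_card_imp_inj_on)
  ultimately show "lin_indep B" by (simp add: lin_indep_iff)
qed

lemma lin_indep_basis:
  assumes "vec.subspace W" "vec.dim W = CARD('d)"
  obtains B :: "'d::finite \<Rightarrow> 'k::field ^ 'n::finite" where "lin_indep B" "vec.span (range B) = W"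
proof -
  obtain S where S: "S \<subseteq> W" "vec.independent S" "W \<subseteq> vec.span S" "card S = vec.dim W"
    using vec.basis_exists by metis
  have "finite S" using S(2) by (rule vec.finiteI_independent)
  with S(4) assms obtain B :: "'d \<Rightarrow> _" where B: "bij_betw B UNIV S"
    by (metis finite_same_card_bij finite_class.finite_UNIV)
  then have "inj B" "range B = S" by (auto simp: bij_betw_def)
  moreover have "vec.span S = W"
    using S assms by (metis subset_antisym vec.span_subspace)
  ultimately show thesis using that[of B] S by (simp add: lin_indep_iff)
qed

text \<open>Cramer's rule: in terms of the columns \<open>j c\<close> of the matrix of
  \<open>B\<close>, column \<open>k\<close> has coefficients that are quotients of minors, here with
  the denominator cleared.\<close>

lemma cramer_minors:
  fixes B :: "'d::finite \<Rightarrow> 'k::field ^ 'n::finite"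
  assumes "minors B $ j \<noteq> 0"
  shows "minors B $ j * B a $ k = (\<Sum>c\<in>UNIV. B a $ j c * minors B $ (j(c := k)))"
proof -
  let ?M = "(\<chi> a b. B a $ j b) :: 'k ^ 'd ^ 'd"
  let ?x = "(\<chi> c. det (\<chi> a b. if b = c then (\<chi> a. B a $ k) $ a else ?M $ a $ b) / det ?M) :: 'k ^ 'd"
  have d: "det ?M = minors B $ j" by (simp add: minors_def)
  have M: "?M *v ?x = (\<chi> a. B a $ k)"
    using cramer[of ?M ?x "\<chi> a. B a $ k"] assms d by simp
  have x: "?x $ c = minors B $ (j(c := k)) / minors B $ j" for c
  proof -
    have "(\<chi> a b. if b = c then (\<chi> a. B a $ k) $ a else ?M $ a $ b) = (\<chi> a b. B a $ (j(c := k)) b)"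
      by (auto simp: vec_eq_iff)
    then show ?thesis by (simp add: minors_def)
  qed
  have "B a $ k = (?M *v ?x) $ a"
    unfolding M by simp
  also have "\<dots> = (\<Sum>c\<in>UNIV. ?M $ a $ c * ?x $ c)"
    by (simp only: matrix_vector_mult_def vec_lambda_beta)
  also have "\<dots> = (\<Sum>c\<in>UNIV. B a $ j c * (minors B $ (j(c := k)) / minors B $ j))"
    unfolding x by simp
  finally have "B a $ k = (\<Sum>c\<in>UNIV. B a $ j c * (minors B $ (j(c := k)) / minors B $ j))" .
  then show ?thesis
    using assms by (simp add: sum_distrib_left)
qed

lemma minors_nonzero_imp_lin_indep:
  fixes B :: "'d::finite \<Rightarrow> 'k::field ^ 'n::finite"
  assumes "minors B \<noteq> 0"
  shows "lin_indep B"
  unfolding lin_indep_def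
proof (intro allI impI)
  fix c a assume c: "(\<Sum>a\<in>UNIV. c a *s B a) = 0"
  obtain j where j: "minors B $ j \<noteq> 0" using assms by (auto simp: vec_eq_iff)
  let ?M = "(\<chi> a b. B a $ j b) :: 'k ^ 'd ^ 'd"
  have "invertible (transpose ?M)"
    using j by (simp add: minors_def invertible_det_nz det_transpose)
  then obtain N where N: "N ** transpose ?M = mat 1" by (auto simp: invertible_def)
  have "(\<Sum>a\<in>UNIV. c a * B a $ j b) = 0" for b
    using arg_cong[OF c, of "\<lambda>v. v $ j b"] by simp
  then have "transpose ?M *v (\<chi> a. c a) = 0"
    by (simp add: matrix_vector_mult_def transpose_def vec_eq_iff mult.commute)
  then have "(\<chi> a. c a) = 0"
    using N by (metis matrix_left_invertible_ker)
  then show "c a = 0" by (simp add: vec_eq_iff)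
qed

text \<open>Row rank equals column rank: the rows of the matrix of \<open>B\<close> span
  \<open>'k ^ 'd\<close>, so some \<open>CARD('d)\<close> of them form a basis, and their indices
  give a nonzero minor.\<close>

lemma lin_indep_imp_minors_nonzero:
  fixes B :: "'d::finite \<Rightarrow> 'k::field ^ 'n::finite"
  assumes "lin_indep B"
  shows "minors B \<noteq> 0"
proof -
  let ?A = "(\<chi> k a. B a $ k) :: 'k ^ 'd ^ 'n"
  have "column a ?A = B a" for a by (simp add: column_def vec_eq_iff)
  then have "\<exists>L. L ** ?A = mat 1"
    using assms by (simp add: matrix_left_invertible_independent_columns lin_indep_def)
  then have span: "vec.span (rows ?A) = UNIV"
    by (simp add: matrix_left_invertible_span_rows_gen)
  obtain S where S: "S \<subseteq> rows ?A" "vec.independent S" "rows ?A \<subseteq> vec.span S"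
    using vec.maximal_independent_subset by metis
  have "vec.span S = UNIV"
    using span S(3) by (metis UNIV_I subsetI subset_antisym top.extremum vec.span_minimal vec.subspace_span)
  then have "card S = CARD('d)"
    using S(2) vec.dim_eq_card_independent[of S] vec.dim_span[of S] vec_dim_card by metis
  moreover have "finite S" using S(2) by (rule vec.finiteI_independent)
  ultimately obtain g :: "'d \<Rightarrow> _" where "bij_betw g UNIV S"
    by (metis finite_same_card_bij finite_class.finite_UNIV)
  then have g: "inj g" "range g = S" by (auto simp: bij_betw_def)
  have "\<forall>b. \<exists>k. g b = row k ?A"
    using S(1) g(2) unfolding rows_def by blast
  then obtain j where j: "\<And>b. g b = row (j b) ?A" by metis
  let ?M = "(\<chi> b. g b) :: 'k ^ 'd ^ 'd"
  have "lin_indep g" using g S(2) by (simp add: lin_indep_iff)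
  then have "\<exists>N. ?M ** N = mat 1"
    unfolding matrix_right_invertible_independent_rows lin_indep_def by (simp add: row_def vec_lambda_eta)
  then have "det ?M \<noteq> 0"
    using invertible_det_nz invertible_right_inverse by blast
  also have "?M = transpose (\<chi> a b. B a $ j b)"
    by (simp add: transpose_def vec_eq_iff j row_def)
  finally have "minors B $ j \<noteq> 0"
    by (simp add: minors_def det_transpose)
  then show ?thesis by auto
qed

lemma minors_linear_combination:
  fixes B :: "'d::finite \<Rightarrow> 'k::field ^ 'n::finite"
  assumes "\<And>a. B' a = (\<Sum>c\<in>UNIV. P a c *s B c)"
  shows "minors B' = det (\<chi> a c. P a c) *s minors B"
proof -
  have "(\<chi> a b. B' a $ i b) = (\<chi> a c. P a c) ** (\<chi> a b. B a $ i b)" for i :: "'d \<Rightarrow> 'n"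
    by (simp add: matrix_matrix_mult_def vec_eq_iff assms)
  then show ?thesis by (simp add: minors_def vec_eq_iff det_mul)
qed

text \<open>Multiplying one single basis vector by \<open>t\<close> multiplies all minors by
  \<open>t\<close> and keeps the span.\<close>

lemma minors_scale_basis:
  fixes B :: "'d::finite \<Rightarrow> 'k::field ^ 'n::finite"
  assumes "lin_indep B" "t \<noteq> 0"
  shows "\<exists>B'. lin_indep B' \<and> vec.span (range B') = vec.span (range B) \<and> minors B' = t *s minors B"
proof -
  obtain a0 :: 'd where True by blast
  define s where "s = (\<lambda>a. if a = a0 then t else 1)"
  define B' where "B' = (\<lambda>a. s a *s B a)"
  have "minors B' $ i = t * minors B $ i" for i
  proof -
    have "minors B' $ i = det (\<chi> a. s a *s (\<chi> b. B a $ i b))"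
      unfolding minors_def B'_def by (auto intro!: arg_cong[where f = det] simp: vec_eq_iff)
    also have "\<dots> = (\<Prod>a\<in>UNIV. s a) * det (\<chi> a b. B a $ i b)"
      by (rule det_rows_mul)
    also have "(\<Prod>a\<in>UNIV. s a) = t" by (simp add: s_def)
    finally show ?thesis by (simp add: minors_def)
  qed
  then have m: "minors B' = t *s minors B" by (simp add: vec_eq_iff)
  then have indep: "lin_indep B'"
    using assms lin_indep_imp_minors_nonzero[OF assms(1)] by (intro minors_nonzero_imp_lin_indep) simp
  have "vec.span (range B') \<subseteq> vec.span (range B)"
    unfolding B'_def by (intro vec.span_minimal image_subsetI vec.span_scale vec.span_base rangeI vec.subspace_span)
  then have "vec.span (range B') = vec.span (range B)"
    using dim_span_range[OF indep] dim_span_range[OF assms(1)] by (intro vec.subspace_dim_equal) auto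
  with indep m show ?thesis by blast
qed

text \<open>By Cramer's rule the subspace has a spanning family made of its own Pluecker
  coordinates. Hence these determine it: the Pluecker embedding is injective.\<close>

lemma span_range_eq_minors:
  fixes B :: "'d::finite \<Rightarrow> 'k::field ^ 'n::finite"
  assumes "lin_indep B" "minors B $ j \<noteq> 0"
  shows "vec.span (range B) = vec.span (range (\<lambda>c. \<chi> k. minors B $ (j(c := k))))"
proof (rule dim_le_span_range(1))
  let ?R = "\<lambda>c. (\<chi> k. minors B $ (j(c := k)))"
  have "B a \<in> vec.span (range ?R)" for a
    unfolding span_range_iff
  proof
    show "B a = (\<Sum>c\<in>UNIV. (B a $ j c / minors B $ j) *s ?R c)"
      using cramer_minors[OF assms(2), of a] assms(2)
      by (simp add: vec_eq_iff sum_divide_distrib[symmetric] eq_divide_eq mult.commute)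
  qed
  then show "vec.span (range B) \<subseteq> vec.span (range ?R)"
    by (intro vec.span_minimal) auto
qed (use assms dim_span_range in auto)

text \<open>The additional factor \<open>minors B $ j\<close> on both sides admits the case that this minor vanishes.\<close>

lemma minors_relation:
  fixes B :: "'d::finite \<Rightarrow> 'k::field ^ 'n::finite"
  shows "minors B $ j ^ CARD('d) * minors B $ i = minors B $ j * det (\<chi> c b. minors B $ (j(c := i b)))"
proof (cases "minors B $ j = 0")
  case False
  \<comment> \<open>Cramer's identity for all columns \<open>i b\<close> as one matrix product. On
    taking determinants, each of the \<open>CARD('d)\<close> rows releases a factor
    \<open>minors B $ j\<close>.\<close>
  have "(\<chi> a. minors B $ j *s (\<chi> b. B a $ i b)) = (\<chi> a b. B a $ j b) ** (\<chi> c b. minors B $ (j(c := i b)))"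
    using cramer_minors[OF False] by (simp add: vec_eq_iff matrix_matrix_mult_def)
  then have "det (\<chi> a. minors B $ j *s (\<chi> b. B a $ i b))
     = det (\<chi> a b. B a $ j b) * det (\<chi> c b. minors B $ (j(c := i b)))"
    by (simp add: det_mul)
  then show ?thesis
    unfolding det_rows_mul by (simp add: minors_def)
qed simp

text \<open>For a nonzero coordinate \<open>j\<close>, the vectors with entries
  \<open>y $ (j(c := k))\<close> are the candidate basis. The relations say that its minors are
  proportional to \<open>y\<close>; rescaling removes the factor.\<close>

lemma relation_imp_minors:
  fixes y :: "'k::field ^ ('d::finite \<Rightarrow> 'n::finite)"
  assumes "y \<noteq> 0" and rel: "\<And>i j. y $ j ^ CARD('d) * y $ i = y $ j * det (\<chi> c b. y $ (j(c := i b)))"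
  obtains B :: "'d \<Rightarrow> 'k ^ 'n" where "lin_indep B" "minors B = y"
proof -
  obtain j where j: "y $ j \<noteq> 0" using assms by (auto simp: vec_eq_iff)
  define R :: "'d \<Rightarrow> 'k ^ 'n" where "R = (\<lambda>c. \<chi> k. y $ (j(c := k)))"
  \<comment> \<open>One factor \<open>y $ j\<close> cancels from the relation; the remaining power
    is the factor of proportionality.\<close>
  have "CARD('d) = Suc (CARD('d) - 1)" by simp
  then have "y $ j * (y $ j ^ (CARD('d) - 1) * y $ i) = y $ j * minors R $ i" for i
    using rel[of j i] by (simp add: minors_def R_def mult.assoc[symmetric] power_Suc[symmetric] del: power_Suc)
  then have m: "minors R = y $ j ^ (CARD('d) - 1) *s y"
    using j by (simp add: vec_eq_iff)
  then have indep: "lin_indep R"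
    using j assms(1) by (intro minors_nonzero_imp_lin_indep) simp
  obtain B where "lin_indep B" "minors B = inverse (y $ j ^ (CARD('d) - 1)) *s minors R"
    using minors_scale_basis[OF indep, of "inverse (y $ j ^ (CARD('d) - 1))"] j by auto
  then show thesis using that m j by simp
qed

lemma plucker_coords_iff:
  "z \<in> (plucker_coords :: (_, 'k::field, 'n::finite, 'd::finite \<Rightarrow> 'n) coords) P \<longleftrightarrow>
    fst z = fst P \<and> (\<exists>B. lin_indep B \<and> vec.span (range B) = snd P \<and> snd z = minors B)"
  unfolding plucker_coords_def minors_def lin_indep_iff by (cases z) auto

text \<open>The orbit property comes from change of basis and from rescaling a basis vector,
  separation from injectivity of the Pluecker embedding.\<close>

lemma coordinates_plucker:
  "coordinates (plucker_coords :: (_, 'k::field, 'n::finite, 'd::finite \<Rightarrow> 'n) coords) (X \<times> Gr CARD('d))"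
proof
  fix P Q :: "('k ^ 'n) \<times> ('k ^ 'n) set" and z z' :: "('k ^ 'n) \<times> ('k ^ ('d \<Rightarrow> 'n))"
  assume P: "P \<in> X \<times> Gr CARD('d)"
  have "snd P \<in> Gr CARD('d)" using P by auto
  then obtain B :: "'d \<Rightarrow> 'k ^ 'n" where "lin_indep B" "vec.span (range B) = snd P"
    unfolding Gr_def by (auto intro: lin_indep_basis)
  then have "(fst P, minors B) \<in> plucker_coords P" by (auto simp: plucker_coords_iff)
  then show "(plucker_coords P :: (_ \<times> ('k ^ ('d \<Rightarrow> 'n))) set) \<noteq> {}" by blast
  assume z: "z \<in> plucker_coords P"
  then obtain B where B: "lin_indep B" "vec.span (range B) = snd P" "snd z = minors B" "fst z = fst P"
    by (auto simp: plucker_coords_iff)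
  show "fst z = fst P" by fact
  show nz: "snd z \<noteq> 0" using B lin_indep_imp_minors_nonzero by metis
  show "z' \<in> plucker_coords P \<longleftrightarrow> (\<exists>c. c \<noteq> 0 \<and> z' = (fst z, c *s snd z))"
  proof
    assume "z' \<in> plucker_coords P"
    then obtain B' where B': "lin_indep B'" "vec.span (range B') = snd P" "snd z' = minors B'" "fst z' = fst P"
      by (auto simp: plucker_coords_iff)
    have "\<forall>a. \<exists>p. B' a = (\<Sum>c\<in>UNIV. p c *s B c)"
      using B(2) B'(2) span_range_iff[of _ B] by (metis rangeI vec.span_base)
    then obtain p where "\<And>a. B' a = (\<Sum>c\<in>UNIV. p a c *s B c)" by metis
    then have m: "minors B' = det (\<chi> a c. p a c) *s minors B" by (rule minors_linear_combination)
    moreover have "det (\<chi> a c. p a c) \<noteq> 0"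
      using m lin_indep_imp_minors_nonzero[OF B'(1)] by auto
    ultimately show "\<exists>c. c \<noteq> 0 \<and> z' = (fst z, c *s snd z)"
      using B B' by (metis prod.collapse)
  next
    assume "\<exists>c. c \<noteq> 0 \<and> z' = (fst z, c *s snd z)"
    then obtain c where c: "c \<noteq> 0" "z' = (fst z, c *s snd z)" by blast
    then obtain B' where "lin_indep B'" "vec.span (range B') = vec.span (range B)" "minors B' = c *s minors B"
      using minors_scale_basis[OF B(1)] by blast
    with c B show "z' \<in> plucker_coords P"
      by (simp add: plucker_coords_iff) metis
  qed
  assume "Q \<in> X \<times> Gr CARD('d)" "z \<in> plucker_coords Q"
  then obtain B' where B': "lin_indep B'" "vec.span (range B') = snd Q" "snd z = minors B'" "fst z = fst Q"
    by (auto simp: plucker_coords_iff)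
  obtain j where "snd z $ j \<noteq> 0" using nz by (auto simp: vec_eq_iff)
  then have "snd P = snd Q"
    using span_range_eq_minors[OF B(1)] span_range_eq_minors[OF B'(1)] B B' by metis
  with B B' show "P = Q" by (simp add: prod_eq_iff)
qed

section \<open>Lines and projective coordinates\<close>

lemma span_singleton_line:
  fixes y :: "'k::field ^ 'r::finite"
  assumes "W \<in> Gr 1" "y \<in> W" "y \<noteq> 0"
  shows "W = vec.span {y}"
proof -
  have "vec.span {y} \<subseteq> W"
    using assms by (intro vec.span_minimal) (auto simp: Gr_def)
  then show ?thesis
    using assms by (intro vec.subspace_dim_equal[symmetric])
      (auto simp: Gr_def vec.dim_insert vec.independent_insert)
qed

lemma span_singleton_iff: "v \<in> vec.span {y} \<longleftrightarrow> (\<exists>c. v = c *s (y :: 'k::field ^ 'r::finite))"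
  by (auto simp: vec.span_singleton)

lemma span_singleton_Gr: "(y :: 'k::field ^ 'r::finite) \<noteq> 0 \<Longrightarrow> vec.span {y} \<in> Gr 1"
  by (auto simp: Gr_def vec.dim_insert)

lemma proj_coords_span:
  "z \<in> proj_coords (x, vec.span {y :: 'k::field ^ 'r::finite}) \<longleftrightarrow>
    y \<noteq> 0 \<and> (\<exists>c. c \<noteq> 0 \<and> z = (x, c *s y))"
  unfolding proj_coords_def by (auto simp: span_singleton_iff)

lemma coordinates_proj:
  "coordinates (proj_coords :: (_, 'k::field, 'n::finite, 'r::finite) coords) (X \<times> Gr 1)"
proof
  fix P Q :: "('k ^ 'n) \<times> ('k ^ 'r) set" and z z' :: "('k ^ 'n) \<times> ('k ^ 'r)"
  assume P: "P \<in> X \<times> Gr 1"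
  then have W: "vec.dim (snd P) = 1" by (auto simp: Gr_def)
  have "\<not> snd P \<subseteq> {0}"
    using W by (metis vec.dim_eq_0 zero_neq_one)
  then show "(proj_coords P :: (_ \<times> ('k ^ 'r)) set) \<noteq> {}"
    unfolding proj_coords_def by auto
  assume z: "z \<in> proj_coords P"
  then have zz: "fst z = fst P" "snd z \<in> snd P" "snd z \<noteq> 0" by (auto simp: proj_coords_def)
  have PG: "snd P \<in> Gr 1" using P by auto
  have sP: "snd P = vec.span {snd z}"
    by (rule span_singleton_line[OF PG zz(2,3)])
  show "fst z = fst P" "snd z \<noteq> 0" by fact+
  show "z' \<in> proj_coords P \<longleftrightarrow> (\<exists>c. c \<noteq> 0 \<and> z' = (fst z, c *s snd z))"
    using proj_coords_span[of z' "fst P" "snd z"] sP zz by (metis prod.collapse)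
  assume Q: "Q \<in> X \<times> Gr 1" "z \<in> proj_coords Q"
  then have "fst z = fst Q" "snd z \<in> snd Q" "snd Q \<in> Gr 1" by (auto simp: proj_coords_def)
  then show "P = Q"
    using span_singleton_line[of "snd Q" "snd z"] zz sP by (simp add: prod_eq_iff)
qed

subsection \<open>Characters of the torus\<close>

text \<open>Over a finite field, 1 plus the product of all \<open>x - a\<close> would be a
  nonconstant polynomial without roots.\<close>

lemma infinite_alg_closed_field: "infinite (UNIV :: 'k::alg_closed_field set)"
proof
  assume fin: "finite (UNIV :: 'k set)"
  let ?p = "(\<Prod>a\<in>(UNIV :: 'k set). [:-a, 1:]) + 1"
  have deg: "degree (\<Prod>a\<in>(UNIV :: 'k set). [:-a, 1:]) = card (UNIV :: 'k set)"
    by (subst degree_prod_eq_sum_degree) auto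
  then have "degree ?p > 0"
    using fin by (subst degree_add_eq_left) (auto simp: card_gt_0_iff)
  then obtain x where "poly ?p x = 0" using alg_closed_imp_poly_has_root by blast
  moreover have "poly (\<Prod>a\<in>(UNIV :: 'k set). [:-a, 1:]) x = 0"
    using fin by (auto simp: poly_prod)
  ultimately show False by simp
qed

definition torus :: "('k::field ^ 'd::finite) set" where
  "torus = {t. \<forall>a. t $ a \<noteq> 0}"

definition lchar :: "'k::field ^ 'd::finite \<Rightarrow> int ^ 'd \<Rightarrow> 'k" where
  "lchar t l = (\<Prod>a\<in>UNIV. t $ a powi l $ a)"

lemma lchar_0 [simp]: "lchar t 0 = 1"
  by (simp add: lchar_def)

lemma lchar_add: "t \<in> torus \<Longrightarrow> lchar t (l + m) = lchar t l * lchar t m"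
  by (simp add: lchar_def torus_def power_int_add prod.distrib)

lemma lchar_sum: "t \<in> torus \<Longrightarrow> lchar t (\<Sum>i\<in>S. f i) = (\<Prod>i\<in>S. lchar t (f i))"
  by (induction S rule: infinite_finite_induct) (simp_all add: lchar_add)

lemma lchar_of_nat_scale: "t \<in> torus \<Longrightarrow> lchar t (int m *s l) = lchar t l ^ m"
  by (induction m) (simp_all add: lchar_add vector_sadd_rdistrib)

lemma lchar_nonzero: "t \<in> torus \<Longrightarrow> lchar t l \<noteq> 0"
  by (simp add: lchar_def torus_def)

lemma lchar_mult: "lchar (\<chi> a. s $ a * t $ a) l = lchar s l * lchar t l"
  by (simp add: lchar_def power_int_mult_distrib prod.distrib)

lemma torus_mult: "s \<in> torus \<Longrightarrow> t \<in> torus \<Longrightarrow> (\<chi> a. s $ a * t $ a) \<in> torus"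
  by (simp add: torus_def)

lemma lchar_one_coordinate: "lchar (\<chi> b. if b = a then s else 1) l = s powi l $ a"
proof -
  have "lchar (\<chi> b. if b = a then s else 1) l = (\<Prod>b\<in>UNIV. if b = a then s powi l $ a else 1)"
    unfolding lchar_def by (intro prod.cong) auto
  then show ?thesis by simp
qed

text \<open>For \<open>i < j\<close>, only 0 and the roots of \<open>s ^ (j - i) - 1\<close> fail.
  This polynomial is nonzero in every characteristic, its constant term being -1.\<close>

lemma ex_power_int_neq:
  fixes i j :: int
  assumes "i \<noteq> j"
  shows "\<exists>s :: 'k::alg_closed_field. s \<noteq> 0 \<and> s powi i \<noteq> s powi j"
proof -
  have *: "\<exists>s :: 'k. s \<noteq> 0 \<and> s powi i \<noteq> s powi j" if "i < j" for i j :: int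
  proof -
    let ?p = "monom 1 (nat (j - i)) - 1 :: 'k poly"
    have "coeff ?p 0 = -1" using that by simp
    then have "?p \<noteq> 0" by (metis coeff_0 neg_equal_0_iff_equal one_neq_zero)
    then have "finite (insert 0 {s. poly ?p s = 0})" by (intro finite.insertI poly_roots_finite)
    then obtain s where "s \<notin> insert 0 {s. poly ?p s = 0}"
      using infinite_alg_closed_field by (metis UNIV_eq_I)
    then have s: "s \<noteq> 0" "s ^ nat (j - i) \<noteq> 1" by (auto simp: poly_monom)
    have "s powi j = s powi i * s powi (j - i)"
      using s(1) by (simp flip: power_int_add)
    also have "s powi (j - i) = s ^ nat (j - i)" using that by (simp add: power_int_def)
    finally have "s powi i \<noteq> s powi j" using s by simp
    with s show ?thesis by blast
  qed
  from assms consider "i < j" | "j < i" by linarith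
  then show ?thesis using *[of i j] *[of j i] by cases (blast, metis)
qed

lemma lchar_separate:
  assumes "l \<noteq> m"
  shows "\<exists>t \<in> (torus :: ('k::alg_closed_field ^ 'd::finite) set). lchar t l \<noteq> lchar t m"
proof -
  obtain a where "l $ a \<noteq> m $ a" using assms by (auto simp: vec_eq_iff)
  then obtain s :: 'k where s: "s \<noteq> 0" "s powi l $ a \<noteq> s powi m $ a"
    using ex_power_int_neq by blast
  then show ?thesis
    by (intro bexI[of _ "\<chi> b. if b = a then s else 1"])
       (simp_all add: lchar_one_coordinate torus_def)
qed

text \<open>Dedekind's argument: translate the relation by \<open>s\<close> and subtract
  \<open>lchar s l0\<close> times the original. The term of \<open>l0\<close> disappears, and the
  others are multiplied by \<open>lchar s l - lchar s l0\<close>.\<close>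

lemma lchar_independent:
  assumes "finite A"
    and "\<And>t :: 'k::alg_closed_field ^ 'd::finite. t \<in> torus \<Longrightarrow> (\<Sum>l\<in>A. c l * lchar t l) = 0"
  shows "\<forall>l\<in>A. c l = 0"
  using assms
proof (induction A arbitrary: c rule: finite_induct)
  case (insert l0 A)
  have 0: "c l = 0" if l: "l \<in> A" for l
  proof -
    \<comment> \<open>The translation \<open>s\<close> is chosen for this one \<open>l\<close>, so
      that its new factor is nonzero.\<close>
    have "l \<noteq> l0" using l insert.hyps by auto
    then obtain s :: "'k ^ 'd" where s: "s \<in> torus" "lchar s l \<noteq> lchar s l0"
      using lchar_separate by blast
    have "(\<Sum>l\<in>A. (c l * (lchar s l - lchar s l0)) * lchar t l) = 0" if t: "t \<in> torus" for t
    proof -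
      have "(\<Sum>l\<in>insert l0 A. c l * lchar (\<chi> a. s $ a * t $ a) l)
          - lchar s l0 * (\<Sum>l\<in>insert l0 A. c l * lchar t l) = 0"
        using insert.prems[OF t] insert.prems[OF torus_mult[OF s(1) t]] by simp
      moreover have "(\<Sum>l\<in>insert l0 A. c l * lchar (\<chi> a. s $ a * t $ a) l)
          - lchar s l0 * (\<Sum>l\<in>insert l0 A. c l * lchar t l)
          = (\<Sum>l\<in>insert l0 A. (c l * (lchar s l - lchar s l0)) * lchar t l)"
        unfolding sum_distrib_left sum_subtractf[symmetric]
        by (intro sum.cong) (auto simp: lchar_mult algebra_simps)
      ultimately show ?thesis using insert.hyps by simp
    qed
    from insert.IH[OF this] l s(2) show ?thesis by auto
  qed
  have one: "(\<chi> a. 1) \<in> (torus :: ('k ^ 'd) set)" by (simp add: torus_def)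
  have "(\<Sum>l\<in>insert l0 A. c l * lchar (\<chi> a. 1) l) = c l0"
    using insert.hyps 0 by (simp add: lchar_def)
  then show ?case using 0 insert.prems[OF one] by auto
qed simp

subsection \<open>The toric variety and its torus\<close>

definition weight :: "('n::finite \<Rightarrow> int ^ 'd::finite) \<Rightarrow> ('n \<Rightarrow>\<^sub>0 nat) \<Rightarrow> int ^ 'd" where
  "weight \<gamma> m = (\<Sum>j\<in>UNIV. int (Poly_Mapping.lookup m j) *s \<gamma> j)"

definition mon :: "'k::comm_semiring_1 ^ 'n::finite \<Rightarrow> ('n \<Rightarrow>\<^sub>0 nat) \<Rightarrow> 'k" where
  "mon x m = (\<Prod>v\<in>UNIV. x $ v ^ Poly_Mapping.lookup m v)"

lemma eval_poly_mon: "eval_poly (($) x) f = (\<Sum>m\<in>Poly_Mapping.keys f. Poly_Mapping.lookup f m * mon x m)"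
  by (simp add: eval_poly_def poly_subst_def mon_def)

lemma toric_hom_single:
  fixes \<gamma> :: "'n::finite \<Rightarrow> int ^ 'd::finite"
  shows "toric_hom \<gamma> (Poly_Mapping.single m a) = Poly_Mapping.single (weight \<gamma> m) (a :: 'k::comm_ring_1)"
proof -
  have pow: "Poly_Mapping.single l (1 :: 'k) ^ k = Poly_Mapping.single (int k *s l) 1" for l :: "int ^ 'd" and k
    by (induction k) (simp_all add: mult_single vector_sadd_rdistrib)
  have prod: "(\<Prod>i\<in>S. Poly_Mapping.single (f i) (1 :: 'k)) = Poly_Mapping.single (\<Sum>i\<in>S. f i) 1"
    for f :: "'n \<Rightarrow> int ^ 'd" and S
    by (induction S rule: infinite_finite_induct) (simp_all add: mult_single)
  show ?thesis
    by (simp add: toric_hom_def coeff_single.poly_subst_single pow prod mult_single weight_def)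
qed

lemma toric_hom_add: "toric_hom \<gamma> (f + g) = toric_hom \<gamma> f + toric_hom \<gamma> g"
  unfolding toric_hom_def by (rule coeff_single.poly_subst_add)

lemma toric_hom_mult: "toric_hom \<gamma> (f * g) = toric_hom \<gamma> f * toric_hom \<gamma> g"
  unfolding toric_hom_def by (rule coeff_single.poly_subst_mult)

lemma toric_hom_sum: "toric_hom \<gamma> (\<Sum>i\<in>S. f i) = (\<Sum>i\<in>S. toric_hom \<gamma> (f i))"
  unfolding toric_hom_def by (rule coeff_single.poly_subst_sum)

lemma toric_hom_zero: "toric_hom \<gamma> 0 = 0"
  by (simp add: toric_hom_def)

lemma toric_hom_diff: "toric_hom \<gamma> (f - g) = toric_hom \<gamma> f - toric_hom \<gamma> (g :: ('n::finite, 'k::comm_ring_1) mpoly)"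
  by (metis add_diff_cancel_right' diff_add_cancel toric_hom_add)

text \<open>The functional with prescribed values on monomials. Evaluation, partial derivatives at a
  point and characters all have this form.\<close>

definition linext :: "('m \<Rightarrow> 'k::comm_semiring_1) \<Rightarrow> ('m \<Rightarrow>\<^sub>0 'k) \<Rightarrow> 'k" where
  "linext \<Phi> L = (\<Sum>l\<in>Poly_Mapping.keys L. Poly_Mapping.lookup L l * \<Phi> l)"

lemma linext_superset:
  "finite S \<Longrightarrow> Poly_Mapping.keys L \<subseteq> S \<Longrightarrow> linext \<Phi> L = (\<Sum>l\<in>S. Poly_Mapping.lookup L l * \<Phi> l)"
  unfolding linext_def by (intro sum.mono_neutral_left) (auto simp: in_keys_iff)

lemma linext_add: "linext \<Phi> (L + M) = linext \<Phi> L + linext \<Phi> M"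
proof -
  let ?S = "Poly_Mapping.keys L \<union> Poly_Mapping.keys M"
  have "Poly_Mapping.keys (L + M) \<subseteq> ?S" by (rule keys_add)
  then show ?thesis
    by (subst (1 2 3) linext_superset[of ?S])
       (auto simp: lookup_add distrib_right sum.distrib)
qed

lemma linext_single: "linext \<Phi> (Poly_Mapping.single l a) = a * \<Phi> l"
  by (subst linext_superset[of "{l}"]) auto

lemma linext_zero [simp]: "linext \<Phi> 0 = 0"
  by (simp add: linext_def)

lemma linext_sum: "linext \<Phi> (\<Sum>i\<in>S. L i) = (\<Sum>i\<in>S. linext \<Phi> (L i))"
  by (induction S rule: infinite_finite_induct) (simp_all add: linext_add)

text \<open>A functional whose values on monomials depend on the weight only factors through
  \<open>toric_hom\<close>, hence kills the toric ideal.\<close>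

lemma linext_toric_hom:
  "linext \<Phi> (toric_hom \<gamma> f) = (\<Sum>m\<in>Poly_Mapping.keys f. Poly_Mapping.lookup f m * \<Phi> (weight \<gamma> m))"
  by (subst poly_mapping_eq_sum_single[of f])
     (simp add: toric_hom_sum toric_hom_single linext_sum linext_single)

definition torus_point :: "('n::finite \<Rightarrow> int ^ 'd::finite) \<Rightarrow> 'k::field ^ 'd \<Rightarrow> 'k ^ 'n" where
  "torus_point \<gamma> t = (\<chi> j. lchar t (\<gamma> j))"

lemma mon_torus_point:
  assumes "t \<in> torus"
  shows "mon (torus_point \<gamma> t) m = lchar t (weight \<gamma> m)"
  using assms by (simp add: mon_def torus_point_def weight_def lchar_sum lchar_of_nat_scale)

lemma eval_torus_point:
  assumes "t \<in> torus"
  shows "eval_poly (($) (torus_point \<gamma> t)) f = linext (lchar t) (toric_hom \<gamma> f)"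
  using assms by (simp add: eval_poly_mon linext_toric_hom mon_torus_point)

lemma linext_lchar_eq_0:
  fixes L :: "('d::finite, 'k::alg_closed_field) laurent"
  assumes "\<And>t. t \<in> torus \<Longrightarrow> linext (lchar t) L = 0"
  shows "L = 0"
proof -
  have "\<forall>l\<in>Poly_Mapping.keys L. Poly_Mapping.lookup L l = 0"
    using assms by (intro lchar_independent) (simp_all add: linext_def)
  then show ?thesis by (intro poly_mapping_eqI) (auto simp: in_keys_iff)
qed

lemma eval_cong_toric_hom:
  fixes f g :: "('n::finite, 'k::comm_ring_1) mpoly"
  assumes "x \<in> toric_variety \<gamma>" "toric_hom \<gamma> f = toric_hom \<gamma> g"
  shows "eval_poly (($) x) f = eval_poly (($) x) g"
proof -
  have "toric_hom \<gamma> (f - g) = 0" using assms(2) by (simp add: toric_hom_diff)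
  then have "eval_poly (($) x) (f - g) = 0"
    using assms(1) by (auto simp: toric_variety_def zero_set_def)
  then show ?thesis by (simp add: eval_poly_diff)
qed

lemma torus_point_in_toric_variety: "t \<in> torus \<Longrightarrow> torus_point \<gamma> t \<in> toric_variety \<gamma>"
  by (auto simp: toric_variety_def zero_set_def eval_torus_point)

text \<open>By independence of characters a Laurent polynomial is determined by its values on the
  torus. So the toric ideal is the vanishing ideal of the torus points.\<close>

lemma toric_hom_eq_0_iff:
  fixes f :: "('n::finite, 'k::alg_closed_field) mpoly"
  shows "toric_hom \<gamma> f = 0 \<longleftrightarrow> (\<forall>t\<in>torus. eval_poly (($) (torus_point \<gamma> t)) f = 0)"
  using linext_lchar_eq_0[of "toric_hom \<gamma> f"] by (auto simp: eval_torus_point)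

text \<open>The torus points lie on the variety, so what vanishes on it is already in the toric
  ideal; no Nullstellensatz enters.\<close>

lemma vanishing_ideal_toric_variety:
  "f \<in> vanishing_ideal (toric_variety \<gamma> :: ('k::alg_closed_field ^ 'n::finite) set) \<longleftrightarrow> toric_hom \<gamma> f = 0"
proof
  assume "f \<in> vanishing_ideal (toric_variety \<gamma>)"
  then show "toric_hom \<gamma> f = 0"
    unfolding toric_hom_eq_0_iff vanishing_ideal_def using torus_point_in_toric_variety by blast
qed (simp add: vanishing_ideal_def toric_variety_def zero_set_def)

lemma pfun_vanish_toric:
  fixes h :: "'k::alg_closed_field ^ 'n::finite \<Rightarrow> 'k"
  assumes "pfun h" "\<And>t. t \<in> torus \<Longrightarrow> h (torus_point \<gamma> t) = 0" "x \<in> toric_variety \<gamma>"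
  shows "h x = 0"
proof -
  obtain f where f: "\<And>x. h x = eval_poly (($) x) f" using assms(1) by (metis pfun_def)
  then have "toric_hom \<gamma> f = 0" using assms(2) by (simp add: toric_hom_eq_0_iff)
  then show ?thesis using f assms(3) by (simp add: toric_variety_def zero_set_def)
qed

lemma eval_single: "eval_poly (($) x) (Poly_Mapping.single m a) = a * mon x m"
  by (simp add: eval_poly_simps mon_def)

text \<open>The difference of two monomials of equal weight is a binomial in the toric
  ideal.\<close>

lemma mon_cong_weight:
  fixes x :: "'k::comm_ring_1 ^ 'n::finite"
  assumes "x \<in> toric_variety \<gamma>" "weight \<gamma> m = weight \<gamma> m'"
  shows "mon x m = mon x m'"
  using eval_cong_toric_hom[OF assms(1), of "Poly_Mapping.single m 1" "Poly_Mapping.single m' 1"] assms(2)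
  by (simp add: toric_hom_single eval_single)

subsection \<open>Tangent spaces\<close>

lemma mon_minus_single:
  assumes "Poly_Mapping.lookup m v \<noteq> 0"
  shows "mon x (m - Poly_Mapping.single v 1) * x $ v = mon x m"
proof -
  have "mon x m = mon x (m - Poly_Mapping.single v 1) *
     (\<Prod>w\<in>UNIV. if w = v then x $ v else 1)"
    unfolding mon_def prod.distrib[symmetric]
  proof (intro prod.cong refl)
    fix w
    show "x $ w ^ Poly_Mapping.lookup m w = x $ w ^ Poly_Mapping.lookup (m - Poly_Mapping.single v 1) w *
       (if w = v then x $ v else 1)"
      using assms by (cases "w = v") (simp_all add: lookup_minus lookup_single flip: power_Suc2)
  qed
  then show ?thesis by simp
qed

text \<open>The factor \<open>x\<close> in the tangent vector turns partial derivatives into logarithmic ones.\<close>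

lemma sum_partial_deriv:
  fixes f :: "('n::finite, 'k::comm_ring_1) mpoly"
  assumes "finite S" "Poly_Mapping.keys f \<subseteq> S"
  shows "(\<Sum>i\<in>UNIV. eval_poly (($) x) (partial_deriv i f) * (x $ i * w i)) =
    (\<Sum>m\<in>S. Poly_Mapping.lookup f m * (\<Sum>i\<in>UNIV. of_nat (Poly_Mapping.lookup m i) * w i) * mon x m)"
proof -
  have "eval_poly (($) x) (partial_deriv i f) * (x $ i * w i) =
     (\<Sum>m\<in>Poly_Mapping.keys f. Poly_Mapping.lookup f m * (of_nat (Poly_Mapping.lookup m i) * w i) * mon x m)" for i
  proof -
    have "eval_poly (($) x) (partial_deriv i f) * (x $ i * w i) =
      (\<Sum>m\<in>Poly_Mapping.keys f. (of_nat (Poly_Mapping.lookup m i) * Poly_Mapping.lookup f m) *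
         (mon x (m - Poly_Mapping.single i 1) * x $ i) * w i)"
      by (simp add: partial_deriv_def eval_poly_simps(4) eval_single sum_distrib_right mult.assoc)
    also have "\<dots> = (\<Sum>m\<in>Poly_Mapping.keys f. (of_nat (Poly_Mapping.lookup m i) * Poly_Mapping.lookup f m) * mon x m * w i)"
    proof (intro sum.cong refl)
      fix m
      show "(of_nat (Poly_Mapping.lookup m i) * Poly_Mapping.lookup f m) *
         (mon x (m - Poly_Mapping.single i 1) * x $ i) * w i =
         (of_nat (Poly_Mapping.lookup m i) * Poly_Mapping.lookup f m) * mon x m * w i"
      proof (cases "Poly_Mapping.lookup m i = 0")
        case False
        show ?thesis unfolding mon_minus_single[OF False] ..
      qed simp
    qed
    finally show ?thesis by (simp add: ac_simps)
  qed
  then have "(\<Sum>i\<in>UNIV. eval_poly (($) x) (partial_deriv i f) * (x $ i * w i)) =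
    (\<Sum>m\<in>Poly_Mapping.keys f. \<Sum>i\<in>UNIV. Poly_Mapping.lookup f m * (of_nat (Poly_Mapping.lookup m i) * w i) * mon x m)"
    by (simp add: sum.swap[of _ UNIV])
  also have "\<dots> = (\<Sum>m\<in>Poly_Mapping.keys f. Poly_Mapping.lookup f m * (\<Sum>i\<in>UNIV. of_nat (Poly_Mapping.lookup m i) * w i) * mon x m)"
    by (simp add: sum_distrib_left sum_distrib_right)
  also have "\<dots> = (\<Sum>m\<in>S. Poly_Mapping.lookup f m * (\<Sum>i\<in>UNIV. of_nat (Poly_Mapping.lookup m i) * w i) * mon x m)"
    using assms by (intro sum.mono_neutral_left) (auto simp: in_keys_iff)
  finally show ?thesis .
qed

text \<open>The derivation \<open>t_a d/dt_a\<close> in the parametrisation: it multiplies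
  \<open>t\<close> to the power \<open>\<gamma> j\<close> by \<open>\<gamma> j $ a\<close>, read in
  the field.\<close>

definition log_frame :: "('n::finite \<Rightarrow> int ^ 'd::finite) \<Rightarrow> 'k::field ^ 'n \<Rightarrow> 'd \<Rightarrow> 'k ^ 'n" where
  "log_frame \<gamma> x a = (\<chi> j. x $ j * of_int (\<gamma> j $ a))"

text \<open>The derivative along this vector multiplies a monomial by a coordinate of its weight, so
  it factors through \<open>toric_hom\<close>. This holds at every point, also outside the
  torus.\<close>

lemma log_frame_in_tangent_space:
  fixes x :: "'k::alg_closed_field ^ 'n::finite"
  assumes x: "x \<in> toric_variety \<gamma>"
  shows "log_frame \<gamma> x a \<in> tangent_space (toric_variety \<gamma>) x"
  unfolding tangent_space_def
proof (intro CollectI ballI)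
  fix f :: "('n, 'k) mpoly"
  assume f: "f \<in> vanishing_ideal (toric_variety \<gamma>)"
  define \<mu> where "\<mu> l = mon x (SOME m. weight \<gamma> m = l)" for l
  have \<mu>: "mon x m = \<mu> (weight \<gamma> m)" for m
    unfolding \<mu>_def by (rule mon_cong_weight[OF x]) (metis (mono_tags, lifting) someI)
  have w: "(\<Sum>i\<in>UNIV. of_nat (Poly_Mapping.lookup m i) * of_int (\<gamma> i $ a)) = (of_int (weight \<gamma> m $ a) :: 'k)" for m
    by (simp add: weight_def)
  have "(\<Sum>i\<in>UNIV. eval_poly (($) x) (partial_deriv i f) * log_frame \<gamma> x a $ i)
      = (\<Sum>m\<in>Poly_Mapping.keys f. Poly_Mapping.lookup f m * of_int (weight \<gamma> m $ a) * \<mu> (weight \<gamma> m))"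
    unfolding log_frame_def vec_lambda_beta w[symmetric] \<mu>[symmetric]
    by (rule sum_partial_deriv) auto
  also have "\<dots> = linext (\<lambda>l. of_int (l $ a) * \<mu> l) (toric_hom \<gamma> f)"
    by (simp add: linext_toric_hom mult.assoc)
  also have "\<dots> = 0"
    using f by (simp add: vanishing_ideal_toric_variety)
  finally show "(\<Sum>i\<in>UNIV. eval_poly (($) x) (partial_deriv i f) * log_frame \<gamma> x a $ i) = 0" .
qed

lemma subspace_tangent_space: "vec.subspace (tangent_space X x)"
  by (auto simp: vec.subspace_def tangent_space_def distrib_left sum.distrib mult.left_commute
      simp flip: sum_distrib_left)

lemma torus_point_nonzero: "t \<in> torus \<Longrightarrow> torus_point \<gamma> t $ j \<noteq> 0"
  by (simp add: torus_point_def lchar_nonzero)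

text \<open>An integer inverse on one side of the matrix of exponents. Being integral, the identity
  can be read in a field of any characteristic.\<close>

lemma int_span_basis:
  assumes "int_span \<gamma> = UNIV"
  obtains C where "\<And>a b. (\<Sum>j\<in>UNIV. C a j * \<gamma> j $ b) = (if a = b then 1 else 0)"
proof -
  have "\<forall>a. \<exists>c. axis a 1 = (\<Sum>j\<in>UNIV. c j *s \<gamma> j)"
    using assms unfolding int_span_def by blast
  then obtain C where C: "\<And>a. axis a 1 = (\<Sum>j\<in>UNIV. C a j *s \<gamma> j)" by metis
  have "(\<Sum>j\<in>UNIV. C a j * \<gamma> j $ b) = (if a = b then 1 else 0)" for a b
    using arg_cong[OF C[of a], of "\<lambda>v. v $ b"] by (auto simp: axis_def)
  then show thesis by (rule that)
qed

text \<open>The coordinates of \<open>x\<close> cancel from a relation, and the image of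
  \<open>C\<close> in the field then isolates each coefficient.\<close>

lemma lin_indep_log_frame:
  fixes x :: "'k::field ^ 'n::finite"
  assumes \<gamma>: "int_span \<gamma> = UNIV" and x: "\<And>j. x $ j \<noteq> 0"
  shows "lin_indep (log_frame \<gamma> x)"
  unfolding lin_indep_def
proof (intro allI impI)
  fix c b assume c: "(\<Sum>a\<in>UNIV. c a *s log_frame \<gamma> x a) = 0"
  obtain C where C: "\<And>a b. (\<Sum>j\<in>UNIV. C a j * \<gamma> j $ b) = (if a = b then 1 else 0)"
    using int_span_basis[OF \<gamma>] by blast
  have 0: "(\<Sum>a\<in>UNIV. c a * of_int (\<gamma> j $ a)) = 0" for j
  proof -
    have "x $ j * (\<Sum>a\<in>UNIV. c a * of_int (\<gamma> j $ a)) = 0"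
      using arg_cong[OF c, of "\<lambda>v. v $ j"] by (simp add: log_frame_def sum_distrib_left mult.left_commute)
    then show ?thesis using x by simp
  qed
  have "c b = (\<Sum>a\<in>UNIV. c a * of_int (\<Sum>j\<in>UNIV. C b j * \<gamma> j $ a))"
    by (simp add: C if_distrib[of of_int] if_distrib[of "(*) _"] cong: if_cong)
  also have "\<dots> = (\<Sum>a\<in>UNIV. \<Sum>j\<in>UNIV. of_int (C b j) * (c a * of_int (\<gamma> j $ a)))"
    by (simp add: sum_distrib_left mult.left_commute)
  also have "\<dots> = (\<Sum>j\<in>UNIV. of_int (C b j) * (\<Sum>a\<in>UNIV. c a * of_int (\<gamma> j $ a)))"
    by (subst sum.swap) (simp add: sum_distrib_left)
  also have "\<dots> = 0" by (simp add: 0)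
  finally show "c b = 0" .
qed

text \<open>Divide a tangent vector by the coordinates of the point. The binomial equations force
  the quotients \<open>w\<close> to satisfy every integer relation among the exponents, so
  \<open>w\<close> is induced by an additive map on the lattice, that is, by a combination of the
  logarithmic frame.\<close>

lemma tangent_space_torus_point:
  fixes t :: "'k::alg_closed_field ^ 'd::finite" and \<gamma> :: "'n::finite \<Rightarrow> int ^ 'd"
  assumes \<gamma>: "int_span \<gamma> = UNIV" and t: "t \<in> torus"
  shows "tangent_space (toric_variety \<gamma>) (torus_point \<gamma> t) = vec.span (range (log_frame \<gamma> (torus_point \<gamma> t)))"
proof
  let ?x = "torus_point \<gamma> t" and ?X = "toric_variety \<gamma> :: ('k ^ 'n) set"
  have x: "?x \<in> ?X" using t by (rule torus_point_in_toric_variety)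
  show "vec.span (range (log_frame \<gamma> ?x)) \<subseteq> tangent_space ?X ?x"
    using log_frame_in_tangent_space[OF x] by (intro vec.span_minimal subspace_tangent_space) auto
  show "tangent_space ?X ?x \<subseteq> vec.span (range (log_frame \<gamma> ?x))"
  proof
    fix v assume v: "v \<in> tangent_space ?X ?x"
    define w where "w j = v $ j / ?x $ j" for j
    have vw: "v $ j = ?x $ j * w j" for j
      by (simp add: w_def torus_point_nonzero[OF t])
    have rel: "(\<Sum>j\<in>UNIV. of_int (c j) * w j) = 0" if c: "(\<Sum>j\<in>UNIV. c j *s \<gamma> j) = 0" for c
    proof (cases "c = (\<lambda>_. 0)")
      case False
      \<comment> \<open>The positive and negative parts of \<open>c\<close> are two monomials of the
        same weight, distinct since \<open>c\<close> is nonzero; their difference is an equation of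
        the variety.\<close>
      define m m' where "m = Abs_poly_mapping (\<lambda>j. nat (c j))" and "m' = Abs_poly_mapping (\<lambda>j. nat (- c j))"
      have m: "Poly_Mapping.lookup m j = nat (c j)" "Poly_Mapping.lookup m' j = nat (- c j)" for j
        by (simp_all add: m_def m'_def Abs_poly_mapping_inverse)
      obtain j where "c j \<noteq> 0" using False by blast
      then have ne: "m \<noteq> m'" using m[of j] by fastforce
      have "weight \<gamma> m - weight \<gamma> m' = (\<Sum>j\<in>UNIV. c j *s \<gamma> j)"
        unfolding weight_def sum_subtractf[symmetric] m by (intro sum.cong) (auto simp: vec_eq_iff)
      then have wt: "weight \<gamma> m = weight \<gamma> m'" using c by simp
      let ?f = "Poly_Mapping.single m 1 - Poly_Mapping.single m' 1 :: ('n, 'k) mpoly"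
      have "?f \<in> vanishing_ideal ?X"
        by (simp add: vanishing_ideal_toric_variety toric_hom_diff toric_hom_single wt)
      then have "0 = (\<Sum>i\<in>UNIV. eval_poly (($) ?x) (partial_deriv i ?f) * (?x $ i * w i))"
        using v unfolding vw[symmetric] by (simp add: tangent_space_def)
      also have "\<dots> = (\<Sum>l\<in>{m, m'}. Poly_Mapping.lookup ?f l *
          (\<Sum>i\<in>UNIV. of_nat (Poly_Mapping.lookup l i) * w i) * mon ?x l)"
        by (rule sum_partial_deriv) (use keys_diff[of "Poly_Mapping.single m 1" "Poly_Mapping.single m' (1::'k)"] in auto)
      also have "\<dots> = ((\<Sum>i\<in>UNIV. of_nat (Poly_Mapping.lookup m i) * w i) -
          (\<Sum>i\<in>UNIV. of_nat (Poly_Mapping.lookup m' i) * w i)) * mon ?x m"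
        using ne mon_cong_weight[OF x wt] by (simp add: lookup_minus lookup_single algebra_simps)
      also have "(\<Sum>i\<in>UNIV. of_nat (Poly_Mapping.lookup m i) * w i) -
          (\<Sum>i\<in>UNIV. of_nat (Poly_Mapping.lookup m' i) * w i) = (\<Sum>i\<in>UNIV. of_int (c i) * w i)"
      proof -
        have "of_nat (nat k) - of_nat (nat (- k)) = (of_int k :: 'k)" for k
          by (cases "k \<ge> 0") simp_all
        then show ?thesis
          unfolding sum_subtractf[symmetric] m left_diff_distrib[symmetric] by simp
      qed
      finally show ?thesis
        using t by (simp add: mon_torus_point lchar_nonzero)
    qed simp
    obtain C where C: "\<And>a b. (\<Sum>j\<in>UNIV. C a j * \<gamma> j $ b) = (if a = b then 1 else 0)"
      using int_span_basis[OF \<gamma>] by blast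
    \<comment> \<open>\<open>u a\<close> is the value on the unit vector of index \<open>a\<close>
      of the additive map with values \<open>w j\<close> on \<open>\<gamma> j\<close>.\<close>
    define u where "u a = (\<Sum>k\<in>UNIV. of_int (C a k) * w k)" for a
    have w: "w j = (\<Sum>a\<in>UNIV. of_int (\<gamma> j $ a) * u a)" for j
    proof -
      \<comment> \<open>The relation obtained by writing \<open>\<gamma> j\<close> in unit vectors
        and these in turn, through \<open>C\<close>, in the generators.\<close>
      define c where "c k = (if k = j then 1 else 0) - (\<Sum>a\<in>UNIV. \<gamma> j $ a * C a k)" for k
      have "(\<Sum>k\<in>UNIV. c k * \<gamma> k $ b) = 0" for b
      proof -
        have "(\<Sum>k\<in>UNIV. c k * \<gamma> k $ b) =
          (\<Sum>k\<in>UNIV. if k = j then \<gamma> k $ b else 0) - (\<Sum>k\<in>UNIV. \<Sum>a\<in>UNIV. \<gamma> j $ a * (C a k * \<gamma> k $ b))"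
          unfolding sum_subtractf[symmetric]
          by (intro sum.cong) (auto simp: c_def left_diff_distrib sum_distrib_right mult.assoc)
        also have "(\<Sum>k\<in>UNIV. \<Sum>a\<in>UNIV. \<gamma> j $ a * (C a k * \<gamma> k $ b)) =
            (\<Sum>a\<in>UNIV. \<gamma> j $ a * (\<Sum>k\<in>UNIV. C a k * \<gamma> k $ b))"
          by (subst sum.swap) (simp add: sum_distrib_left)
        finally show ?thesis by (simp add: C if_distrib[of "(*) _"] cong: if_cong)
      qed
      then have "(\<Sum>k\<in>UNIV. c k *s \<gamma> k) = 0" by (simp add: vec_eq_iff)
      from rel[OF this] have "0 = (\<Sum>k\<in>UNIV. of_int (c k) * w k)" by simp
      also have "\<dots> = (\<Sum>k\<in>UNIV. if k = j then w k else 0) -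
           (\<Sum>k\<in>UNIV. \<Sum>a\<in>UNIV. of_int (\<gamma> j $ a) * (of_int (C a k) * w k))"
        unfolding sum_subtractf[symmetric]
        by (intro sum.cong) (auto simp: c_def left_diff_distrib sum_distrib_right mult.assoc)
      also have "(\<Sum>k\<in>UNIV. \<Sum>a\<in>UNIV. of_int (\<gamma> j $ a) * (of_int (C a k) * w k)) =
           (\<Sum>a\<in>UNIV. of_int (\<gamma> j $ a) * u a)"
        unfolding u_def by (subst sum.swap) (simp add: sum_distrib_left)
      finally show ?thesis by simp
    qed
    have "v = (\<Sum>a\<in>UNIV. u a *s log_frame \<gamma> ?x a)"
      by (simp add: vec_eq_iff vw w log_frame_def sum_distrib_left ac_simps)
    then show "v \<in> vec.span (range (log_frame \<gamma> ?x))"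
      unfolding span_range_iff by blast
  qed
qed

subsection \<open>The dimension of the toric variety\<close>

definition zclosure :: "('k::comm_semiring_1 ^ 'n::finite) set \<Rightarrow> ('k ^ 'n) set" where
  "zclosure S = zero_set (vanishing_ideal S)"

lemma subset_zclosure: "S \<subseteq> zclosure S"
  by (auto simp: zclosure_def zero_set_def vanishing_ideal_def)

lemma zclosure_mono: "S \<subseteq> T \<Longrightarrow> zclosure S \<subseteq> zclosure T"
  by (auto simp: zclosure_def zero_set_def vanishing_ideal_def)

lemma zclosure_minimal: "S \<subseteq> zero_set I \<Longrightarrow> zclosure S \<subseteq> zero_set I"
  by (auto simp: zclosure_def zero_set_def vanishing_ideal_def subset_iff)

lemma pfun_vanish_zclosure:
  assumes "pfun h" "\<And>x. x \<in> S \<Longrightarrow> h x = 0" "x \<in> zclosure S"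
  shows "h x = 0"
proof -
  obtain f where f: "\<And>x. h x = eval_poly (($) x) f" using assms(1) by (metis pfun_def)
  then have "f \<in> vanishing_ideal S" using assms(2) by (simp add: vanishing_ideal_def)
  then show ?thesis using f assms(3) by (simp add: zclosure_def zero_set_def)
qed

text \<open>Irreducibility as primality of the vanishing ideal.\<close>

lemma irreducible_pfun:
  fixes Z :: "('k::idom ^ 'n::finite) set"
  assumes Z: "irreducible_algebraic_set Z" and g: "pfun g" and h: "pfun h"
    and gh: "\<And>x. x \<in> Z \<Longrightarrow> g x * h x = 0"
  shows "(\<forall>x\<in>Z. g x = 0) \<or> (\<forall>x\<in>Z. h x = 0)"
proof -
  obtain g' h' where *: "\<And>x. g x = eval_poly (($) x) g'" "\<And>x. h x = eval_poly (($) x) h'"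
    using g h by (metis pfun_def)
  have "Z \<subseteq> zero_set {g'} \<union> zero_set {h'}"
    using gh by (auto simp: zero_set_def *)
  then have "Z \<subseteq> zero_set {g'} \<or> Z \<subseteq> zero_set {h'}"
    using Z unfolding irreducible_algebraic_set_def by blast
  then show ?thesis by (auto simp: zero_set_def *)
qed

text \<open>Bounding each exponent instead of the total degree makes the count exactly
  \<open>Suc D ^ k\<close>. Entries from \<open>k\<close> on are fixed to 0, so each vector is one
  function.\<close>

definition exponents :: "nat \<Rightarrow> nat \<Rightarrow> (nat \<Rightarrow> nat) set" where
  "exponents D k = {\<alpha>. (\<forall>i<k. \<alpha> i \<le> D) \<and> (\<forall>i\<ge>k. \<alpha> i = 0)}"

lemma exponents_0: "exponents D 0 = {\<lambda>_. 0}"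
  by (auto simp: exponents_def)

lemma exponents_Suc: "exponents D (Suc k) = (\<lambda>(\<alpha>, j). \<alpha>(k := j)) ` (exponents D k \<times> {..D})"
proof
  show "exponents D (Suc k) \<subseteq> (\<lambda>(\<alpha>, j). \<alpha>(k := j)) ` (exponents D k \<times> {..D})"
  proof
    fix \<alpha> assume "\<alpha> \<in> exponents D (Suc k)"
    then show "\<alpha> \<in> (\<lambda>(\<alpha>, j). \<alpha>(k := j)) ` (exponents D k \<times> {..D})"
      by (intro image_eqI[of _ _ "(\<alpha>(k := 0), \<alpha> k)"]) (auto simp: exponents_def)
  qed
qed (auto simp: exponents_def)

lemma inj_on_exponents: "inj_on (\<lambda>(\<alpha>, j). \<alpha>(k := j)) (exponents D k \<times> {..D})"
proof (rule inj_onI, clarify)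
  fix \<alpha> \<beta> :: "nat \<Rightarrow> nat" and i j
  assume *: "\<alpha> \<in> exponents D k" "\<beta> \<in> exponents D k" "\<alpha>(k := i) = \<beta>(k := j)"
  have "\<alpha> x = \<beta> x" for x
    using fun_cong[OF *(3), of x] *(1,2) by (cases "x = k") (auto simp: exponents_def)
  moreover have "i = j" using fun_cong[OF *(3), of k] by simp
  ultimately show "\<alpha> = \<beta> \<and> i = j" by blast
qed

lemma finite_exponents: "finite (exponents D k)"
  by (induction k) (simp_all add: exponents_0 exponents_Suc)

lemma card_exponents: "card (exponents D k) = Suc D ^ k"
  by (induction k)
     (simp_all add: exponents_0 exponents_Suc card_image[OF inj_on_exponents] card_cartesian_product)

text \<open>
  Functions that separate the members of a chain of irreducible sets are algebraically independent:
  divide a relation by the largest possible power of the last function and restrict it to the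
  zeros of that function.
\<close>

lemma chain_monomials_independent:
  fixes Z :: "nat \<Rightarrow> ('k::field ^ 'n::finite) set"
  assumes irr: "\<And>i. i \<le> k \<Longrightarrow> irreducible_algebraic_set (Z i)"
    and mono: "\<And>i. i < k \<Longrightarrow> Z i \<subseteq> Z (Suc i)"
    and pf: "\<And>i. i < k \<Longrightarrow> pfun (f i)"
    and zero: "\<And>i x. i < k \<Longrightarrow> x \<in> Z i \<Longrightarrow> f i x = 0"
    and nz: "\<And>i. i < k \<Longrightarrow> \<exists>x\<in>Z (Suc i). f i x \<noteq> 0"
    and rel: "\<And>x. x \<in> Z k \<Longrightarrow> (\<Sum>\<alpha>\<in>exponents D k. c \<alpha> * (\<Prod>i<k. f i x ^ \<alpha> i)) = 0"
    and \<alpha>: "\<alpha> \<in> exponents D k"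
  shows "c \<alpha> = 0"
  using assms
proof (induction k arbitrary: c \<alpha>)
  case 0
  have "Z 0 \<noteq> {}" using 0(1)[of 0] by (simp add: irreducible_algebraic_set_def)
  then obtain x where x: "x \<in> Z 0" by blast
  show ?case using 0(6)[OF x] 0(7) by (simp add: exponents_0)
next
  case (Suc k)
  note prems = Suc.prems
  \<comment> \<open>\<open>H j\<close> is the coefficient of \<open>f k ^ j\<close> when the
    relation is ordered by powers of the last function.\<close>
  define H where "H j x = (\<Sum>\<alpha>\<in>exponents D k. c (\<alpha>(k := j)) * (\<Prod>i<k. f i x ^ \<alpha> i))" for j x
  have pH: "pfun (H j)" for j
    unfolding H_def using prems(3) by (intro pfun_sum pfun_mult pfun_const pfun_prod pfun_power) auto
  have IH: "c (\<alpha>(k := j)) = 0" if "\<And>x. x \<in> Z k \<Longrightarrow> H j x = 0" "\<alpha> \<in> exponents D k" for \<alpha> j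
    by (rule Suc.IH[where c = "\<lambda>\<alpha>. c (\<alpha>(k := j))"]) (use prems that in \<open>simp_all add: H_def\<close>)
  have sumH: "(\<Sum>j\<le>D. H j x * f k x ^ j) = 0" if x: "x \<in> Z (Suc k)" for x
  proof -
    have "0 = (\<Sum>\<alpha>\<in>exponents D (Suc k). c \<alpha> * (\<Prod>i<Suc k. f i x ^ \<alpha> i))"
      using prems(6)[OF x] by simp
    also have "\<dots> = (\<Sum>(\<alpha>, j)\<in>exponents D k \<times> {..D}. c (\<alpha>(k := j)) * (\<Prod>i<Suc k. f i x ^ (\<alpha>(k := j)) i))"
      unfolding exponents_Suc by (subst sum.reindex[OF inj_on_exponents]) (simp add: case_prod_unfold)
    also have "\<dots> = (\<Sum>\<alpha>\<in>exponents D k. \<Sum>j\<le>D. c (\<alpha>(k := j)) * (\<Prod>i<k. f i x ^ \<alpha> i) * f k x ^ j)"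
      by (subst sum.cartesian_product[symmetric]) (simp add: mult.assoc)
    also have "\<dots> = (\<Sum>j\<le>D. H j x * f k x ^ j)"
      unfolding H_def by (subst sum.swap) (simp add: sum_distrib_right)
    finally show ?thesis by simp
  qed
  have key: "\<forall>\<alpha>\<in>exponents D k. c (\<alpha>(k := j)) = 0" if "j \<le> D" for j
    using that
  proof (induction j rule: less_induct)
    case (less j)
    \<comment> \<open>Lower coefficient functions vanish identically, not only on
      \<open>Z k\<close>, as all their scalars are already known to be 0.\<close>
    have H0: "H j' x = 0" if "j' < j" for j' x
    proof -
      have "\<forall>\<alpha>\<in>exponents D k. c (\<alpha>(k := j')) = 0"
        by (rule less.IH[OF that]) (use that less.prems in linarith)
      then show ?thesis
        unfolding H_def by (intro sum.neutral) (auto simp del: fun_upd_apply)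
    qed
    \<comment> \<open>What remains of the higher terms after division by
      \<open>f k ^ Suc j\<close>.\<close>
    define Q where "Q x = (\<Sum>i\<in>{j<..D}. H i x * f k x ^ (i - Suc j))" for x
    have pQ: "pfun Q"
      unfolding Q_def using prems(3) by (intro pfun_sum pfun_mult pH pfun_power) auto
    have "f k x ^ j * (H j x + f k x * Q x) = 0" if x: "x \<in> Z (Suc k)" for x
    proof -
      have "{..D} = {..<j} \<union> insert j {j<..D}" using less.prems by auto
      then have "(\<Sum>i\<le>D. H i x * f k x ^ i) = (\<Sum>i<j. H i x * f k x ^ i) + (\<Sum>i\<in>insert j {j<..D}. H i x * f k x ^ i)"
        by (simp only:) (rule sum.union_disjoint, auto)
      then have "0 = H j x * f k x ^ j + (\<Sum>i\<in>{j<..D}. H i x * f k x ^ i)"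
        using sumH[OF x] by (simp add: H0)
      also have "(\<Sum>i\<in>{j<..D}. H i x * f k x ^ i) = f k x ^ j * (f k x * Q x)"
        unfolding Q_def sum_distrib_left
      proof (intro sum.cong refl)
        fix i assume "i \<in> {j<..D}"
        then have "i = j + (1 + (i - Suc j))" by simp
        then have "f k x ^ i = f k x ^ j * (f k x * f k x ^ (i - Suc j))"
          by (metis power_add power_one_right)
        then show "H i x * f k x ^ i = f k x ^ j * (f k x * (H i x * f k x ^ (i - Suc j)))"
          by (simp add: ac_simps)
      qed
      finally show ?thesis by (simp add: algebra_simps)
    qed
    moreover have "pfun (\<lambda>x. f k x ^ j)" "pfun (\<lambda>x. H j x + f k x * Q x)"
      by (intro pfun_power pfun_add pfun_mult pH pQ prems(3) lessI)+
    ultimately have "(\<forall>x\<in>Z (Suc k). f k x ^ j = 0) \<or> (\<forall>x\<in>Z (Suc k). H j x + f k x * Q x = 0)"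
      using prems(1)[of "Suc k"] by (intro irreducible_pfun) auto
    moreover have "\<exists>x\<in>Z (Suc k). f k x ^ j \<noteq> 0" using prems(5)[of k] by auto
    ultimately have "H j x + f k x * Q x = 0" if "x \<in> Z (Suc k)" for x using that by blast
    \<comment> \<open>On \<open>Z k\<close> the last function vanishes, which leaves a relation in
      one function fewer.\<close>
    then have "H j x = 0" if "x \<in> Z k" for x
      using prems(2)[of k] prems(4)[of k x] that by fastforce
    then show ?case using IH by blast
  qed
  from prems(7) obtain \<beta> j where "\<alpha> = \<beta>(k := j)" "\<beta> \<in> exponents D k" "j \<le> D"
    by (auto simp: exponents_Suc)
  then show ?case using key by blast
qed

text \<open>Gaussian elimination: more unknowns than equations. An equation with a pivot
  \<open>a0\<close> removes one of each.\<close>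

lemma ex_nontrivial_solution:
  fixes M :: "'a \<Rightarrow> 'b \<Rightarrow> 'k::field"
  assumes "finite B" "finite A" "card B < card A"
  shows "\<exists>c. (\<exists>a\<in>A. c a \<noteq> 0) \<and> (\<forall>b\<in>B. (\<Sum>a\<in>A. c a * M a b) = 0)"
  using assms
proof (induction B arbitrary: A M rule: finite_induct)
  case empty
  then have "A \<noteq> {}" by auto
  then show ?case by (intro exI[of _ "\<lambda>_. 1"]) auto
next
  case (insert b B)
  show ?case
  proof (cases "\<forall>a\<in>A. M a b = 0")
    case True
    from insert.IH[of A M] insert.prems insert.hyps
    obtain c where "\<exists>a\<in>A. c a \<noteq> 0" "\<forall>b\<in>B. (\<Sum>a\<in>A. c a * M a b) = 0" by auto
    with True show ?thesis by (intro exI[of _ c]) auto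
  next
    case False
    then obtain a0 where a0: "a0 \<in> A" "M a0 b \<noteq> 0" by blast
    let ?A = "A - {a0}"
    define M' where "M' a b' = M a b' - M a b / M a0 b * M a0 b'" for a b'
    have "card B < card ?A" using insert.prems insert.hyps a0 by (simp add: card_Diff_singleton)
    with insert.IH[of ?A M'] insert.prems
    obtain c where c: "\<exists>a\<in>?A. c a \<noteq> 0" "\<forall>b'\<in>B. (\<Sum>a\<in>?A. c a * M' a b') = 0" by auto
    \<comment> \<open>The value \<open>- s\<close> of the eliminated unknown is the one that solves
      the pivot equation.\<close>
    define s where "s = (\<Sum>a\<in>?A. c a * (M a b / M a0 b))"
    define c' where "c' = c(a0 := - s)"
    have sum: "(\<Sum>a\<in>A. c' a * M a b') = (\<Sum>a\<in>?A. c a * M' a b')" for b'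
    proof -
      have "(\<Sum>a\<in>A. c' a * M a b') = - s * M a0 b' + (\<Sum>a\<in>?A. c' a * M a b')"
        using insert.prems a0 by (subst sum.remove[of A a0]) (auto simp: c'_def)
      also have "(\<Sum>a\<in>?A. c' a * M a b') = (\<Sum>a\<in>?A. c a * M a b')"
        by (intro sum.cong) (auto simp: c'_def)
      also have "- s * M a0 b' + (\<Sum>a\<in>?A. c a * M a b') = (\<Sum>a\<in>?A. c a * M' a b')"
        unfolding s_def M'_def
        by (simp add: right_diff_distrib sum_subtractf sum_distrib_right mult.assoc)
      finally show ?thesis .
    qed
    have "(\<Sum>a\<in>A. c' a * M a b) = 0"
      unfolding sum M'_def using a0 by simp
    moreover have "\<exists>a\<in>A. c' a \<noteq> 0" using c(1) by (auto simp: c'_def)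
    ultimately show ?thesis using c(2) by (intro exI[of _ c']) (auto simp: sum)
  qed
qed

section \<open>Supports of Laurent polynomials\<close>

definition lattice_box :: "nat \<Rightarrow> (int ^ 'd::finite) set" where
  "lattice_box N = {l. \<forall>a. \<bar>l $ a\<bar> \<le> int N}"

lemma finite_card_lattice_box:
  "finite (lattice_box N :: (int ^ 'd::finite) set)" "card (lattice_box N :: (int ^ 'd) set) \<le> (2 * N + 1) ^ CARD('d)"
proof -
  let ?P = "PiE (UNIV :: 'd set) (\<lambda>_. {- int N..int N})"
  have fin: "finite ?P" by (intro finite_PiE) auto
  have sub: "(lattice_box N :: (int ^ 'd) set) \<subseteq> vec_lambda ` ?P"
  proof
    fix l :: "int ^ 'd" assume "l \<in> lattice_box N"
    then have "($) l \<in> ?P" by (auto simp: lattice_box_def abs_le_iff minus_le_iff)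
    then show "l \<in> vec_lambda ` ?P" by (metis image_eqI vec_lambda_eta)
  qed
  show "finite (lattice_box N :: (int ^ 'd) set)" using sub fin by (meson finite_imageI finite_subset)
  have "card (lattice_box N :: (int ^ 'd) set) \<le> card ?P"
    using sub fin by (meson card_image_le card_mono finite_imageI order_trans)
  also have "\<dots> = (2 * N + 1) ^ CARD('d)"
    by (simp add: card_PiE nat_add_distrib nat_mult_distrib)
  finally show "card (lattice_box N :: (int ^ 'd) set) \<le> (2 * N + 1) ^ CARD('d)" .
qed

lemma lattice_box_mono: "N \<le> M \<Longrightarrow> lattice_box N \<subseteq> lattice_box M"
  unfolding lattice_box_def by (auto intro: order_trans)

lemma ex_lattice_box: "finite S \<Longrightarrow> \<exists>N. S \<subseteq> lattice_box N"
proof (induction S rule: finite_induct)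
  case (insert l S)
  then obtain N where "S \<subseteq> lattice_box N" by blast
  moreover have "l \<in> lattice_box (nat (\<Sum>a\<in>UNIV. \<bar>l $ a\<bar>))"
    by (auto simp: lattice_box_def sum_nonneg intro: member_le_sum)
  ultimately have "insert l S \<subseteq> lattice_box (max N (nat (\<Sum>a\<in>UNIV. \<bar>l $ a\<bar>)))"
    using lattice_box_mono[of N "max N (nat (\<Sum>a\<in>UNIV. \<bar>l $ a\<bar>))"]
      lattice_box_mono[of "nat (\<Sum>a\<in>UNIV. \<bar>l $ a\<bar>)" "max N (nat (\<Sum>a\<in>UNIV. \<bar>l $ a\<bar>))"] by auto
  then show ?case by blast
qed simp

lemma zero_in_lattice_box [simp]: "0 \<in> lattice_box N"
  by (simp add: lattice_box_def)

lemma keys_mult_lattice_box: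
  assumes "Poly_Mapping.keys L \<subseteq> lattice_box N" "Poly_Mapping.keys M \<subseteq> lattice_box N'"
  shows "Poly_Mapping.keys (L * M) \<subseteq> lattice_box (N + N')"
proof
  fix l assume "l \<in> Poly_Mapping.keys (L * M)"
  then obtain a b where "l = a + b" "a \<in> lattice_box N" "b \<in> lattice_box N'"
    using keys_mult[of L M] assms by blast
  then show "l \<in> lattice_box (N + N')"
    by (auto simp: lattice_box_def intro: order_trans[OF abs_triangle_ineq] add_mono)
qed

lemma keys_power_lattice_box:
  "Poly_Mapping.keys L \<subseteq> lattice_box N \<Longrightarrow> Poly_Mapping.keys (L ^ k) \<subseteq> lattice_box (k * N)"
  by (induction k) (simp_all add: keys_mult_lattice_box)

lemma keys_prod_lattice_box:
  assumes "finite S" "\<And>i. i \<in> S \<Longrightarrow> Poly_Mapping.keys (L i) \<subseteq> lattice_box (N i)"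
  shows "Poly_Mapping.keys (\<Prod>i\<in>S. L i) \<subseteq> lattice_box (\<Sum>i\<in>S. N i)"
  using assms by (induction S rule: finite_induct) (simp_all add: keys_mult_lattice_box)

lemma toric_hom_one: "toric_hom \<gamma> 1 = 1"
  using toric_hom_single[of \<gamma> 0 1] by (simp add: weight_def)

lemma toric_hom_power: "toric_hom \<gamma> (f ^ k) = toric_hom \<gamma> f ^ k"
  by (induction k) (simp_all add: toric_hom_one toric_hom_mult)

lemma toric_hom_prod: "toric_hom \<gamma> (\<Prod>i\<in>S. f i) = (\<Prod>i\<in>S. toric_hom \<gamma> (f i))"
  by (induction S rule: infinite_finite_induct) (simp_all add: toric_hom_one toric_hom_mult)

lemma eval_poly_one: "eval_poly x 1 = 1"
  using eval_poly_simps(5)[of x 1] by simp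

lemma eval_poly_power: "eval_poly x (f ^ k) = eval_poly x f ^ k"
  by (induction k) (simp_all add: eval_poly_one eval_poly_simps)

lemma eval_poly_prod: "eval_poly x (\<Prod>i\<in>S. f i) = (\<Prod>i\<in>S. eval_poly x (f i))"
  by (induction S rule: infinite_finite_induct) (simp_all add: eval_poly_one eval_poly_simps)

text \<open>Evaluation at a point of the variety is linear in the coefficients of the Laurent
  polynomial, so relations among these coefficients become relations among values.\<close>

lemma eval_on_toric_variety:
  fixes x :: "'k::comm_ring_1 ^ 'n::finite"
  assumes x: "x \<in> toric_variety \<gamma>"
  obtains \<mu> where "\<And>f. eval_poly (($) x) f = linext \<mu> (toric_hom \<gamma> f)"
proof -
  define \<mu> where "\<mu> l = mon x (SOME m. weight \<gamma> m = l)" for l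
  have \<mu>: "mon x m = \<mu> (weight \<gamma> m)" for m
    unfolding \<mu>_def by (rule mon_cong_weight[OF x]) (metis (mono_tags, lifting) someI)
  have "eval_poly (($) x) f = linext \<mu> (toric_hom \<gamma> f)" for f
    by (simp add: eval_poly_mon linext_toric_hom \<mu>)
  then show thesis by (rule that)
qed

text \<open>A chain of length \<open>k\<close> yields \<open>Suc D ^ k\<close> independent monomials
  in separating functions, while their Laurent supports lie in a box whose size grows like
  \<open>D ^ CARD('d)\<close>. For \<open>k > CARD('d)\<close> there would be too many.\<close>

lemma chain_length_le:
  fixes \<gamma> :: "'n::finite \<Rightarrow> int ^ 'd::finite" and Z :: "nat \<Rightarrow> ('k::field ^ 'n) set"
  assumes irr: "\<And>i. i \<le> k \<Longrightarrow> irreducible_algebraic_set (Z i)"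
    and ZX: "\<And>i. i \<le> k \<Longrightarrow> Z i \<subseteq> toric_variety \<gamma>"
    and strict: "\<And>i. i < k \<Longrightarrow> Z i \<subset> Z (Suc i)"
  shows "k \<le> CARD('d)"
proof (rule ccontr)
  assume kd: "\<not> k \<le> CARD('d)"
  have "\<exists>f. (\<forall>x\<in>Z i. eval_poly (($) x) f = 0) \<and> (\<exists>x\<in>Z (Suc i). eval_poly (($) x) f \<noteq> 0)" if i: "i < k" for i
  proof -
    obtain I where I: "Z i = zero_set I"
      using irr[of i] i by (auto simp: irreducible_algebraic_set_def)
    obtain x where "x \<in> Z (Suc i)" "x \<notin> Z i" using strict[OF i] by blast
    then show ?thesis unfolding I zero_set_def by blast
  qed
  then obtain f where f: "\<And>i x. i < k \<Longrightarrow> x \<in> Z i \<Longrightarrow> eval_poly (($) x) (f i) = 0"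
    "\<And>i. i < k \<Longrightarrow> \<exists>x\<in>Z (Suc i). eval_poly (($) x) (f i) \<noteq> 0"
    by metis
  obtain N where N: "(\<Union>i<k. Poly_Mapping.keys (toric_hom \<gamma> (f i))) \<subseteq> lattice_box N"
    using ex_lattice_box[of "\<Union>i<k. Poly_Mapping.keys (toric_hom \<gamma> (f i))"] by auto
  \<comment> \<open>The constants satisfy \<open>2 * (k * (D * N)) + 1 \<le> C * Suc D\<close> and
    \<open>C ^ CARD('d) = D\<close>, so the box has at most \<open>D * Suc D ^ CARD('d)\<close>
    points, fewer than \<open>Suc D ^ Suc CARD('d)\<close>.\<close>
  define C where "C = 2 * (k * N) + 1"
  define D where "D = C ^ CARD('d)"
  define g where "g \<alpha> = (\<Prod>i<k. f i ^ \<alpha> i)" for \<alpha>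
  let ?B = "lattice_box (k * (D * N)) :: (int ^ 'd) set"
  have keys: "Poly_Mapping.keys (toric_hom \<gamma> (g \<alpha>)) \<subseteq> ?B" if "\<alpha> \<in> exponents D k" for \<alpha>
  proof -
    have "Poly_Mapping.keys (toric_hom \<gamma> (g \<alpha>)) \<subseteq> lattice_box (\<Sum>i<k. \<alpha> i * N)"
      unfolding g_def toric_hom_prod toric_hom_power
      using N by (intro keys_prod_lattice_box keys_power_lattice_box) auto
    also have "(\<Sum>i<k. \<alpha> i * N) \<le> (\<Sum>i<k. D * N)"
      using that by (intro sum_mono mult_right_mono) (auto simp: exponents_def)
    then have "lattice_box (\<Sum>i<k. \<alpha> i * N) \<subseteq> ?B" by (intro lattice_box_mono) simp
    finally show ?thesis .
  qed
  have "card ?B \<le> (2 * (k * (D * N)) + 1) ^ CARD('d)" by (rule finite_card_lattice_box)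
  also have "\<dots> \<le> (C * Suc D) ^ CARD('d)"
    unfolding C_def by (intro power_mono) (simp_all add: algebra_simps)
  also have "\<dots> = D * Suc D ^ CARD('d)" by (simp only: power_mult_distrib D_def)
  also have "\<dots> < Suc D * Suc D ^ CARD('d)" by simp
  also have "\<dots> = Suc D ^ Suc CARD('d)" by simp
  also have "\<dots> \<le> Suc D ^ k" using kd by (intro power_increasing) auto
  finally have "card ?B < card (exponents D k)" by (simp add: card_exponents)
  \<comment> \<open>One unknown for each exponent vector, one equation for each lattice point of the
    box.\<close>
  from ex_nontrivial_solution[OF finite_card_lattice_box(1) finite_exponents this,
      of "\<lambda>\<alpha> l. Poly_Mapping.lookup (toric_hom \<gamma> (g \<alpha>)) l :: 'k"]
  obtain c :: "(nat \<Rightarrow> nat) \<Rightarrow> 'k" where c: "\<exists>\<alpha>\<in>exponents D k. c \<alpha> \<noteq> 0"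
    "\<And>l. l \<in> ?B \<Longrightarrow> (\<Sum>\<alpha>\<in>exponents D k. c \<alpha> * Poly_Mapping.lookup (toric_hom \<gamma> (g \<alpha>)) l) = 0"
    by (elim exE conjE) blast
  have "(\<Sum>\<alpha>\<in>exponents D k. c \<alpha> * (\<Prod>i<k. eval_poly (($) x) (f i) ^ \<alpha> i)) = 0" if "x \<in> Z k" for x
  proof -
    have "x \<in> toric_variety \<gamma>" using ZX[of k] that by blast
    then obtain \<mu> where \<mu>: "\<And>f. eval_poly (($) x) f = linext \<mu> (toric_hom \<gamma> f)"
      using eval_on_toric_variety by blast
    have "(\<Sum>\<alpha>\<in>exponents D k. c \<alpha> * (\<Prod>i<k. eval_poly (($) x) (f i) ^ \<alpha> i))
        = (\<Sum>\<alpha>\<in>exponents D k. c \<alpha> * (\<Sum>l\<in>?B. Poly_Mapping.lookup (toric_hom \<gamma> (g \<alpha>)) l * \<mu> l))"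
    proof (intro sum.cong refl arg_cong2[where f = "(*)"])
      fix \<alpha> assume \<alpha>: "\<alpha> \<in> exponents D k"
      show "(\<Prod>i<k. eval_poly (($) x) (f i) ^ \<alpha> i) = (\<Sum>l\<in>?B. Poly_Mapping.lookup (toric_hom \<gamma> (g \<alpha>)) l * \<mu> l)"
        unfolding linext_superset[OF finite_card_lattice_box(1) keys[OF \<alpha>], symmetric] \<mu>[symmetric]
        by (simp add: g_def eval_poly_prod eval_poly_power)
    qed
    also have "\<dots> = (\<Sum>l\<in>?B. (\<Sum>\<alpha>\<in>exponents D k. c \<alpha> * Poly_Mapping.lookup (toric_hom \<gamma> (g \<alpha>)) l) * \<mu> l)"
      unfolding sum_distrib_left sum_distrib_right by (subst sum.swap) (simp add: mult.assoc)
    also have "\<dots> = 0" by (simp add: c(2))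
    finally show ?thesis .
  qed
  then have "c \<alpha> = 0" if "\<alpha> \<in> exponents D k" for \<alpha>
    using that irr strict f
    by (intro chain_monomials_independent[where Z = Z and k = k and f = "\<lambda>i x. eval_poly (($) x) (f i)"
          and D = D and c = c]) auto
  with c(1) show False by blast
qed

text \<open>
  Along the line through two points of the torus, a polynomial function on the torus becomes a
  rational function, hence has finitely many zeros unless it vanishes identically.
\<close>

lemma torus_line_avoids_zeros:
  fixes t t' :: "'k::alg_closed_field ^ 'd::finite" and \<gamma> :: "'n::finite \<Rightarrow> int ^ 'd"
  assumes t: "t \<in> torus" "t' \<in> torus"
    and f: "eval_poly (($) (torus_point \<gamma> t)) f \<noteq> 0" and g: "eval_poly (($) (torus_point \<gamma> t')) g \<noteq> 0"
  obtains s where "(\<chi> a. t $ a + s * (t' $ a - t $ a)) \<in> torus"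
    "eval_poly (($) (torus_point \<gamma> (\<chi> a. t $ a + s * (t' $ a - t $ a)))) f \<noteq> 0"
    "eval_poly (($) (torus_point \<gamma> (\<chi> a. t $ a + s * (t' $ a - t $ a)))) g \<noteq> 0"
proof -
  define c where "c s = (\<chi> a. t $ a + s * (t' $ a - t $ a))" for s
  define q where "q a = [:t $ a, t' $ a - t $ a:]" for a
  define R where "R = (\<Prod>a\<in>UNIV. q a)"
  have q: "poly (q a) s = c s $ a" for a s by (simp add: q_def c_def)
  have R: "poly R s = (\<Prod>a\<in>UNIV. c s $ a)" for s by (simp add: R_def poly_prod q)
  \<comment> \<open>\<open>R\<close> vanishes exactly where the line leaves the torus;
    \<open>rat\<close> means that a power of \<open>R\<close> clears the denominator.\<close>
  define rat where "rat h \<longleftrightarrow> (\<exists>P N. \<forall>s. poly R s \<noteq> 0 \<longrightarrow> h s * poly R s ^ N = poly P s)"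
    for h :: "'k \<Rightarrow> 'k"
  have rat_const: "rat (\<lambda>_. b)" for b
    unfolding rat_def by (rule exI[of _ "[:b:]"], rule exI[of _ 0]) simp
  have rat_add: "rat (\<lambda>s. h s + h' s)" if hh: "rat h" "rat h'" for h h'
  proof -
    obtain P N where P: "\<And>s. poly R s \<noteq> 0 \<Longrightarrow> h s * poly R s ^ N = poly P s"
      using hh(1) unfolding rat_def by blast
    obtain P' N' where P': "\<And>s. poly R s \<noteq> 0 \<Longrightarrow> h' s * poly R s ^ N' = poly P' s"
      using hh(2) unfolding rat_def by blast
    have "(h s + h' s) * poly R s ^ (N + N') = poly (P * R ^ N' + P' * R ^ N) s" if "poly R s \<noteq> 0" for s
      using P[OF that, symmetric] P'[OF that, symmetric] by (simp add: power_add algebra_simps)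
    then show ?thesis unfolding rat_def by blast
  qed
  have rat_mult: "rat (\<lambda>s. h s * h' s)" if hh: "rat h" "rat h'" for h h'
  proof -
    obtain P N where P: "\<And>s. poly R s \<noteq> 0 \<Longrightarrow> h s * poly R s ^ N = poly P s"
      using hh(1) unfolding rat_def by blast
    obtain P' N' where P': "\<And>s. poly R s \<noteq> 0 \<Longrightarrow> h' s * poly R s ^ N' = poly P' s"
      using hh(2) unfolding rat_def by blast
    have "h s * h' s * poly R s ^ (N + N') = poly (P * P') s" if "poly R s \<noteq> 0" for s
      using P[OF that, symmetric] P'[OF that, symmetric] by (simp add: power_add ac_simps)
    then show ?thesis unfolding rat_def by blast
  qed
  have rat_power: "rat (\<lambda>s. h s ^ k)" if "rat h" for h k
    using that by (induction k) (auto intro: rat_const rat_mult)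
  have rat_prod: "rat (\<lambda>s. \<Prod>i\<in>S. h i s)" if "\<And>i. rat (h i)" for h :: "'i \<Rightarrow> 'k \<Rightarrow> 'k" and S
    using that by (induction S rule: infinite_finite_induct) (auto intro: rat_const rat_mult)
  have rat_sum: "rat (\<lambda>s. \<Sum>i\<in>S. h i s)" if "\<And>i. rat (h i)" for h :: "'i \<Rightarrow> 'k \<Rightarrow> 'k" and S
    using that by (induction S rule: infinite_finite_induct) (auto intro: rat_const rat_add)
  have rat_c: "rat (\<lambda>s. c s $ a)" for a
    unfolding rat_def by (rule exI[of _ "q a"], rule exI[of _ 0]) (simp add: q)
  \<comment> \<open>The inverse of one factor of \<open>R\<close> is the product of the other
    factors divided by \<open>R\<close>.\<close>
  have rat_inv: "rat (\<lambda>s. inverse (c s $ a))" for a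
    unfolding rat_def
  proof (rule exI[of _ "\<Prod>b\<in>UNIV - {a}. q b"], rule exI[of _ 1], intro allI impI)
    fix s assume "poly R s \<noteq> 0"
    then have "c s $ a \<noteq> 0" by (simp add: R)
    moreover have "poly R s = c s $ a * poly (\<Prod>b\<in>UNIV - {a}. q b) s"
      unfolding R poly_prod q by (rule prod.remove) auto
    ultimately show "inverse (c s $ a) * poly R s ^ 1 = poly (\<Prod>b\<in>UNIV - {a}. q b) s" by simp
  qed
  have rat_powi: "rat (\<lambda>s. c s $ a powi i)" for a i
    by (cases "i \<ge> 0") (simp_all add: power_int_def rat_power rat_c rat_inv)
  have rat_poly: "rat (\<lambda>s. eval_poly (($) (torus_point \<gamma> (c s))) h)" for h
    unfolding eval_poly_def poly_subst_def torus_point_def vec_lambda_beta lchar_def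
    by (intro rat_sum rat_mult rat_const rat_prod rat_power rat_powi)
  obtain P N P' N' where P: "\<And>s. poly R s \<noteq> 0 \<Longrightarrow> eval_poly (($) (torus_point \<gamma> (c s))) f * poly R s ^ N = poly P s"
    "\<And>s. poly R s \<noteq> 0 \<Longrightarrow> eval_poly (($) (torus_point \<gamma> (c s))) g * poly R s ^ N' = poly P' s"
    using rat_poly[of f] rat_poly[of g] unfolding rat_def by blast
  have c01: "c 0 = t" "c 1 = t'" by (simp_all add: c_def)
  have R01: "poly R 0 \<noteq> 0" "poly R 1 \<noteq> 0" using t by (simp_all add: R c01 torus_def)
  \<comment> \<open>The ends \<open>s = 0\<close> and \<open>s = 1\<close> witness that
    \<open>P\<close> and \<open>P'\<close> are not the zero polynomial.\<close>
  have "poly P 0 \<noteq> 0" "poly P' 1 \<noteq> 0"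
    using P(1)[OF R01(1)] P(2)[OF R01(2)] R01 f g by (auto simp: c01)
  then have "P * P' * R \<noteq> 0" using R01 by auto
  then have "finite {s. poly (P * P' * R) s = 0}" by (rule poly_roots_finite)
  then obtain s where s: "poly (P * P' * R) s \<noteq> 0"
    using infinite_alg_closed_field by (metis (mono_tags, lifting) UNIV_eq_I mem_Collect_eq)
  then have "poly R s \<noteq> 0" by auto
  then have "c s \<in> torus" by (simp add: R torus_def)
  moreover have "eval_poly (($) (torus_point \<gamma> (c s))) f \<noteq> 0" "eval_poly (($) (torus_point \<gamma> (c s))) g \<noteq> 0"
    using P[OF \<open>poly R s \<noteq> 0\<close>] s by auto
  ultimately show thesis using that[of s] by (simp add: c_def)
qed

text \<open>Coordinates equal to 1 at two points are 1 along their line. If neither set of a cover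
  suffices, an equation of each is nonzero at some point of the subtorus, and a point of the joining
  line avoids both.\<close>

lemma irreducible_subtorus_closure:
  fixes \<gamma> :: "'n::finite \<Rightarrow> int ^ 'd::finite"
  defines "T \<equiv> \<lambda>A. {t \<in> torus :: ('k::alg_closed_field ^ 'd) set. \<forall>a\<in>A. t $ a = 1}"
  shows "irreducible_algebraic_set (zclosure (torus_point \<gamma> ` T A))"
  unfolding irreducible_algebraic_set_def
proof (intro conjI ballI impI)
  show "zclosure (torus_point \<gamma> ` T A) \<in> range zero_set"
    by (simp add: zclosure_def)
  have "(\<chi> a. 1) \<in> T A" by (simp add: T_def torus_def)
  then show "zclosure (torus_point \<gamma> ` T A) \<noteq> {}" using subset_zclosure by blast
  fix U V :: "('k ^ 'n) set"
  assume "U \<in> range zero_set" "V \<in> range zero_set" and sub: "zclosure (torus_point \<gamma> ` T A) \<subseteq> U \<union> V"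
  then obtain I J where IJ: "U = zero_set I" "V = zero_set J" by auto
  show "zclosure (torus_point \<gamma> ` T A) \<subseteq> U \<or> zclosure (torus_point \<gamma> ` T A) \<subseteq> V"
  proof (rule ccontr)
    assume "\<not> (zclosure (torus_point \<gamma> ` T A) \<subseteq> U \<or> zclosure (torus_point \<gamma> ` T A) \<subseteq> V)"
    then have "\<not> torus_point \<gamma> ` T A \<subseteq> zero_set I" "\<not> torus_point \<gamma> ` T A \<subseteq> zero_set J"
      using zclosure_minimal IJ by blast+
    then obtain t t' f g where t: "t \<in> T A" "f \<in> I" "eval_poly (($) (torus_point \<gamma> t)) f \<noteq> 0"
      "t' \<in> T A" "g \<in> J" "eval_poly (($) (torus_point \<gamma> t')) g \<noteq> 0"
      by (auto simp: zero_set_def)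
    then have tt: "t \<in> torus" "t' \<in> torus" by (simp_all add: T_def)
    obtain s where s: "(\<chi> a. t $ a + s * (t' $ a - t $ a)) \<in> torus"
      "eval_poly (($) (torus_point \<gamma> (\<chi> a. t $ a + s * (t' $ a - t $ a)))) f \<noteq> 0"
      "eval_poly (($) (torus_point \<gamma> (\<chi> a. t $ a + s * (t' $ a - t $ a)))) g \<noteq> 0"
      using torus_line_avoids_zeros[OF tt t(3,6)] by blast
    define u where "u = (\<chi> a. t $ a + s * (t' $ a - t $ a))"
    have "u \<in> T A" using s(1) t(1,4) by (simp add: T_def u_def)
    then have "torus_point \<gamma> u \<in> U \<union> V" using sub subset_zclosure by blast
    then show False using s(2,3) t(2,5) unfolding u_def[symmetric] IJ zero_set_def by blast
  qed
qed

text \<open>Positive and negative parts of integer coefficients: every character is a quotient of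
  two monomials on the torus.\<close>

lemma ex_weight_diff:
  assumes "int_span \<gamma> = UNIV"
  obtains m m' where "weight \<gamma> m = weight \<gamma> m' + l"
proof -
  obtain c where c: "l = (\<Sum>j\<in>UNIV. c j *s \<gamma> j)"
    using assms unfolding int_span_def by blast
  define m m' where "m = Abs_poly_mapping (\<lambda>j. nat (c j))" and "m' = Abs_poly_mapping (\<lambda>j. nat (- c j))"
  have m: "Poly_Mapping.lookup m j = nat (c j)" "Poly_Mapping.lookup m' j = nat (- c j)" for j
    by (simp_all add: m_def m'_def Abs_poly_mapping_inverse)
  have "weight \<gamma> m - weight \<gamma> m' = l"
    unfolding weight_def sum_subtractf[symmetric] m c by (intro sum.cong) (auto simp: vec_eq_iff)
  then show thesis using that by (metis add.commute diff_add_cancel)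
qed

lemma pfun_mon: "pfun (\<lambda>x. mon x m)"
  unfolding mon_def by (intro pfun_prod pfun_power pfun_var)

text \<open>For the lower bound, the closures of the subtori that release one coordinate after
  another form a chain of irreducible sets.\<close>

lemma alg_dim_toric_variety:
  fixes \<gamma> :: "'n::finite \<Rightarrow> int ^ 'd::finite"
  assumes \<gamma>: "int_span \<gamma> = UNIV"
  shows "alg_dim (toric_variety \<gamma> :: ('k::alg_closed_field ^ 'n) set) = enat CARD('d)"
proof (rule antisym)
  show "alg_dim (toric_variety \<gamma> :: ('k ^ 'n) set) \<le> enat CARD('d)"
    unfolding alg_dim_def
  proof (rule Sup_least, clarify)
    fix k and Z :: "nat \<Rightarrow> ('k ^ 'n) set"
    assume *: "\<forall>i\<le>k. irreducible_algebraic_set (Z i) \<and> Z i \<subseteq> toric_variety \<gamma>" "\<forall>i<k. Z i \<subset> Z (Suc i)"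
    have "k \<le> CARD('d)"
      by (rule chain_length_le[of k Z \<gamma>]) (use * in blast)+
    then show "enat k \<le> enat CARD('d)" by simp
  qed
  obtain e :: "nat \<Rightarrow> 'd" where e: "bij_betw e {0..<CARD('d)} UNIV"
    using ex_bij_betw_nat_finite[of "UNIV :: 'd set"] by auto
  \<comment> \<open>\<open>A k\<close> holds the coordinates frozen to 1: \<open>T 0\<close> is one
    point, and \<open>T CARD('d)\<close> is the whole torus.\<close>
  define A where "A k = e ` {k..<CARD('d)}" for k
  define T where "T k = {t \<in> torus :: ('k ^ 'd) set. \<forall>a\<in>A k. t $ a = 1}" for k
  define Z where "Z k = zclosure (torus_point \<gamma> ` T k)" for k
  have irr: "irreducible_algebraic_set (Z k)" for k
    unfolding Z_def T_def by (rule irreducible_subtorus_closure)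
  have ZX: "Z k \<subseteq> toric_variety \<gamma>" for k
    unfolding Z_def toric_variety_def
    by (rule zclosure_minimal) (auto simp: T_def torus_point_in_toric_variety simp flip: toric_variety_def)
  have strict: "Z k \<subset> Z (Suc k)" if k: "k < CARD('d)" for k
  proof -
    have "A (Suc k) \<subseteq> A k" by (auto simp: A_def)
    then have "T k \<subseteq> T (Suc k)" by (auto simp: T_def)
    then have sub: "Z k \<subseteq> Z (Suc k)" unfolding Z_def by (intro zclosure_mono image_mono)
    obtain m m' where m: "weight \<gamma> m = weight \<gamma> m' + axis (e k) 1"
      using ex_weight_diff[OF \<gamma>] by blast
    \<comment> \<open>Up to a nonvanishing factor, \<open>h\<close> is \<open>t $ e k - 1\<close> on
      the torus, so it vanishes on \<open>Z k\<close>.\<close>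
    define h where "h x = mon x m - mon x m'" for x :: "'k ^ 'n"
    have h: "h (torus_point \<gamma> t) = lchar t (weight \<gamma> m') * (t $ e k - 1)" if "t \<in> torus" for t
    proof -
      have "lchar t (axis (e k) 1) = (\<Prod>a\<in>UNIV. if a = e k then t $ a else 1)"
        unfolding lchar_def by (intro prod.cong) (auto simp: axis_def)
      then show ?thesis using that by (simp add: h_def mon_torus_point m lchar_add algebra_simps)
    qed
    have "e k \<in> A k" using k by (auto simp: A_def)
    then have "h x = 0" if "x \<in> torus_point \<gamma> ` T k" for x
      using that by (auto simp: h T_def)
    moreover have "pfun h" unfolding h_def by (intro pfun_diff pfun_mon)
    ultimately have h0: "h x = 0" if "x \<in> Z k" for x
      using pfun_vanish_zclosure[of h "torus_point \<gamma> ` T k" x] that unfolding Z_def by blast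
    \<comment> \<open>Moving only coordinate \<open>e k\<close> to a value other than 0 and 1 gives
      a point of the next subtorus where \<open>h\<close> is nonzero.\<close>
    obtain s :: 'k where "s \<notin> {0, 1}"
      using infinite_alg_closed_field by (metis UNIV_eq_I finite.emptyI finite.insertI)
    then have s: "s \<noteq> 0" "s \<noteq> 1" by auto
    define t where "t = (\<chi> a. if a = e k then s else 1)"
    have "e k \<notin> A (Suc k)"
      using e k unfolding A_def bij_betw_def inj_on_def by fastforce
    then have t: "t \<in> T (Suc k)" "t \<in> torus" using s by (auto simp: T_def t_def torus_def)
    then have "torus_point \<gamma> t \<in> Z (Suc k)"
      unfolding Z_def by (intro subsetD[OF subset_zclosure] imageI)
    moreover have "h (torus_point \<gamma> t) \<noteq> 0"
      using s by (simp add: h t lchar_nonzero) (simp add: t_def)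
    ultimately show ?thesis using sub h0 by blast
  qed
  show "enat CARD('d) \<le> alg_dim (toric_variety \<gamma> :: ('k ^ 'n) set)"
    unfolding alg_dim_def
    by (rule Sup_upper, rule CollectI, rule exI[of _ "CARD('d)"], rule conjI[OF refl], rule exI[of _ Z])
       (simp add: irr ZX strict)
qed

subsection \<open>The Nash blowup as the closure of its part over the torus\<close>

lemma linext_scale: "linext \<Phi> (Poly_Mapping.map ((*) a) f) = a * linext \<Phi> f"
proof -
  have "Poly_Mapping.keys (Poly_Mapping.map ((*) a) f) \<subseteq> Poly_Mapping.keys f"
    by (auto simp: in_keys_iff map.rep_eq when_def split: if_splits)
  then have "linext \<Phi> (Poly_Mapping.map ((*) a) f)
      = (\<Sum>m\<in>Poly_Mapping.keys f. Poly_Mapping.lookup (Poly_Mapping.map ((*) a) f) m * \<Phi> m)"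
    by (intro linext_superset) auto
  also have "\<dots> = a * linext \<Phi> f"
    unfolding linext_def sum_distrib_left
    by (intro sum.cong) (auto simp: map.rep_eq when_def in_keys_iff mult.assoc)
  finally show ?thesis .
qed

lemma eval_poly_linext: "eval_poly (($) x) f = linext (mon x) f"
  by (simp add: eval_poly_mon linext_def)

lemma eval_partial_deriv_linext:
  "eval_poly (($) x) (partial_deriv i f) =
    linext (\<lambda>m. of_nat (Poly_Mapping.lookup m i) * mon x (m - Poly_Mapping.single i 1)) f"
  by (simp add: partial_deriv_def eval_poly_simps(4) eval_poly_simps(7) mon_def linext_def ac_simps)

text \<open>Finite-dimensional duality for the dot product: a vector outside \<open>U\<close> is
  detected by a linear functional that kills \<open>U\<close>.\<close>

lemma double_annihilator:
  fixes U :: "('k::field ^ 'n::finite) set"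
  assumes U: "vec.subspace U"
    and l: "\<And>v. (\<And>u. u \<in> U \<Longrightarrow> (\<Sum>i\<in>UNIV. u $ i * v $ i) = 0) \<Longrightarrow> (\<Sum>i\<in>UNIV. l $ i * v $ i) = 0"
  shows "l \<in> U"
proof (rule ccontr)
  assume lU: "l \<notin> U"
  obtain S where S: "S \<subseteq> U" "vec.independent S" "U \<subseteq> vec.span S"
    using vec.maximal_independent_subset by metis
  have spanS: "vec.span S = U" using S U by (metis subset_antisym vec.span_subspace)
  obtain i0 :: 'n where True by blast
  have "vec.independent (insert l S)"
    using S lU spanS by (simp add: vec.independent_insert)
  \<comment> \<open>The extension is vector-valued; its coordinate \<open>i0\<close> is the
    functional that is 1 at \<open>l\<close> and 0 on \<open>S\<close>.\<close>
  from vec.linear_independent_extend[OF this, of "\<lambda>x. if x = l then axis i0 1 else 0 :: 'k ^ 'n"]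
  obtain g where g: "Vector_Spaces.linear (*s) (*s) g"
    "\<forall>x\<in>insert l S. g x = (if x = l then axis i0 1 else 0 :: 'k ^ 'n)" by blast
  interpret g: Vector_Spaces.linear "(*s)" "(*s)" g by fact
  define v where "v = (\<chi> i. g (axis i 1) $ i0)"
  have gv: "g u $ i0 = (\<Sum>i\<in>UNIV. u $ i * v $ i)" for u
  proof -
    have "u = (\<Sum>i\<in>UNIV. u $ i *s axis i 1)"
      by (simp add: vec_eq_iff axis_def if_distrib[of "(*) _"] cong: if_cong)
    then have "g u = (\<Sum>i\<in>UNIV. u $ i *s g (axis i 1))"
      by (metis (no_types, lifting) g.scale g.sum sum.cong)
    then show ?thesis by (simp add: v_def)
  qed
  have "g u = 0" if "u \<in> U" for u
  proof (rule g.eq_0_on_span[of S])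
    show "g x = 0" if "x \<in> S" for x
    proof -
      have "x \<noteq> l" using that S(1) lU by auto
      then show ?thesis using g(2) that by simp
    qed
    show "u \<in> vec.span S" using that spanS by simp
  qed
  then have "(\<Sum>i\<in>UNIV. l $ i * v $ i) = 0"
    by (intro l) (simp flip: gv)
  then have "g l $ i0 = 0" by (simp add: gv)
  then show False using g(2) by (simp add: axis_def)
qed

text \<open>The gradients at \<open>x\<close> form a subspace whose annihilator is the tangent space
  by definition; duality recovers every form vanishing there as a gradient.\<close>

lemma ex_gradient:
  fixes X :: "('k::field ^ 'n::finite) set"
  assumes "\<And>v. v \<in> tangent_space X x \<Longrightarrow> (\<Sum>i\<in>UNIV. l $ i * v $ i) = 0"
  shows "\<exists>g\<in>vanishing_ideal X. \<forall>i. eval_poly (($) x) (partial_deriv i g) = l $ i"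
proof -
  let ?grad = "\<lambda>f. (\<chi> i. eval_poly (($) x) (partial_deriv i f))"
  have "vec.subspace (?grad ` vanishing_ideal X)"
    unfolding vec.subspace_def
  proof (intro conjI ballI allI)
    have "0 \<in> vanishing_ideal X" by (simp add: vanishing_ideal_def eval_poly_linext)
    moreover have "?grad 0 = 0" by (simp add: eval_partial_deriv_linext vec_eq_iff)
    ultimately show "0 \<in> ?grad ` vanishing_ideal X" by (metis imageI)
  next
    fix u v assume "u \<in> ?grad ` vanishing_ideal X" "v \<in> ?grad ` vanishing_ideal X"
    then obtain f g where "f \<in> vanishing_ideal X" "g \<in> vanishing_ideal X" "u = ?grad f" "v = ?grad g" by blast
    then have "f + g \<in> vanishing_ideal X"
      by (simp add: vanishing_ideal_def eval_poly_linext linext_add)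
    moreover have "u + v = ?grad (f + g)"
      using \<open>u = ?grad f\<close> \<open>v = ?grad g\<close> by (simp add: eval_partial_deriv_linext vec_eq_iff linext_add)
    ultimately show "u + v \<in> ?grad ` vanishing_ideal X" by blast
  next
    fix a v assume "v \<in> ?grad ` vanishing_ideal X"
    then obtain f where "f \<in> vanishing_ideal X" "v = ?grad f" by blast
    then have "Poly_Mapping.map ((*) a) f \<in> vanishing_ideal X"
      by (simp add: vanishing_ideal_def eval_poly_linext linext_scale)
    moreover have "a *s v = ?grad (Poly_Mapping.map ((*) a) f)"
      using \<open>v = ?grad f\<close> by (simp add: eval_partial_deriv_linext vec_eq_iff linext_scale)
    ultimately show "a *s v \<in> ?grad ` vanishing_ideal X" by blast
  qed
  then have "l \<in> ?grad ` vanishing_ideal X"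
  proof (rule double_annihilator)
    fix v assume v: "\<And>u. u \<in> ?grad ` vanishing_ideal X \<Longrightarrow> (\<Sum>i\<in>UNIV. u $ i * v $ i) = 0"
    have "v \<in> tangent_space X x"
      using v[OF imageI] by (simp add: tangent_space_def)
    then show "(\<Sum>i\<in>UNIV. l $ i * v $ i) = 0" by (rule assms)
  qed
  then show ?thesis by (auto simp: vec_eq_iff)
qed

text \<open>Column \<open>j c\<close> of the adjugate of \<open>N\<close>: the solution of
  \<open>N *v u = axis (j c) 1\<close> multiplied by \<open>det N\<close>, hence polynomial in the
  entries of \<open>N\<close>.\<close>

definition cramer_frame :: "'k::field ^ 'n::finite ^ 'n \<Rightarrow> ('d \<Rightarrow> 'n) \<Rightarrow> 'd \<Rightarrow> 'k ^ 'n" where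
  "cramer_frame N j c = (\<chi> i. det (\<chi> r s. if s = i then axis (j c) 1 $ r else N $ r $ s))"

text \<open>\<open>N\<close> sends \<open>v\<close> to a combination of the unit vectors with index
  in \<open>range j\<close>; applying its inverse writes \<open>v\<close> in columns of the
  adjugate.\<close>

lemma subset_span_cramer_frame:
  fixes N :: "'k::field ^ 'n::finite ^ 'n" and j :: "'d::finite \<Rightarrow> 'n"
  assumes det: "det N \<noteq> 0"
    and V: "\<And>v k. v \<in> V \<Longrightarrow> (N *v v) $ k = (if k \<in> range j then v $ k else 0)"
  shows "V \<subseteq> vec.span (range (cramer_frame N j))"
proof
  fix v assume v: "v \<in> V"
  have N: "N *v (inverse (det N) *s cramer_frame N j c) = axis (j c) 1" for c
    unfolding cramer[OF det] by (simp add: vec_eq_iff cramer_frame_def divide_inverse mult.commute)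
  have "\<forall>k\<in>range j. \<exists>c. j c = k" by blast
  then obtain c where c: "\<And>k. k \<in> range j \<Longrightarrow> j (c k) = k" by metis
  define u where "u = (\<Sum>k\<in>range j. v $ k *s (inverse (det N) *s cramer_frame N j (c k)))"
  have "N *v u = (\<Sum>k\<in>range j. v $ k *s axis k 1)"
    unfolding u_def vec.sum
  proof (intro sum.cong refl)
    fix k assume "k \<in> range j"
    then show "N *v (v $ k *s (inverse (det N) *s cramer_frame N j (c k))) = v $ k *s axis k 1"
      using N[of "c k"] c[of k] vec.scale[of N "v $ k" "inverse (det N) *s cramer_frame N j (c k)"] by simp
  qed
  also have "\<dots> = N *v v"
    by (simp add: vec_eq_iff V[OF v] axis_def if_distrib[of "(*) _"] cong: if_cong)
  finally have "N *v (v - u) = 0" by (simp add: matrix_vector_mult_diff_distrib)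
  moreover have "\<exists>M. M ** N = mat 1"
    using det invertible_det_nz invertible_left_inverse by blast
  ultimately have "v = u" by (metis matrix_left_invertible_ker eq_iff_diff_eq_0)
  also have "u \<in> vec.span (range (cramer_frame N j))"
    unfolding u_def by (intro vec.span_sum vec.span_scale vec.span_base rangeI)
  finally show "v \<in> vec.span (range (cramer_frame N j))" .
qed

text \<open>
  Near a point with a tangent space of dimension \<open>d\<close>, the Pluecker coordinates of the tangent spaces
  of this dimension are polynomial functions: there are equations of \<open>X\<close> that exhibit the tangent
  space as a graph over \<open>d\<close> of the coordinates, and Cramer's rule solves them.
\<close>

lemma local_polynomial_frame:
  fixes X :: "('k::field ^ 'n::finite) set"
  assumes dim: "vec.dim (tangent_space X x0) = CARD('d)"
  obtains \<delta> :: "'k ^ 'n \<Rightarrow> 'k" and H :: "'k ^ 'n \<Rightarrow> 'd::finite \<Rightarrow> 'k ^ 'n"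
  where "pfun \<delta>" "\<And>i. pfun (\<lambda>x. minors (H x) $ i)" "\<delta> x0 \<noteq> 0"
    "\<And>x. vec.dim (tangent_space X x) = CARD('d) \<Longrightarrow> \<delta> x \<noteq> 0 \<Longrightarrow>
       lin_indep (H x) \<and> vec.span (range (H x)) = tangent_space X x"
proof -
  obtain B :: "'d \<Rightarrow> 'k ^ 'n" where B: "lin_indep B" "vec.span (range B) = tangent_space X x0"
    using lin_indep_basis[OF subspace_tangent_space dim] by blast
  then obtain j where j: "minors B $ j \<noteq> 0"
    using lin_indep_imp_minors_nonzero by (metis vec_eq_iff zero_index)
  \<comment> \<open>On the tangent space at \<open>x0\<close>, coordinate \<open>k\<close> is the
    combination of the coordinates \<open>j c\<close> with coefficients \<open>s k c\<close>; the
    form \<open>l k\<close> expresses this.\<close>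
  define s where "s k c = minors B $ (j(c := k)) / minors B $ j" for k c
  define l :: "'n \<Rightarrow> 'k ^ 'n" where "l k = axis k 1 - (\<Sum>c\<in>UNIV. s k c *s axis (j c) 1)" for k
  have l: "(\<Sum>i\<in>UNIV. l k $ i * v $ i) = v $ k - (\<Sum>c\<in>UNIV. s k c * v $ j c)" for k v
  proof -
    have ax: "(\<Sum>i\<in>UNIV. axis r (1::'k) $ i * v $ i) = v $ r" for r
      by (simp add: axis_def if_distrib[of "\<lambda>y. y * _"] cong: if_cong)
    have "(\<Sum>i\<in>UNIV. l k $ i * v $ i) =
      (\<Sum>i\<in>UNIV. axis k 1 $ i * v $ i) - (\<Sum>i\<in>UNIV. \<Sum>c\<in>UNIV. s k c * (axis (j c) 1 $ i * v $ i))"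
      by (simp add: l_def left_diff_distrib sum_subtractf sum_distrib_right mult.assoc)
    also have "(\<Sum>i\<in>UNIV. \<Sum>c\<in>UNIV. s k c * (axis (j c) 1 $ i * v $ i)) =
        (\<Sum>c\<in>UNIV. s k c * (\<Sum>i\<in>UNIV. axis (j c) 1 $ i * v $ i))"
      by (subst sum.swap) (simp add: sum_distrib_left)
    finally show ?thesis by (simp only: ax)
  qed
  have l0: "(\<Sum>i\<in>UNIV. l k $ i * v $ i) = 0" if v: "v \<in> tangent_space X x0" for k v
  proof -
    have Bk: "B a $ k = (\<Sum>c\<in>UNIV. s k c * B a $ j c)" for a
      using cramer_minors[OF j, of a k] j
      by (simp add: s_def eq_divide_eq mult.commute flip: sum_divide_distrib)
    obtain b where b: "v = (\<Sum>a\<in>UNIV. b a *s B a)"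
      using v B(2) span_range_iff by blast
    have "v $ k = (\<Sum>a\<in>UNIV. \<Sum>c\<in>UNIV. s k c * (b a * B a $ j c))"
      by (simp add: b Bk sum_distrib_left mult.left_commute)
    also have "\<dots> = (\<Sum>c\<in>UNIV. s k c * v $ j c)"
      by (subst sum.swap) (simp add: b sum_distrib_left)
    finally show ?thesis by (simp add: l)
  qed
  have "\<forall>k. \<exists>g\<in>vanishing_ideal X. \<forall>i. eval_poly (($) x0) (partial_deriv i g) = l k $ i"
    using ex_gradient l0 by blast
  then obtain g where g: "\<And>k. g k \<in> vanishing_ideal X"
    "\<And>k i. eval_poly (($) x0) (partial_deriv i (g k)) = l k $ i" by metis
  \<comment> \<open>Unit rows keep the free coordinates; the other rows are gradients of equations
    and give 0 on tangent vectors.\<close>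
  define N :: "'k ^ 'n \<Rightarrow> 'k ^ 'n ^ 'n" where
    "N x = (\<chi> k i. if k \<in> range j then if i = k then 1 else 0 else eval_poly (($) x) (partial_deriv i (g k)))" for x
  have Nv: "(N x *v v) $ k = (if k \<in> range j then v $ k else
      (\<Sum>i\<in>UNIV. eval_poly (($) x) (partial_deriv i (g k)) * v $ i))" for x v k
    by (auto simp: N_def matrix_vector_mult_def if_distrib[of "\<lambda>y. y * _"] cong: if_cong)
  have pN: "pfun (\<lambda>x. N x $ k $ i)" for k i
    by (cases "k \<in> range j") (auto simp: N_def)
  \<comment> \<open>At \<open>x0\<close>, a vector in the kernel has all coordinates
    \<open>j c\<close> zero, and the forms \<open>l k\<close> then determine its other coordinates
    as 0.\<close>
  have "v = 0" if "N x0 *v v = 0" for v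
  proof -
    have 0: "(if k \<in> range j then v $ k else (\<Sum>i\<in>UNIV. l k $ i * v $ i)) = 0" for k
      using Nv[of x0 v k, unfolded g(2)] that by simp
    then have "v $ j c = 0" for c by (metis rangeI)
    then have "v $ k = 0" for k
      using 0[of k, unfolded l] by (auto split: if_splits)
    then show ?thesis by (simp add: vec_eq_iff)
  qed
  then have "\<exists>M. M ** N x0 = mat 1" unfolding matrix_left_invertible_ker by blast
  then have d0: "det (N x0) \<noteq> 0"
    using invertible_det_nz invertible_left_inverse by blast
  show thesis
  proof (rule that[of "\<lambda>x. det (N x)" "\<lambda>x. cramer_frame (N x) j"])
    show "pfun (\<lambda>x. det (N x))" by (intro pfun_det pN)
    have "pfun (\<lambda>x. (if q = i then axis (j c) 1 $ r else N x $ r $ q))" for q i c r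
      using pN by (cases "q = i") auto
    then show "pfun (\<lambda>x. minors (cramer_frame (N x) j) $ i)" for i
      unfolding minors_def cramer_frame_def vec_lambda_beta
      by (intro pfun_det) (simp only: vec_lambda_beta, intro pfun_det, simp only: vec_lambda_beta)
    show "det (N x0) \<noteq> 0" by fact
    fix x assume dimx: "vec.dim (tangent_space X x) = CARD('d)" and d: "det (N x) \<noteq> 0"
    \<comment> \<open>The equations \<open>g k\<close> hold on all of \<open>X\<close>, so this
      applies at each such \<open>x\<close>; equality with the span follows by comparing
      dimensions.\<close>
    have "(N x *v v) $ k = (if k \<in> range j then v $ k else 0)" if "v \<in> tangent_space X x" for v k
      unfolding Nv using that g(1) by (simp add: tangent_space_def)
    then have "tangent_space X x \<subseteq> vec.span (range (cramer_frame (N x) j))"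
      by (rule subset_span_cramer_frame[OF d])
    from dim_le_span_range[OF this subspace_tangent_space dimx]
    show "lin_indep (cramer_frame (N x) j) \<and> vec.span (range (cramer_frame (N x) j)) = tangent_space X x"
      by simp
  qed
qed

section \<open>Membership in the closures, tested over the torus\<close>

lemma log_frame_plucker_coords:
  fixes t :: "'k::alg_closed_field ^ 'd::finite" and \<gamma> :: "'n::finite \<Rightarrow> int ^ 'd"
  assumes "int_span \<gamma> = UNIV" "t \<in> torus"
  shows "(torus_point \<gamma> t, minors (log_frame \<gamma> (torus_point \<gamma> t)))
    \<in> plucker_coords (torus_point \<gamma> t, tangent_space (toric_variety \<gamma>) (torus_point \<gamma> t))"
  unfolding plucker_coords_iff
  using tangent_space_torus_point[OF assms] lin_indep_log_frame[OF assms(1) torus_point_nonzero[OF assms(2)]]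
  by auto

lemma dim_tangent_space_torus_point:
  fixes t :: "'k::alg_closed_field ^ 'd::finite" and \<gamma> :: "'n::finite \<Rightarrow> int ^ 'd"
  assumes "int_span \<gamma> = UNIV" "t \<in> torus"
  shows "vec.dim (tangent_space (toric_variety \<gamma>) (torus_point \<gamma> t)) = CARD('d)"
  unfolding tangent_space_torus_point[OF assms]
  by (intro dim_span_range lin_indep_log_frame assms(1) torus_point_nonzero[OF assms(2)])

lemma tangent_space_Gr:
  fixes X :: "('k::field ^ 'n::finite) set"
  shows "vec.dim (tangent_space X x) = m \<Longrightarrow> tangent_space X x \<in> Gr m"
  by (simp add: Gr_def subspace_tangent_space)

text \<open>A test function that vanishes over the torus vanishes on the whole graph of the Gauss
  map: near a smooth point it becomes polynomial through a local frame, and the torus is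
  dense.\<close>

lemma in_nash_blowup_iff:
  fixes \<gamma> :: "'n::finite \<Rightarrow> int ^ 'd::finite" and P :: "('k::alg_closed_field ^ 'n) \<times> ('k ^ 'n) set"
  assumes \<gamma>: "int_span \<gamma> = UNIV"
  shows "P \<in> nash_blowup TYPE('d) (toric_variety \<gamma>) \<longleftrightarrow> P \<in> toric_variety \<gamma> \<times> Gr CARD('d) \<and>
    (\<forall>e h. hfun e h \<longrightarrow> (\<forall>t\<in>torus. h (torus_point \<gamma> t, minors (log_frame \<gamma> (torus_point \<gamma> t))) = 0) \<longrightarrow>
       (\<forall>z\<in>(plucker_coords P :: (_ \<times> ('k ^ ('d \<Rightarrow> 'n))) set). h z = 0))"
proof -
  let ?X = "toric_variety \<gamma> :: ('k ^ 'n) set"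
  let ?co = "plucker_coords :: (_, 'k, 'n, 'd \<Rightarrow> 'n) coords"
  let ?S = "{(x, tangent_space ?X x) | x. x \<in> ?X - singular_locus ?X}"
  interpret coordinates ?co "?X \<times> Gr CARD('d)" by (rule coordinates_plucker)
  have smooth: "x \<in> ?X - singular_locus ?X \<longleftrightarrow> x \<in> ?X \<and> vec.dim (tangent_space ?X x) = CARD('d)" for x
    by (auto simp: singular_locus_def alg_dim_toric_variety[OF \<gamma>])
  have S: "?S \<subseteq> ?X \<times> Gr CARD('d)"
    unfolding smooth by (auto intro: tangent_space_Gr)
  have "(\<forall>Q\<in>?S. \<forall>z\<in>?co Q. h z = 0) \<longleftrightarrow>
      (\<forall>t\<in>torus. h (torus_point \<gamma> t, minors (log_frame \<gamma> (torus_point \<gamma> t))) = 0)"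
    (is "?A \<longleftrightarrow> ?B") if h: "hfun e h" for e h
  proof
    assume ?A
    show ?B
    proof
      fix t :: "'k ^ 'd" assume t: "t \<in> torus"
      have "(torus_point \<gamma> t, tangent_space ?X (torus_point \<gamma> t)) \<in> ?S"
        unfolding smooth using torus_point_in_toric_variety[OF t] dim_tangent_space_torus_point[OF \<gamma> t] by blast
      with \<open>?A\<close> log_frame_plucker_coords[OF \<gamma> t]
      show "h (torus_point \<gamma> t, minors (log_frame \<gamma> (torus_point \<gamma> t))) = 0" by blast
    qed
  next
    assume B: ?B
    have "h z = 0" if x0: "x0 \<in> ?X" "vec.dim (tangent_space ?X x0) = CARD('d)"
      and z: "z \<in> ?co (x0, tangent_space ?X x0)" for x0 z
    proof -
      obtain \<delta> :: "'k ^ 'n \<Rightarrow> 'k" and H :: "'k ^ 'n \<Rightarrow> 'd \<Rightarrow> 'k ^ 'n"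
      where H: "pfun \<delta>" "\<And>i. pfun (\<lambda>x. minors (H x) $ i)" "\<delta> x0 \<noteq> 0"
        "\<And>x. vec.dim (tangent_space ?X x) = CARD('d) \<Longrightarrow> \<delta> x \<noteq> 0 \<Longrightarrow>
           lin_indep (H x) \<and> vec.span (range (H x)) = tangent_space ?X x"
        using local_polynomial_frame[OF x0(2)] by metis
      have HZ: "(x, minors (H x)) \<in> ?co (x, tangent_space ?X x)"
        if "vec.dim (tangent_space ?X x) = CARD('d)" "\<delta> x \<noteq> 0" for x
        unfolding plucker_coords_iff using H(4)[OF that] by auto
      \<comment> \<open>The factor \<open>\<delta>\<close> makes the function vanish where the frame
        fails. Elsewhere on the torus this frame and the logarithmic one span the same
        subspace.\<close>
      have "\<delta> x0 * h (x0, minors (H x0)) = 0"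
      proof (rule pfun_vanish_toric[OF _ _ x0(1)])
        show "pfun (\<lambda>x. \<delta> x * h (x, minors (H x)))"
          by (intro pfun_mult H(1) pfun_hfun_subst[OF h] H(2))
        fix t :: "'k ^ 'd" assume t: "t \<in> torus"
        let ?x = "torus_point \<gamma> t"
        have "h (?x, minors (H ?x)) = 0" if "\<delta> ?x \<noteq> 0"
        proof -
          have "(?x, tangent_space ?X ?x) \<in> ?X \<times> Gr CARD('d)"
            using torus_point_in_toric_variety[OF t] dim_tangent_space_torus_point[OF \<gamma> t]
            by (auto intro: tangent_space_Gr)
          from vanish_cong[OF h this log_frame_plucker_coords[OF \<gamma> t] HZ[OF dim_tangent_space_torus_point[OF \<gamma> t] that]]
          show ?thesis using B t by blast
        qed
        then show "\<delta> ?x * h (?x, minors (H ?x)) = 0" by auto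
      qed
      then have "h (x0, minors (H x0)) = 0" using H(3) by simp
      moreover have "(x0, tangent_space ?X x0) \<in> ?X \<times> Gr CARD('d)"
        using x0 by (auto intro: tangent_space_Gr)
      ultimately show ?thesis
        using vanish_cong[OF h _ HZ[OF x0(2) H(3)] z] by blast
    qed
    then show ?A unfolding smooth by blast
  qed
  then have "(\<forall>e h. hfun e h \<longrightarrow> (\<forall>Q\<in>?S. \<forall>z\<in>?co Q. h z = 0) \<longrightarrow> (\<forall>z\<in>?co P. h z = 0)) \<longleftrightarrow>
     (\<forall>e h. hfun e h \<longrightarrow> (\<forall>t\<in>torus. h (torus_point \<gamma> t, minors (log_frame \<gamma> (torus_point \<gamma> t))) = 0) \<longrightarrow>
       (\<forall>z\<in>?co P. h z = 0))"
    by (intro all_cong1 imp_cong refl)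
  then show ?thesis
    unfolding nash_blowup_def in_closure_zariski_iff[OF S] by (intro conj_cong refl)
qed

text \<open>Here the map to projective space is polynomial from the start, so density of the torus
  applies directly.\<close>

lemma in_blowup_iff:
  fixes \<gamma> :: "'n::finite \<Rightarrow> int ^ 'd::finite" and P :: "('k::alg_closed_field ^ 'n) \<times> ('k ^ 'r::finite) set"
    and F :: "'r \<Rightarrow> ('n, 'k) mpoly"
  defines "\<Phi> \<equiv> \<lambda>x. \<chi> j. eval_poly (($) x) (F j)"
  assumes nz: "\<And>t :: 'k ^ 'd. t \<in> torus \<Longrightarrow> \<Phi> (torus_point \<gamma> t) \<noteq> 0"
  shows "P \<in> blowup (toric_variety \<gamma>) F \<longleftrightarrow> P \<in> toric_variety \<gamma> \<times> Gr 1 \<and>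
    (\<forall>e h. hfun e h \<longrightarrow> (\<forall>t\<in>torus. h (torus_point \<gamma> t, \<Phi> (torus_point \<gamma> t)) = 0) \<longrightarrow>
       (\<forall>z\<in>proj_coords P. h z = 0))"
proof -
  let ?X = "toric_variety \<gamma> :: ('k ^ 'n) set"
  let ?co = "proj_coords :: (_, 'k, 'n, 'r) coords"
  let ?S = "{(x, vec.span {\<Phi> x}) | x. x \<in> ?X \<and> \<Phi> x \<noteq> 0}"
  interpret coordinates ?co "?X \<times> Gr 1" by (rule coordinates_proj)
  have S: "?S \<subseteq> ?X \<times> Gr 1" by (auto simp del: One_nat_def intro: span_singleton_Gr)
  have "(\<forall>Q\<in>?S. \<forall>z\<in>?co Q. h z = 0) \<longleftrightarrow> (\<forall>t\<in>torus. h (torus_point \<gamma> t, \<Phi> (torus_point \<gamma> t)) = 0)"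
    (is "?A \<longleftrightarrow> ?B") if h: "hfun e h" for e h
  proof
    assume A: ?A
    show ?B
    proof
      fix t :: "'k ^ 'd" assume t: "t \<in> torus"
      let ?x = "torus_point \<gamma> t"
      have "(?x, \<Phi> ?x) \<in> ?co (?x, vec.span {\<Phi> ?x})"
        unfolding proj_coords_span using nz[OF t] by (auto intro: exI[of _ 1])
      moreover have "(?x, vec.span {\<Phi> ?x}) \<in> ?S"
        using nz[OF t] torus_point_in_toric_variety[OF t] by blast
      ultimately show "h (?x, \<Phi> ?x) = 0" using A by blast
    qed
  next
    assume B: ?B
    have "h z = 0" if x: "x \<in> ?X" "\<Phi> x \<noteq> 0" and z: "z \<in> ?co (x, vec.span {\<Phi> x})" for x z
    proof -
      have "h (x, \<Phi> x) = 0"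
      proof (rule pfun_vanish_toric[OF _ _ x(1)])
        show "pfun (\<lambda>x. h (x, \<Phi> x))"
          by (rule pfun_hfun_subst[OF h]) (auto simp: \<Phi>_def)
      qed (use B in blast)
      moreover obtain c where "z = (x, c *s \<Phi> x)" using z proj_coords_span by blast
      ultimately show ?thesis by (simp add: hfun_scale[OF h])
    qed
    then show ?A by blast
  qed
  then have "(\<forall>e h. hfun e h \<longrightarrow> (\<forall>Q\<in>?S. \<forall>z\<in>?co Q. h z = 0) \<longrightarrow> (\<forall>z\<in>?co P. h z = 0)) \<longleftrightarrow>
     (\<forall>e h. hfun e h \<longrightarrow> (\<forall>t\<in>torus. h (torus_point \<gamma> t, \<Phi> (torus_point \<gamma> t)) = 0) \<longrightarrow>
       (\<forall>z\<in>?co P. h z = 0))"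
    by (intro all_cong1 imp_cong refl)
  note closure_condition = this
  have "blowup ?X F = zariski ?co (?X \<times> Gr 1) closure_of ?S"
    unfolding blowup_def \<Phi>_def by (simp add: vec_eq_iff)
  then show ?thesis
    by (simp only: in_closure_zariski_iff[OF S] closure_condition)
qed

subsection \<open>The logarithmic Jacobian ideal\<close>

text \<open>Sorts the values of \<open>i\<close>. It reconciles Pluecker indices, which are
  arbitrary maps, with the increasing ones that generate the ideal.\<close>

lemma ex_strict_mono_rearrangement:
  fixes i :: "'d::{finite,linorder} \<Rightarrow> 'n::linorder"
  assumes "inj i"
  obtains \<sigma> where "\<sigma> permutes UNIV" "strict_mono (i \<circ> \<sigma>)"
proof -
  define xs where "xs = sorted_list_of_set (range i)"
  \<comment> \<open>The position of \<open>b\<close> in the order of \<open>'d\<close>, counted from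
    0.\<close>
  define r where "r b = card {..<b}" for b :: 'd
  define i' where "i' b = xs ! r b" for b
  have card: "card (range i) = CARD('d)" using assms by (rule card_image)
  have len: "length xs = CARD('d)" by (simp add: xs_def card)
  have r_less: "r b < CARD('d)" for b
    unfolding r_def by (rule psubset_card_mono) auto
  have r_mono: "r a < r b" if "a < b" for a b
    unfolding r_def using that by (intro psubset_card_mono) auto
  have mono: "strict_mono i'"
  proof (rule strict_monoI)
    fix a b :: 'd assume "a < b"
    moreover have "sorted_wrt (<) xs" unfolding xs_def by (rule strict_sorted_list_of_set)
    ultimately show "i' a < i' b"
      unfolding i'_def using r_mono r_less len sorted_wrt_nth_less[of "(<)" xs "r a" "r b"] by simp
  qed
  then have inj': "inj i'" by (rule strict_mono_imp_inj_on)
  have "range i' \<subseteq> range i"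
  proof
    fix x assume "x \<in> range i'"
    then obtain b where "x = xs ! r b" by (auto simp: i'_def)
    then have "x \<in> set xs" using r_less[of b] len by simp
    then show "x \<in> range i" by (simp add: xs_def)
  qed
  moreover have "card (range i') = card (range i)" using inj' card by (simp add: card_image)
  ultimately have range: "range i' = range i" by (intro card_subset_eq) auto
  define \<sigma> where "\<sigma> = inv i \<circ> i'"
  have i\<sigma>: "i \<circ> \<sigma> = i'"
  proof
    fix b
    have "i' b \<in> range i" using range by blast
    then show "(i \<circ> \<sigma>) b = i' b" by (simp add: \<sigma>_def f_inv_into_f)
  qed
  have "inj \<sigma>" using inj' i\<sigma> by (metis inj_on_imageI2)
  then have "bij \<sigma>" by (simp add: bij_def finite_UNIV_inj_surj)
  then have "\<sigma> permutes UNIV" by (intro bij_imp_permutes) auto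
  with mono i\<sigma> that show thesis by metis
qed

lemma ideal_in_incl: "s \<in> S \<Longrightarrow> 1 \<in> R \<Longrightarrow> s \<in> ideal_in R S"
  unfolding ideal_in_def by (intro CollectI exI[of _ "{s}"] exI[of _ "\<lambda>_. 1"]) auto

lemma one_in_toric_ring: "1 \<in> toric_ring \<gamma>"
  unfolding toric_ring_def by (metis rangeI toric_hom_one)

text \<open>\<open>ideal_in\<close> sums over distinct ring elements, although several indices may
  give the same one; one index is chosen for each element used, and all others get coefficient
  0.\<close>

lemma ideal_in_toric_ring_image:
  assumes "y \<in> ideal_in (toric_ring \<gamma>) (f ` J)" "finite J"
  obtains a where "y = (\<Sum>j\<in>J. toric_hom \<gamma> (a j) * f j)"
proof -
  obtain T c where T: "y = (\<Sum>s\<in>T. c s * s)" "T \<subseteq> f ` J" "c ` T \<subseteq> range (toric_hom \<gamma>)"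
    using assms(1) unfolding ideal_in_def toric_ring_def by blast
  have "\<forall>s\<in>T. \<exists>j\<in>J. f j = s" using T(2) by blast
  then obtain k where k: "\<And>s. s \<in> T \<Longrightarrow> k s \<in> J \<and> f (k s) = s" by metis
  have "\<forall>s\<in>T. \<exists>r. c s = toric_hom \<gamma> r" using T(3) by blast
  then obtain r where r: "\<And>s. s \<in> T \<Longrightarrow> c s = toric_hom \<gamma> (r s)" by metis
  define a where "a j = (if j \<in> k ` T then r (f j) else 0)" for j
  have inj: "inj_on k T" using k by (metis inj_onI)
  have "y = (\<Sum>s\<in>T. toric_hom \<gamma> (a (k s)) * f (k s))"
    unfolding T(1) using k r by (intro sum.cong) (auto simp: a_def)
  also have "\<dots> = (\<Sum>j\<in>k ` T. toric_hom \<gamma> (a j) * f j)"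
    by (simp add: sum.reindex[OF inj])
  also have "\<dots> = (\<Sum>j\<in>J. toric_hom \<gamma> (a j) * f j)"
    using k assms(2) by (intro sum.mono_neutral_left) (auto simp: a_def toric_hom_zero)
  finally show thesis by (rule that)
qed

definition monom_of :: "('d::finite \<Rightarrow> 'n::finite) \<Rightarrow> ('n, 'k::comm_ring_1) mpoly" where
  "monom_of i = (\<Prod>b\<in>UNIV. Poly_Mapping.single (Poly_Mapping.single (i b) 1) 1)"

lemma eval_monom_of: "eval_poly (($) x) (monom_of i) = (\<Prod>b\<in>UNIV. x $ i b)"
  by (simp only: monom_of_def eval_poly_prod eval_poly_simps(6))

lemma toric_hom_monom_of:
  fixes \<gamma> :: "'n::finite \<Rightarrow> int ^ 'd::finite"
  shows "toric_hom \<gamma> (monom_of i) = Poly_Mapping.single (\<Sum>b\<in>UNIV. \<gamma> (i b)) (1 :: 'k::comm_ring_1)"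
proof -
  have "weight \<gamma> (Poly_Mapping.single v 1) = \<gamma> v" for v
  proof -
    have "weight \<gamma> (Poly_Mapping.single v 1) = (\<Sum>j\<in>UNIV. if j = v then \<gamma> v else 0)"
      unfolding weight_def by (intro sum.cong) (auto simp: lookup_single when_def)
    then show ?thesis by simp
  qed
  moreover have "(\<Prod>b\<in>S. Poly_Mapping.single (f b) (1 :: 'k)) = Poly_Mapping.single (\<Sum>b\<in>S. f b) 1"
    for f :: "'a \<Rightarrow> int ^ 'd" and S
    by (induction S rule: infinite_finite_induct) (simp_all add: mult_single)
  ultimately show ?thesis
    by (simp only: monom_of_def toric_hom_prod toric_hom_single)
qed

lemma of_int_det: "of_int (det A) = det (\<chi> a b. (of_int (A $ a $ b) :: 'k::field))" for A :: "int ^ 'm ^ 'm"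
  by (simp add: det_def)

text \<open>Column \<open>b\<close> carries the common factor \<open>x $ i b\<close>. What remains
  is the image in the field of the determinant of the exponents.\<close>

lemma minors_log_frame:
  fixes x :: "'k::field ^ 'n::finite"
  shows "minors (log_frame \<gamma> x) $ i = of_int (det (\<chi> a b. \<gamma> (i b) $ a)) * eval_poly (($) x) (monom_of i)"
proof -
  have "minors (log_frame \<gamma> x) $ i = det (transpose (\<chi> b. x $ i b *s (\<chi> a. of_int (\<gamma> (i b) $ a))))"
    unfolding minors_def log_frame_def by (simp add: transpose_def)
  also have "\<dots> = (\<Prod>b\<in>UNIV. x $ i b) * det (transpose (\<chi> a b. of_int (\<gamma> (i b) $ a)))"
    unfolding det_transpose[of "\<chi> b. x $ i b *s (\<chi> a. of_int (\<gamma> (i b) $ a))"] det_rows_mul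
    by (simp add: transpose_def del: det_transpose)
  finally show ?thesis
    by (simp add: of_int_det eval_monom_of mult.commute)
qed

text \<open>Equal ideals in the coordinate ring let each family be expressed in the other. Lifted to
  polynomials, the expressions hold at the points of the variety.\<close>

lemma log_jacobian_generators:
  fixes \<gamma> :: "'n::{finite,linorder} \<Rightarrow> int ^ 'd::{finite,linorder}"
    and F :: "'r::finite \<Rightarrow> ('n, 'k::field) mpoly"
  assumes p: "CHAR('k) = p"
    and F: "ideal_in (toric_ring \<gamma>) (range (\<lambda>j. toric_hom \<gamma> (F j))) = log_jacobian_ideal p \<gamma>"
  obtains a :: "('d \<Rightarrow> 'n) \<Rightarrow> 'r \<Rightarrow> ('k, 'n) vec \<Rightarrow> 'k" and b :: "'r \<Rightarrow> ('d \<Rightarrow> 'n) \<Rightarrow> ('k, 'n) vec \<Rightarrow> 'k"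
  where "\<And>i j. pfun (a i j)" "\<And>i j. pfun (b j i)"
    "\<And>x i. x \<in> toric_variety \<gamma> \<Longrightarrow> minors (log_frame \<gamma> x) $ i = (\<Sum>j\<in>UNIV. a i j x * eval_poly (($) x) (F j))"
    "\<And>x j. x \<in> toric_variety \<gamma> \<Longrightarrow> eval_poly (($) x) (F j) = (\<Sum>i\<in>UNIV. b j i x * minors (log_frame \<gamma> x) $ i)"
proof -
  define D :: "('d \<Rightarrow> 'n) \<Rightarrow> 'k" where "D i = of_int (det (\<chi> a b. \<gamma> (i b) $ a))" for i
  define J where "J = {i :: 'd \<Rightarrow> 'n. strict_mono i \<and> D i \<noteq> 0}"
  have G: "minors (log_frame \<gamma> x) $ i = D i * eval_poly (($) x) (monom_of i)" for x i
    by (simp add: minors_log_frame D_def)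
  \<comment> \<open>The characteristic enters here: an integer is zero in the field exactly if
    \<open>p\<close> divides it.\<close>
  have D: "det (\<chi> a b. \<gamma> (i b) $ a) mod int p \<noteq> 0 \<longleftrightarrow> D i \<noteq> 0" for i
    unfolding D_def of_int_eq_0_iff_char_dvd p by (simp add: dvd_eq_mod_eq_0)
  have "{Poly_Mapping.single (\<Sum>b\<in>UNIV. \<gamma> (i b)) 1 | i :: 'd \<Rightarrow> 'n.
        strict_mono i \<and> det (\<chi> a b. \<gamma> (i b) $ a) mod int p \<noteq> 0}
      = (\<lambda>i. toric_hom \<gamma> (monom_of i) :: ('d, 'k) laurent) ` J"
    unfolding D J_def toric_hom_monom_of by blast
  then have ideal: "ideal_in (toric_ring \<gamma>) (range (\<lambda>j. toric_hom \<gamma> (F j)))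
      = ideal_in (toric_ring \<gamma>) ((\<lambda>i. toric_hom \<gamma> (monom_of i)) ` J)"
    unfolding F log_jacobian_ideal_def by simp
  have "\<exists>b. toric_hom \<gamma> (F j) = (\<Sum>i\<in>J. toric_hom \<gamma> (b i) * toric_hom \<gamma> (monom_of i))" for j
  proof -
    have "toric_hom \<gamma> (F j) \<in> ideal_in (toric_ring \<gamma>) ((\<lambda>i. toric_hom \<gamma> (monom_of i)) ` J)"
      unfolding ideal[symmetric] by (intro ideal_in_incl one_in_toric_ring rangeI)
    then obtain b where "toric_hom \<gamma> (F j) = (\<Sum>i\<in>J. toric_hom \<gamma> (b i) * toric_hom \<gamma> (monom_of i))"
      by (rule ideal_in_toric_ring_image[OF _ finite])
    then show ?thesis by (rule exI[of _ b])
  qed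
  then have "\<exists>b. \<forall>j. toric_hom \<gamma> (F j) = (\<Sum>i\<in>J. toric_hom \<gamma> (b j i) * toric_hom \<gamma> (monom_of i))"
    by (intro choice allI)
  then obtain b where b: "\<And>j. toric_hom \<gamma> (F j) = (\<Sum>i\<in>J. toric_hom \<gamma> (b j i) * toric_hom \<gamma> (monom_of i))"
    by (elim exE) simp
  have "\<exists>a. toric_hom \<gamma> (monom_of i) = (\<Sum>j\<in>UNIV. toric_hom \<gamma> (a j) * toric_hom \<gamma> (F j))" if "i \<in> J" for i
  proof -
    have "toric_hom \<gamma> (monom_of i) \<in> ideal_in (toric_ring \<gamma>) (range (\<lambda>j. toric_hom \<gamma> (F j)))"
      unfolding ideal using that by (intro ideal_in_incl one_in_toric_ring imageI)
    then obtain a where "toric_hom \<gamma> (monom_of i) = (\<Sum>j\<in>UNIV. toric_hom \<gamma> (a j) * toric_hom \<gamma> (F j))"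
      by (rule ideal_in_toric_ring_image[OF _ finite])
    then show ?thesis by (rule exI[of _ a])
  qed
  then have "\<forall>i\<in>J. \<exists>a. toric_hom \<gamma> (monom_of i) = (\<Sum>j\<in>UNIV. toric_hom \<gamma> (a j) * toric_hom \<gamma> (F j))"
    by (rule ballI)
  from bchoice[OF this] obtain a where a: "\<And>i. i \<in> J \<Longrightarrow>
      toric_hom \<gamma> (monom_of i) = (\<Sum>j\<in>UNIV. toric_hom \<gamma> (a i j) * toric_hom \<gamma> (F j))"
    by (elim exE) simp
  have Fx: "eval_poly (($) x) (F j) = (\<Sum>i\<in>J. eval_poly (($) x) (b j i) * eval_poly (($) x) (monom_of i))"
    if "x \<in> toric_variety \<gamma>" for x j
    using eval_cong_toric_hom[OF that, of "F j" "\<Sum>i\<in>J. b j i * monom_of i"]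
    by (simp add: b toric_hom_sum toric_hom_mult eval_poly_simps(2,4))
  have Mx: "eval_poly (($) x) (monom_of i) = (\<Sum>j\<in>UNIV. eval_poly (($) x) (a i j) * eval_poly (($) x) (F j))"
    if "x \<in> toric_variety \<gamma>" "i \<in> J" for x i
    using eval_cong_toric_hom[OF that(1), of "monom_of i" "\<Sum>j\<in>UNIV. a i j * F j"]
    by (simp add: a[OF that(2)] toric_hom_sum toric_hom_mult eval_poly_simps(2,4))
  \<comment> \<open>A nonzero determinant forces \<open>i\<close> to be injective. Sorting it keeps
    the monomial and changes the determinant only by a sign.\<close>
  have "\<exists>i'\<in>J. \<forall>x. eval_poly (($) x) (monom_of i) = eval_poly (($) (x :: ('k, 'n) vec)) (monom_of i')" if Di: "D i \<noteq> 0" for i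
  proof -
    have "inj i"
    proof (rule injI, rule ccontr)
      fix c c' assume *: "i c = i c'" "c \<noteq> c'"
      have "det (\<chi> a b. \<gamma> (i b) $ a) = 0"
        by (rule det_identical_columns[OF *(2)]) (simp add: column_def *(1))
      then show False using Di by (simp add: D_def)
    qed
    then obtain \<sigma> where \<sigma>: "\<sigma> permutes UNIV" "strict_mono (i \<circ> \<sigma>)"
      by (rule ex_strict_mono_rearrangement)
    have "D (i \<circ> \<sigma>) = of_int (sign \<sigma>) * D i"
      using det_permute_columns[OF \<sigma>(1), of "\<chi> a b. \<gamma> (i b) $ a"] by (simp add: D_def)
    then have "D (i \<circ> \<sigma>) \<noteq> 0" using Di by (auto simp: sign_def)
    with \<sigma> have "i \<circ> \<sigma> \<in> J" by (simp add: J_def)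
    moreover have "eval_poly (($) x) (monom_of i) = eval_poly (($) x) (monom_of (i \<circ> \<sigma>))" for x :: "('k, 'n) vec"
      using prod.permute[OF \<sigma>(1), of "\<lambda>b. x $ i b"] by (simp add: eval_monom_of o_def)
    ultimately show ?thesis by blast
  qed
  then obtain \<tau> where \<tau>: "\<And>i. D i \<noteq> 0 \<Longrightarrow> \<tau> i \<in> J"
    "\<And>i x. D i \<noteq> 0 \<Longrightarrow> eval_poly (($) x) (monom_of i) = eval_poly (($) (x :: ('k, 'n) vec)) (monom_of (\<tau> i))"
    by metis
  show thesis
  \<comment> \<open>A minor is \<open>D i\<close> times the monomial of the sorted index
    \<open>\<tau> i\<close>; conversely only the minors with index in \<open>J\<close> are used,
    divided by the unit \<open>D i\<close>.\<close>
  proof (rule that[of "\<lambda>i j x. D i * eval_poly (($) x) (a (\<tau> i) j)"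
        "\<lambda>j i x. (if i \<in> J then inverse (D i) else 0) * eval_poly (($) x) (b j i)"])
    fix x :: "('k, 'n) vec" and i j assume x: "x \<in> toric_variety \<gamma>"
    show "minors (log_frame \<gamma> x) $ i = (\<Sum>j\<in>UNIV. D i * eval_poly (($) x) (a (\<tau> i) j) * eval_poly (($) x) (F j))"
    proof (cases "D i = 0")
      case False
      then show ?thesis
        by (simp add: G \<tau>(2) Mx[OF x \<tau>(1)] sum_distrib_left mult.assoc)
    qed (simp add: G)
    have "eval_poly (($) x) (F j) = (\<Sum>i\<in>J. inverse (D i) * eval_poly (($) x) (b j i) * minors (log_frame \<gamma> x) $ i)"
      unfolding Fx[OF x] G by (intro sum.cong) (auto simp: J_def)
    also have "\<dots> = (\<Sum>i\<in>UNIV. (if i \<in> J then inverse (D i) else 0) * eval_poly (($) x) (b j i) * minors (log_frame \<gamma> x) $ i)"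
      by (intro sum.mono_neutral_cong_left) auto
    finally show "eval_poly (($) x) (F j) =
      (\<Sum>i\<in>UNIV. (if i \<in> J then inverse (D i) else 0) * eval_poly (($) x) (b j i) * minors (log_frame \<gamma> x) $ i)" .
  qed (intro pfun_mult pfun_const pfun_eval)+
qed

theorem theorem1:
  fixes \<gamma> :: "'n::{finite,linorder} \<Rightarrow> int ^ 'd::{finite,linorder}"
    and F :: "'r::finite \<Rightarrow> ('n, 'k::alg_closed_field) mpoly"
    and p :: nat
  assumes "CHAR('k) = p" and "p > 0"
    and "int_span \<gamma> = UNIV"
    and "ideal_in (toric_ring \<gamma>) (range (\<lambda>j. toric_hom \<gamma> (F j))) = log_jacobian_ideal p \<gamma>"
  shows "isomorphic_over_base
    (plucker_coords :: (_, _, _, 'd \<Rightarrow> 'n) coords) (nash_blowup TYPE('d) (toric_variety \<gamma>))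
    proj_coords (blowup (toric_variety \<gamma>) F)"
proof -
  note \<gamma> = assms(3)
  let ?X = "toric_variety \<gamma> :: (('k, 'n) vec) set"
  let ?co = "plucker_coords :: (_, 'k, 'n, 'd \<Rightarrow> 'n) coords"
  let ?co' = "proj_coords :: (_, 'k, 'n, 'r) coords"
  let ?N = "nash_blowup TYPE('d) ?X" and ?B = "blowup ?X F"
  define G where "G x = minors (log_frame \<gamma> x)" for x :: "('k, 'n) vec"
  define \<Phi> where "\<Phi> x = (\<chi> j. eval_poly (($) x) (F j))" for x :: "('k, 'n) vec"
  obtain a :: "('d \<Rightarrow> 'n) \<Rightarrow> 'r \<Rightarrow> ('k, 'n) vec \<Rightarrow> 'k" and b :: "'r \<Rightarrow> ('d \<Rightarrow> 'n) \<Rightarrow> ('k, 'n) vec \<Rightarrow> 'k"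
  where ab: "\<And>i j. pfun (a i j)" "\<And>i j. pfun (b j i)"
    "\<And>x i. x \<in> ?X \<Longrightarrow> G x $ i = (\<Sum>j\<in>UNIV. a i j x * \<Phi> x $ j)"
    "\<And>x j. x \<in> ?X \<Longrightarrow> \<Phi> x $ j = (\<Sum>i\<in>UNIV. b j i x * G x $ i)"
    using log_jacobian_generators[OF assms(1,4)] unfolding G_def \<Phi>_def vec_lambda_beta by blast
  define L where "L z = (\<chi> j. \<Sum>i\<in>UNIV. b j i (fst z) * snd z $ i)" for z :: "(('k, 'n) vec) \<times> (('k, 'd \<Rightarrow> 'n) vec)"
  define L' where "L' z = (\<chi> i. \<Sum>j\<in>UNIV. a i j (fst z) * snd z $ j)" for z :: "(('k, 'n) vec) \<times> (('k, 'r) vec)"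
  have L: "hfun 1 (\<lambda>z. L z $ j)" for j
    unfolding L_def vec_lambda_beta
    using hfun_mult[OF hfun_pfun[OF ab(2)] hfun_snd] by (intro hfun_sum) simp
  have L': "hfun 1 (\<lambda>z. L' z $ i)" for i
    unfolding L'_def vec_lambda_beta
    using hfun_mult[OF hfun_pfun[OF ab(1)] hfun_snd] by (intro hfun_sum) simp
  let ?pt = "torus_point \<gamma> :: ('k, 'd) vec \<Rightarrow> ('k, 'n) vec"
  have LG: "L (?pt t, G (?pt t)) = \<Phi> (?pt t)" if "t \<in> torus" for t
    by (simp add: L_def vec_eq_iff ab(4)[OF torus_point_in_toric_variety[OF that], symmetric])
  have L'\<Phi>: "L' (?pt t, \<Phi> (?pt t)) = G (?pt t)" if "t \<in> torus" for t
    by (simp add: L'_def vec_eq_iff ab(3)[OF torus_point_in_toric_variety[OF that], symmetric])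
  have L'0: "L' (x, 0) = 0" and L0: "L (x, 0) = 0" for x
    by (simp_all add: L'_def L_def vec_eq_iff)
  \<comment> \<open>The matrix \<open>a\<close> carries \<open>\<Phi>\<close> to the Pluecker tuple
    of an independent frame, which is nonzero.\<close>
  have \<Phi>nz: "\<Phi> (?pt t) \<noteq> 0" if t: "t \<in> torus" for t
  proof
    assume "\<Phi> (?pt t) = 0"
    then have "G (?pt t) = 0" using L'\<Phi>[OF t] L'0 by simp
    then show False
      using lin_indep_imp_minors_nonzero[OF lin_indep_log_frame[OF \<gamma> torus_point_nonzero[OF t]]]
      by (simp add: G_def)
  qed
  have nash: "P \<in> ?N \<longleftrightarrow> P \<in> ?X \<times> Gr CARD('d) \<and>
      (\<forall>e h. hfun e h \<longrightarrow> (\<forall>t\<in>torus. h (?pt t, G (?pt t)) = 0) \<longrightarrow> (\<forall>z\<in>?co P. h z = 0))" for P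
    unfolding G_def by (rule in_nash_blowup_iff[OF \<gamma>])
  have blow: "P \<in> ?B \<longleftrightarrow> P \<in> ?X \<times> Gr 1 \<and>
      (\<forall>e h. hfun e h \<longrightarrow> (\<forall>t\<in>torus. h (?pt t, \<Phi> (?pt t)) = 0) \<longrightarrow> (\<forall>z\<in>?co' P. h z = 0))" for P
    unfolding \<Phi>_def by (rule in_blowup_iff) (use \<Phi>nz in \<open>simp add: \<Phi>_def\<close>)
  have NX: "P \<in> ?N \<Longrightarrow> P \<in> ?X \<times> Gr CARD('d)" for P
    by (rule nash[THEN iffD1, THEN conjunct1])
  have BX: "P \<in> ?B \<Longrightarrow> P \<in> ?X \<times> Gr 1" for P
    by (rule blow[THEN iffD1, THEN conjunct1])
  have N: "coordinates ?co ?N"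
    by (rule coordinates.restrict[OF coordinates_plucker[of ?X]]) (use NX in blast)
  have B: "coordinates ?co' ?B"
    by (rule coordinates.restrict[OF coordinates_proj[of ?X]]) (use BX in blast)
  interpret N: coordinates ?co ?N by (rule N)
  interpret B: coordinates ?co' ?B by (rule B)
  \<comment> \<open>Propagation: a homogeneous equation that holds for the tuples over the torus
    holds for every tuple of every point of the closure.\<close>
  have vanN: "h z = 0"
    if "P \<in> ?N" "z \<in> ?co P" "hfun e h" "\<And>t. t \<in> torus \<Longrightarrow> h (?pt t, G (?pt t)) = 0" for P z e h
    by (rule nash[THEN iffD1, OF that(1), THEN conjunct2, THEN spec[of _ e], THEN spec[of _ h], THEN mp,
          OF that(3), THEN mp, THEN bspec, OF _ that(2)]) (rule ballI, rule that(4))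
  have vanB: "h z = 0"
    if "P \<in> ?B" "z \<in> ?co' P" "hfun e h" "\<And>t. t \<in> torus \<Longrightarrow> h (?pt t, \<Phi> (?pt t)) = 0" for P z e h
    by (rule blow[THEN iffD1, OF that(1), THEN conjunct2, THEN spec[of _ e], THEN spec[of _ h], THEN mp,
          OF that(3), THEN mp, THEN bspec, OF _ that(2)]) (rule ballI, rule that(4))
  have inv: "L' (fst z, L z) = snd z" if P: "P \<in> ?N" "z \<in> ?co P" for P z
  proof -
    have "L' (fst z, L z) $ i - snd z $ i = 0" for i
      by (rule vanN[OF P hfun_diff[OF hfun_subst[OF L' L] hfun_snd]]) (simp add: LG L'\<Phi>)
    then show ?thesis by (simp add: vec_eq_iff)
  qed
  have inv': "L (fst z, L' z) = snd z" if P: "P \<in> ?B" "z \<in> ?co' P" for P z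
  proof -
    have "L (fst z, L' z) $ i - snd z $ i = 0" for i
      by (rule vanB[OF P hfun_diff[OF hfun_subst[OF L L'] hfun_snd]]) (simp add: LG L'\<Phi>)
    then show ?thesis by (simp add: vec_eq_iff)
  qed
  show ?thesis
  proof (rule isomorphic_over_base_linear[OF N B L L'])
    fix P z assume P: "P \<in> ?N" "z \<in> ?co P"
    let ?Q = "(fst z, vec.span {L z})"
    \<comment> \<open>\<open>L'\<close> maps this tuple back to the nonzero tuple
      \<open>snd z\<close>.\<close>
    have nz: "L z \<noteq> 0" using inv[OF P] N.nonzero[OF P] L'0 by auto
    have "fst z \<in> ?X" using NX[OF P(1)] N.fst_co[OF P] by (simp add: mem_Times_iff)
    then have Q: "?Q \<in> ?X \<times> Gr 1" using span_singleton_Gr[OF nz] by simp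
    have vanish: "h z' = 0" if h: "hfun e h" "\<forall>t\<in>torus. h (?pt t, \<Phi> (?pt t)) = 0" and z': "z' \<in> ?co' ?Q" for e h z'
    proof -
      have "h (fst z, L z) = 0"
        by (rule vanN[OF P hfun_subst[OF h(1) L]]) (use h(2) in \<open>simp add: LG\<close>)
      moreover obtain c where "z' = (fst z, c *s L z)" using z' proj_coords_span by blast
      ultimately show ?thesis by (simp add: hfun_scale[OF h(1)])
    qed
    have "?Q \<in> ?B"
      unfolding blow by (intro conjI allI impI ballI Q) (rule vanish)
    moreover have "(fst z, L z) \<in> ?co' ?Q"
      unfolding proj_coords_span using nz by (auto intro: exI[of _ 1])
    ultimately show "\<exists>Q\<in>?B. (fst z, L z) \<in> ?co' Q" by blast
  next
    fix P z assume P: "P \<in> ?B" "z \<in> ?co' P"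
    have nz: "L' z \<noteq> 0" using inv'[OF P] B.nonzero[OF P] L0 by auto
    \<comment> \<open>Both sides have degree \<open>CARD('d) + 1\<close> in the homogeneous
      coordinates, and over the torus \<open>L' z\<close> is a tuple of minors, so the relation
      propagates.\<close>
    have "L' z $ j ^ CARD('d) * L' z $ i = L' z $ j * det (\<chi> c b. L' z $ (j(c := i b)))" for i j
    proof -
      have "hfun (CARD('d) * 1 + 1) (\<lambda>z. L' z $ j ^ CARD('d) * L' z $ i)"
        by (intro hfun_mult hfun_power L')
      moreover have "hfun (1 + CARD('d)) (\<lambda>z. L' z $ j * det (\<chi> c b. L' z $ (j(c := i b))))"
        by (intro hfun_mult hfun_det) (simp_all only: vec_lambda_beta L')
      ultimately have "hfun (1 + CARD('d))
          (\<lambda>z. L' z $ j ^ CARD('d) * L' z $ i - L' z $ j * det (\<chi> c b. L' z $ (j(c := i b))))"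
        by (intro hfun_diff) simp_all
      from vanB[OF P this]
      have "L' z $ j ^ CARD('d) * L' z $ i - L' z $ j * det (\<chi> c b. L' z $ (j(c := i b))) = 0"
        by (simp add: L'\<Phi> G_def minors_relation)
      then show ?thesis by simp
    qed
    from relation_imp_minors[OF nz this]
    obtain B where B: "lin_indep B" "minors B = L' z" by blast
    let ?Q = "(fst z, vec.span (range B))"
    have co: "(fst z, L' z) \<in> ?co ?Q" using B by (auto simp: plucker_coords_iff)
    have "fst z \<in> ?X" using BX[OF P(1)] B.fst_co[OF P] by (simp add: mem_Times_iff)
    then have Q: "?Q \<in> ?X \<times> Gr CARD('d)"
      using dim_span_range[OF B(1)] by (simp add: Gr_def del: vec.dim_span)
    have vanish: "h z' = 0" if h: "hfun e h" "\<forall>t\<in>torus. h (?pt t, G (?pt t)) = 0" and z': "z' \<in> ?co ?Q" for e h z'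
    proof -
      have "h (fst z, L' z) = 0"
        by (rule vanB[OF P hfun_subst[OF h(1) L']]) (use h(2) in \<open>simp add: L'\<Phi>\<close>)
      then show ?thesis
        using coordinates.vanish_cong[OF coordinates_plucker h(1) Q co z'] by simp
    qed
    have "?Q \<in> ?N"
      unfolding nash by (intro conjI allI impI ballI Q) (rule vanish)
    with co show "\<exists>Q\<in>?N. (fst z, L' z) \<in> ?co Q" by blast
  qed (fact inv inv')+
qed

end
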